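(* Let $\mathbb{F}$ be a finite field and $n\ge 1$. Let $\pi_1,\pi_2$ be two irreducible cuspidal representations of $\mathrm{GL}_n(\mathbb{F})$ and let $\chi_1,\chi_2:\mathbb{F}^\times\to\mathbb{C}^\times$ be two characters. Then the representation $\pi_1\times\pi_2$ of $\mathrm{GL}_{2n}(\mathbb{F})$ has a nonzero vector on which $\mathrm{GL}_n(\mathbb{F})\times\mathrm{GL}_n(\mathbb{F})$ operates by the character $\chi_1\times\chi_2$ if and only if one of the following two conditions holds: (1) $(\pi_1\otimes\chi_1^{-1})^\vee\cong\pi_2\otimes\chi_2^{-1}$; (2) $n=2m$ is even, $\pi_1$ contains a nonzero vector on which $\mathrm{GL}_m(\mathbb{F})\times\mathrm{GL}_m(\mathbb{F})$ operates via $\chi_1\times\chi_2$, and $\pi_2$ contains a nonzero vector on which $\mathrm{GL}_m(\mathbb{F})\times\mathrm{GL}_m(\mathbb{F})$ operates via $\chi_1\times\chi_2$. If $n>1$, then the dimension of the space of vectors in $\pi_1\times\pi_2$ on which $\mathrm{GL}_n(\mathbb{F})\times\mathrm{GL}_n(\mathbb{F})$ operates by $\chi_1\times\chi_2$ is the sum of the dimensions arising from these two options: condition (1), when it holds, contributes $1$, and condition (2), when it holds, contributes $m(\pi_1,\chi_1\times\chi_2)\cdot m(\pi_2,\chi_1\times\chi_2)$ (an option that does not hold contributes $0$).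
   Context: All representations are finite-dimensional and complex. $\pi_1\times\pi_2$ denotes the representation of $\mathrm{GL}_{2n}(\mathbb{F})$ parabolically induced from the representation $\pi_1\otimes\pi_2$ of the Levi subgroup $\mathrm{GL}_n(\mathbb{F})\times\mathrm{GL}_n(\mathbb{F})$ of the standard $(n,n)$-parabolic subgroup, extended trivially across the unipotent radical. For any $k$, $\mathrm{GL}_k(\mathbb{F})\times\mathrm{GL}_k(\mathbb{F})$ is embedded in $\mathrm{GL}_{2k}(\mathbb{F})$ as block-diagonal matrices, and $\chi_1\times\chi_2$ denotes its character $(g_1,g_2)\mapsto\chi_1(\det g_1)\chi_2(\det g_2)$. The twist $\pi\otimes\chi$ means $\pi\otimes(\chi\circ\det)$, and $\pi^\vee$ is the dual (contragredient) representation. For $n=2m$ and a representation $\pi$ of $\mathrm{GL}_n(\mathbb{F})$, $m(\pi,\chi_1\times\chi_2)=\dim\mathrm{Hom}_{\mathrm{GL}_m(\mathbb{F})\times\mathrm{GL}_m(\mathbb{F})}(\pi,\chi_1\times\chi_2)$. *)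

theory Defs
  imports
    Complex_Main
    "HOL-Algebra.Group"
    "HOL-Library.Function_Algebras"
    "Jordan_Normal_Form.Determinant"
begin

definition field_units :: "'f::field monoid" where
  "field_units = units_of \<lparr>carrier = UNIV, mult = (*), one = 1\<rparr>"

definition GL :: "nat \<Rightarrow> 'f::field mat monoid" where
  "GL n = units_of (ring_mat TYPE('f) n ())"

definition block_diag :: "nat \<Rightarrow> 'f::field mat \<Rightarrow> 'f mat \<Rightarrow> 'f mat" where
  "block_diag k g1 g2 = four_block_mat g1 (0\<^sub>m k k) (0\<^sub>m k k) g2"


text \<open>The space of a representation is a subspace \<open>rep_space\<close> of the complex vector space given by
  the type \<open>'v\<close> with scalar multiplication \<open>rep_scale\<close>; the values of \<open>rep_act\<close> outside the group
  or outside this subspace are irrelevant.\<close>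

record ('g, 'v) rep =
  rep_scale :: "complex \<Rightarrow> 'v \<Rightarrow> 'v"
  rep_space :: "'v set"
  rep_act :: "'g \<Rightarrow> 'v \<Rightarrow> 'v"

definition lin_on ::
  "'v set \<Rightarrow> (complex \<Rightarrow> 'v::ab_group_add \<Rightarrow> 'v) \<Rightarrow> (complex \<Rightarrow> 'w::ab_group_add \<Rightarrow> 'w) \<Rightarrow> ('v \<Rightarrow> 'w) \<Rightarrow> bool"
  where
  "lin_on V s1 s2 T \<longleftrightarrow>
     (\<forall>v\<in>V. \<forall>w\<in>V. T (v + w) = T v + T w) \<and> (\<forall>c. \<forall>v\<in>V. T (s1 c v) = s2 c (T v))"

definition is_rep :: "('g, 'b) monoid_scheme \<Rightarrow> ('g, 'v::ab_group_add) rep \<Rightarrow> bool" where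
  "is_rep G \<pi> \<longleftrightarrow>
     vector_space (rep_scale \<pi>) \<and>
     module.subspace (rep_scale \<pi>) (rep_space \<pi>) \<and>
     (\<exists>B. finite B \<and> rep_space \<pi> = module.span (rep_scale \<pi>) B) \<and>
     (\<forall>g\<in>carrier G. rep_act \<pi> g ` rep_space \<pi> \<subseteq> rep_space \<pi> \<and>
        lin_on (rep_space \<pi>) (rep_scale \<pi>) (rep_scale \<pi>) (rep_act \<pi> g)) \<and>
     (\<forall>v\<in>rep_space \<pi>. rep_act \<pi> \<one>\<^bsub>G\<^esub> v = v) \<and>
     (\<forall>g\<in>carrier G. \<forall>h\<in>carrier G. \<forall>v\<in>rep_space \<pi>.
        rep_act \<pi> (g \<otimes>\<^bsub>G\<^esub> h) v = rep_act \<pi> g (rep_act \<pi> h v))"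

definition irreducible_rep :: "('g, 'b) monoid_scheme \<Rightarrow> ('g, 'v::ab_group_add) rep \<Rightarrow> bool" where
  "irreducible_rep G \<pi> \<longleftrightarrow>
     is_rep G \<pi> \<and> rep_space \<pi> \<noteq> {0} \<and>
     (\<forall>W. module.subspace (rep_scale \<pi>) W \<and> W \<subseteq> rep_space \<pi> \<and>
          (\<forall>g\<in>carrier G. rep_act \<pi> g ` W \<subseteq> W) \<longrightarrow> W = {0} \<or> W = rep_space \<pi>)"

definition iso_rep ::
  "('g, 'b) monoid_scheme \<Rightarrow> ('g, 'v::ab_group_add) rep \<Rightarrow> ('g, 'w::ab_group_add) rep \<Rightarrow> bool" where
  "iso_rep G \<pi> \<sigma> \<longleftrightarrow>
     (\<exists>T. bij_betw T (rep_space \<pi>) (rep_space \<sigma>) \<and>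
          lin_on (rep_space \<pi>) (rep_scale \<pi>) (rep_scale \<sigma>) T \<and>
          (\<forall>g\<in>carrier G. \<forall>v\<in>rep_space \<pi>. T (rep_act \<pi> g v) = rep_act \<sigma> g (T v)))"

definition fun_scale :: "complex \<Rightarrow> ('x \<Rightarrow> complex) \<Rightarrow> 'x \<Rightarrow> complex" where
  "fun_scale c f = (\<lambda>x. c * f x)"

text \<open>A linear functional on the representation space is encoded as a function on the whole type
  that vanishes off that space, so that functionals are determined by their restriction to it.\<close>

definition functionals :: "('g, 'v::ab_group_add) rep \<Rightarrow> ('v \<Rightarrow> complex) set" where
  "functionals \<pi> =
     {\<phi>. lin_on (rep_space \<pi>) (rep_scale \<pi>) (*) \<phi> \<and> (\<forall>v. v \<notin> rep_space \<pi> \<longrightarrow> \<phi> v = 0)}"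

definition pullback :: "('g, 'v) rep \<Rightarrow> 'g \<Rightarrow> ('v \<Rightarrow> complex) \<Rightarrow> 'v \<Rightarrow> complex" where
  "pullback \<pi> g \<phi> = (\<lambda>v. if v \<in> rep_space \<pi> then \<phi> (rep_act \<pi> g v) else 0)"

definition dual_rep ::
  "('g, 'b) monoid_scheme \<Rightarrow> ('g, 'v::ab_group_add) rep \<Rightarrow> ('g, 'v \<Rightarrow> complex) rep" where
  "dual_rep G \<pi> =
     \<lparr>rep_scale = fun_scale, rep_space = functionals \<pi>,
      rep_act = (\<lambda>g. pullback \<pi> (inv\<^bsub>G\<^esub> g))\<rparr>"

definition twist :: "('f::field mat, 'v) rep \<Rightarrow> ('f \<Rightarrow> complex) \<Rightarrow> ('f mat, 'v) rep" where
  "twist \<pi> \<chi> = \<pi>\<lparr>rep_act := (\<lambda>g v. rep_scale \<pi> (\<chi> (det g)) (rep_act \<pi> g v))\<rparr>"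

text \<open>The tensor product of \<open>V\<^sub>1\<close> and \<open>V\<^sub>2\<close> is realised as the span of the pure tensors \<open>v \<otimes> w\<close>,
  viewed as functions \<open>(\<phi>, \<psi>) \<mapsto> \<phi> v * \<psi> w\<close> on pairs of linear functionals. Then
  \<open>(g\<^sub>1, g\<^sub>2)\<close> sends \<open>v \<otimes> w\<close> to \<open>g\<^sub>1 v \<otimes> g\<^sub>2 w\<close>.\<close>

definition pure_tensor ::
  "('g, 'v::ab_group_add) rep \<Rightarrow> ('h, 'w::ab_group_add) rep \<Rightarrow> 'v \<Rightarrow> 'w
    \<Rightarrow> ('v \<Rightarrow> complex) \<times> ('w \<Rightarrow> complex) \<Rightarrow> complex" where
  "pure_tensor \<pi>1 \<pi>2 v w =
     (\<lambda>(\<phi>, \<psi>). if \<phi> \<in> functionals \<pi>1 \<and> \<psi> \<in> functionals \<pi>2 then \<phi> v * \<psi> w else 0)"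

definition tensor_rep ::
  "('g, 'v::ab_group_add) rep \<Rightarrow> ('h, 'w::ab_group_add) rep
    \<Rightarrow> ('g \<times> 'h, ('v \<Rightarrow> complex) \<times> ('w \<Rightarrow> complex) \<Rightarrow> complex) rep" where
  "tensor_rep \<pi>1 \<pi>2 =
     \<lparr>rep_scale = fun_scale,
      rep_space =
        module.span fun_scale {pure_tensor \<pi>1 \<pi>2 v w |v w. v \<in> rep_space \<pi>1 \<and> w \<in> rep_space \<pi>2},
      rep_act = (\<lambda>(g1, g2) B (\<phi>, \<psi>).
        if \<phi> \<in> functionals \<pi>1 \<and> \<psi> \<in> functionals \<pi>2
        then B (pullback \<pi>1 g1 \<phi>, pullback \<pi>2 g2 \<psi>) else 0)\<rparr>"

text \<open>Induction from the standard \<open>(n, n)\<close>-parabolic: functions \<open>f\<close> on \<open>GL\<^sub>2\<^sub>n\<close> with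
  \<open>f (p g) = \<sigma> (p) (f g)\<close>, under right translation. They are extended by \<open>0\<close> to all matrices.\<close>

definition para_ind ::
  "nat \<Rightarrow> ('f::field mat \<times> 'f mat, 'v::ab_group_add) rep \<Rightarrow> ('f mat, 'f mat \<Rightarrow> 'v) rep" where
  "para_ind n \<sigma> =
     \<lparr>rep_scale = (\<lambda>c f g. rep_scale \<sigma> c (f g)),
      rep_space =
        {f. (\<forall>g\<in>carrier (GL (2 * n)). f g \<in> rep_space \<sigma>) \<and>
            (\<forall>g. g \<notin> carrier (GL (2 * n)) \<longrightarrow> f g = 0) \<and>
            (\<forall>A\<in>carrier (GL n). \<forall>D\<in>carrier (GL n). \<forall>X\<in>carrier_mat n n. \<forall>g\<in>carrier (GL (2 * n)).
               f (four_block_mat A X (0\<^sub>m n n) D * g) = rep_act \<sigma> (A, D) (f g))},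
      rep_act = (\<lambda>h f g. if g \<in> carrier (GL (2 * n)) then f (g * h) else 0)\<rparr>"

definition ind_prod ::
  "nat \<Rightarrow> ('f::field mat, 'v::ab_group_add) rep \<Rightarrow> ('f mat, 'w::ab_group_add) rep
    \<Rightarrow> ('f mat, 'f mat \<Rightarrow> ('v \<Rightarrow> complex) \<times> ('w \<Rightarrow> complex) \<Rightarrow> complex) rep" where
  "ind_prod n \<pi>1 \<pi>2 = para_ind n (tensor_rep \<pi>1 \<pi>2)"

text \<open>A set \<open>S \<subseteq> {1..<n}\<close> of cut points encodes a composition of \<open>n\<close>, hence a standard (block upper
  triangular) parabolic of \<open>GL\<^sub>n\<close>. The position \<open>(i, j)\<close> lies strictly above the block diagonal
  iff some \<open>s \<in> S\<close> satisfies \<open>i < s \<le> j\<close>.\<close>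

definition unipotent_radical :: "nat \<Rightarrow> nat set \<Rightarrow> 'f::field mat set" where
  "unipotent_radical n S =
     {u \<in> carrier_mat n n. (\<forall>i<n. u $$ (i, i) = 1) \<and>
        (\<forall>i<n. \<forall>j<n. i \<noteq> j \<and> \<not> (\<exists>s\<in>S. i < s \<and> s \<le> j) \<longrightarrow> u $$ (i, j) = 0)}"

text \<open>Every parabolic is conjugate to a standard one, so only the standard ones need be tested.\<close>

definition cuspidal :: "nat \<Rightarrow> ('f::field mat, 'v::ab_group_add) rep \<Rightarrow> bool" where
  "cuspidal n \<pi> \<longleftrightarrow>
     (\<forall>S. S \<noteq> {} \<and> S \<subseteq> {1..<n} \<longrightarrow>
        {v \<in> rep_space \<pi>. \<forall>u\<in>unipotent_radical n S. rep_act \<pi> u v = v} = {0})"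

definition char_vectors ::
  "nat \<Rightarrow> ('f::field mat, 'v::ab_group_add) rep \<Rightarrow> ('f \<Rightarrow> complex) \<Rightarrow> ('f \<Rightarrow> complex) \<Rightarrow> 'v set" where
  "char_vectors k \<pi> \<chi>1 \<chi>2 =
     {v \<in> rep_space \<pi>. \<forall>g1\<in>carrier (GL k). \<forall>g2\<in>carrier (GL k).
        rep_act \<pi> (block_diag k g1 g2) v = rep_scale \<pi> (\<chi>1 (det g1) * \<chi>2 (det g2)) v}"

definition hom_to_char ::
  "nat \<Rightarrow> ('f::field mat, 'v::ab_group_add) rep \<Rightarrow> ('f \<Rightarrow> complex) \<Rightarrow> ('f \<Rightarrow> complex) \<Rightarrow> ('v \<Rightarrow> complex) set"
  where
  "hom_to_char k \<pi> \<chi>1 \<chi>2 =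
     {\<phi> \<in> functionals \<pi>. \<forall>g1\<in>carrier (GL k). \<forall>g2\<in>carrier (GL k). \<forall>v\<in>rep_space \<pi>.
        \<phi> (rep_act \<pi> (block_diag k g1 g2) v) = \<chi>1 (det g1) * \<chi>2 (det g2) * \<phi> v}"

definition char_mult ::
  "nat \<Rightarrow> ('f::field mat, 'v::ab_group_add) rep \<Rightarrow> ('f \<Rightarrow> complex) \<Rightarrow> ('f \<Rightarrow> complex) \<Rightarrow> nat" where
  "char_mult k \<pi> \<chi>1 \<chi>2 = vector_space.dim fun_scale (hom_to_char k \<pi> \<chi>1 \<chi>2)"

end

theory Submission
  imports Defs "HOL-Computational_Algebra.Fundamental_Theorem_Algebra" "HOL-Number_Theory.Cong"
begin

text \<open>A vector of \<open>\<pi>\<^sub>1 \<times> \<pi>\<^sub>2\<close> on which \<open>H = GL\<^sub>n \<times> GL\<^sub>n\<close> acts by the character is a function \<open>f\<close> on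
  \<open>GL\<^sub>2\<^sub>n\<close>, equivariant under the parabolic \<open>P\<close> on the left and \<open>H\<close> on the right, whose values are bilinear forms
  on the duals of \<open>\<pi>\<^sub>1\<close> and \<open>\<pi>\<^sub>2\<close>. It is determined by its values at representatives of \<open>P \ GL\<^sub>2\<^sub>n / H\<close>. The
  coset of \<open>g\<close> is the \<open>H\<close>-orbit of the row space \<open>W\<close> of the lower half of \<open>g\<close> in \<open>E\<^sub>1 \<oplus> E\<^sub>2\<close>, classified by
  \<open>a = dim (W \<inter> E\<^sub>1)\<close> and \<open>b = dim (W \<inter> E\<^sub>2)\<close>; put \<open>c = n - a - b\<close>. If \<open>0 < c < n\<close>, the stabilizer of \<open>W\<close> contains
  unipotents acting on \<open>W\<close> as a full unipotent radical and trivially on the quotient by \<open>W\<close>, so that the value of \<open>f\<close>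
  vanishes by cuspidality of \<open>\<pi>\<^sub>2\<close>. If \<open>c = 0\<close>, the value is an eigenform for \<open>GL\<^sub>a \<times> GL\<^sub>b\<close> in both arguments; for
  \<open>n > 1\<close> a cuspidal representation has such eigenvectors only if \<open>a = b\<close>, and this orbit gives condition (2). If
  \<open>c = n\<close>, the value is a form invariant under the diagonal \<open>GL\<^sub>n\<close> up to a character; by Schur's lemma such a form
  exists exactly under condition (1) and is unique up to a scalar.\<close>

section \<open>General linear groups and block matrices\<close>

text \<open>Two languages have to be reconciled: condition (1) and the multiplicities speak of duals
  and functionals, whereas the induced side counts vectors. Bilinear forms on the two duals mediate.
  By reflexivity a slice of such a form is a vector, so that irreducibility and cuspidality apply to
  it; averaging over the finite group GL_m x GL_m matches eigenvectors with eigenfunctionals. That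
  eigenvectors are absent for a \<noteq> b rests on Fourier inversion over the abelian group of
  block unipotents: up to a nonzero factor a vector is the sum of its components, and each component
  vanishes separately. The two contributions are added by means of a dual system: lifts supported on
  a single double coset are the vectors, evaluations at the two representatives are the functionals.
  A value can be lifted only if it is compatible with the whole stabilizer, hence the effort to
  determine the stabilizers of these representatives from both sides. For n = 1 orbits with c = 0
  and a \<noteq> b can carry independent functions, which is why the dimension formula excludes that
  case.\<close>

lemma carrier_GL: "A \<in> carrier (GL n) \<longleftrightarrow> A \<in> carrier_mat n n \<and> det A \<noteq> 0"
proof
  assume "A \<in> carrier (GL n)"
  then have A: "A \<in> Units (ring_mat TYPE('a) n ())" by (simp add: GL_def units_of_def)
  then have "A \<in> carrier_mat n n" by (simp add: Units_def ring_mat_def)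
  with unit_imp_det_non_zero[OF A] show "A \<in> carrier_mat n n \<and> det A \<noteq> 0" by simp
next
  assume "A \<in> carrier_mat n n \<and> det A \<noteq> 0"
  then show "A \<in> carrier (GL n)"
    using det_non_zero_imp_unit[of A n "()"] by (simp add: GL_def units_of_def)
qed

lemma GL_carrier_mat: "A \<in> carrier (GL n) \<Longrightarrow> A \<in> carrier_mat n n"
  by (simp add: carrier_GL)

lemma mult_GL: "A \<otimes>\<^bsub>GL n\<^esub> B = A * B"
  by (simp add: GL_def units_of_def ring_mat_def)

lemma one_GL: "\<one>\<^bsub>GL n\<^esub> = 1\<^sub>m n"
  by (simp add: GL_def units_of_def ring_mat_def)

lemma group_GL: "group (GL n)"
proof -
  interpret ring "ring_mat TYPE('a::field) n ()" by (rule ring_mat)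
  show "group (GL n :: 'a mat monoid)" unfolding GL_def by (rule units_group)
qed

lemma GL_mult_closed: "A \<in> carrier (GL n) \<Longrightarrow> B \<in> carrier (GL n) \<Longrightarrow> A * B \<in> carrier (GL n)"
  by (auto simp: carrier_GL det_mult)

lemma GL_one: "1\<^sub>m n \<in> carrier (GL n)"
  by (simp add: carrier_GL)

lemma GL_inv:
  assumes "A \<in> carrier (GL n)"
  shows "inv\<^bsub>GL n\<^esub> A \<in> carrier (GL n)" "A * inv\<^bsub>GL n\<^esub> A = 1\<^sub>m n" "inv\<^bsub>GL n\<^esub> A * A = 1\<^sub>m n"
proof -
  interpret group "GL n :: 'a mat monoid" by (rule group_GL)
  show "inv\<^bsub>GL n\<^esub> A \<in> carrier (GL n)" using assms by simp
  show "A * inv\<^bsub>GL n\<^esub> A = 1\<^sub>m n" using r_inv[OF assms] by (simp add: mult_GL one_GL)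
  show "inv\<^bsub>GL n\<^esub> A * A = 1\<^sub>m n" using l_inv[OF assms] by (simp add: mult_GL one_GL)
qed

lemma GL_obtain_inv:
  assumes "A \<in> carrier (GL n)"
  obtains B where "B \<in> carrier (GL n)" "A * B = 1\<^sub>m n" "B * A = 1\<^sub>m n"
  using GL_inv[OF assms] by blast

lemma finite_carrier_mat: "finite (carrier_mat nr nc :: 'a::finite mat set)"
proof -
  let ?I = "{..<nr} \<times> {..<nc}"
  have "carrier_mat nr nc \<subseteq> mat nr nc ` (?I \<rightarrow>\<^sub>E (UNIV :: 'a set))"
  proof
    fix A :: "'a mat" assume A: "A \<in> carrier_mat nr nc"
    have "A = mat nr nc (restrict (\<lambda>ij. A $$ ij) ?I)"
      using A by (intro eq_matI) auto
    then show "A \<in> mat nr nc ` (?I \<rightarrow>\<^sub>E UNIV)"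
      by (rule image_eqI[where f = "mat nr nc"]) simp
  qed
  moreover have "finite (?I \<rightarrow>\<^sub>E (UNIV :: 'a set))" by (intro finite_PiE) auto
  ultimately show ?thesis by (rule finite_subset[OF _ finite_imageI])
qed

lemma finite_GL: "finite (carrier (GL n :: 'a::{field,finite} mat monoid))"
  by (rule finite_subset[OF _ finite_carrier_mat[of n n]]) (auto simp: carrier_GL)

lemma GL_four_block_upper:
  assumes "A \<in> carrier (GL a)" "D \<in> carrier (GL b)" "X \<in> carrier_mat a b"
  shows "four_block_mat A X (0\<^sub>m b a) D \<in> carrier (GL (a + b))"
    "det (four_block_mat A X (0\<^sub>m b a) D) = det A * det D"
  using assms det_four_block_mat_lower_left_zero[of A a X b "0\<^sub>m b a" D]
  by (auto simp: carrier_GL)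

lemma GL_four_block_lower:
  assumes "A \<in> carrier (GL a)" "D \<in> carrier (GL b)" "X \<in> carrier_mat b a"
  shows "four_block_mat A (0\<^sub>m a b) X D \<in> carrier (GL (a + b))"
    "det (four_block_mat A (0\<^sub>m a b) X D) = det A * det D"
  using assms det_four_block_mat_upper_right_zero[of A a "0\<^sub>m a b" b X D]
  by (auto simp: carrier_GL)

lemma four_block_mat_eqD:
  assumes "A \<in> carrier_mat a c" "B \<in> carrier_mat a d" "C \<in> carrier_mat b c" "D \<in> carrier_mat b d"
    and "A' \<in> carrier_mat a c" "B' \<in> carrier_mat a d" "C' \<in> carrier_mat b c" "D' \<in> carrier_mat b d"
    and eq: "four_block_mat A B C D = four_block_mat A' B' C' D'"
  shows "A = A'" "B = B'" "C = C'" "D = D'"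
proof -
  have e: "four_block_mat A B C D $$ (i,j) = four_block_mat A' B' C' D' $$ (i,j)" for i j
    by (simp add: eq)
  show "A = A'"
  proof (rule eq_matI)
    fix i j assume "i < dim_row A'" "j < dim_col A'"
    then show "A $$ (i,j) = A' $$ (i,j)" using e[of i j] assms(1-8) by auto
  qed (use assms in auto)
  show "B = B'"
  proof (rule eq_matI)
    fix i j assume "i < dim_row B'" "j < dim_col B'"
    then show "B $$ (i,j) = B' $$ (i,j)" using e[of i "j + c"] assms(1-8) by auto
  qed (use assms in auto)
  show "C = C'"
  proof (rule eq_matI)
    fix i j assume "i < dim_row C'" "j < dim_col C'"
    then show "C $$ (i,j) = C' $$ (i,j)" using e[of "i + a" j] assms(1-8) by auto
  qed (use assms in auto)
  show "D = D'"
  proof (rule eq_matI)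
    fix i j assume "i < dim_row D'" "j < dim_col D'"
    then show "D $$ (i,j) = D' $$ (i,j)" using e[of "i + a" "j + c"] assms(1-8) by auto
  qed (use assms in auto)
qed

lemma four_block_mat_cases:
  assumes "A \<in> carrier_mat (a + b) (c + d)"
  obtains A1 A2 A3 A4 where "A1 \<in> carrier_mat a c" "A2 \<in> carrier_mat a d"
    "A3 \<in> carrier_mat b c" "A4 \<in> carrier_mat b d" "A = four_block_mat A1 A2 A3 A4"
proof -
  obtain A1 A2 A3 A4 where "split_block A a c = (A1, A2, A3, A4)" by (metis prod_cases4)
  from split_block[OF this, of b d] assms that show ?thesis by auto
qed


section \<open>Rank normal form\<close>

definition rank_mat :: "nat \<Rightarrow> nat \<Rightarrow> nat \<Rightarrow> 'a::{zero,one} mat" where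
  "rank_mat nr nc r = mat nr nc (\<lambda>(i, j). if i = j \<and> i < r then 1 else 0)"

lemma rank_mat_carrier [simp]: "rank_mat nr nc r \<in> carrier_mat nr nc"
  by (simp add: rank_mat_def)

lemma move_entry_to_corner:
  fixes A :: "'a::field mat"
  assumes A: "A \<in> carrier_mat nr nc" and "i < nr" "j < nc"
  obtains P Q where "P \<in> carrier (GL nr)" "Q \<in> carrier (GL nc)" "(P * A * Q) $$ (0, 0) = A $$ (i, j)"
proof
  let ?P = "swaprows_mat nr 0 i :: 'a mat" and ?Q = "swaprows_mat nc 0 j :: 'a mat"
  show "?P \<in> carrier (GL nr)" "?Q \<in> carrier (GL nc)"
    using swaprows_mat_Unit[of 0 nr i, where 'a = 'a and b = "()"]
      swaprows_mat_Unit[of 0 nc j, where 'a = 'a and b = "()"] assms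
    by (auto simp: GL_def units_of_def)
  have PA: "?P * A = swaprows 0 i A" using swaprows_mat[OF A, of 0 i] assms by simp
  have "?P * A * ?Q = swapcols 0 j (?P * A)"
    using swapcols_mat[OF mult_carrier_mat[OF swaprows_mat_carrier A], of 0 j 0 i] assms by simp
  then show "(?P * A * ?Q) $$ (0, 0) = A $$ (i, j)"
    using assms by (simp add: PA)
qed

lemma sandwich_mult:
  fixes A :: "'a::semiring_1 mat"
  assumes "P \<in> carrier_mat nr nr" "P' \<in> carrier_mat nr nr" "A \<in> carrier_mat nr nc"
    "Q \<in> carrier_mat nc nc" "Q' \<in> carrier_mat nc nc"
  shows "P * (P' * A * Q') * Q = (P * P') * A * (Q' * Q)"
proof -
  have "P * (P' * A * Q') = P * (P' * A) * Q'"
    by (rule assoc_mult_mat[symmetric]) (use assms in auto)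
  also have "P * (P' * A) = P * P' * A"
    by (rule assoc_mult_mat[symmetric]) (use assms in auto)
  finally have "P * (P' * A * Q') * Q = P * P' * A * Q' * Q" by simp
  also have "\<dots> = P * P' * A * (Q' * Q)"
    by (rule assoc_mult_mat[of _ nr nc _ nc _ nc]) (use assms in auto)
  finally show ?thesis .
qed

text \<open>Elimination by induction on the rows: once a nonzero entry sits in the corner, one lower
  and one upper block triangular factor clear its column and row, and the induction hypothesis
  treats the Schur complement \<open>B'\<close>.\<close>

lemma rank_normal_form:
  fixes A :: "'a::field mat"
  assumes "A \<in> carrier_mat nr nc"
  shows "\<exists>P\<in>carrier (GL nr). \<exists>Q\<in>carrier (GL nc). \<exists>r\<le>min nr nc. P * A * Q = rank_mat nr nc r"
  using assms
proof (induction nr arbitrary: nc A)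
  case 0
  then have "1\<^sub>m 0 * A * 1\<^sub>m nc = rank_mat 0 nc 0" by (intro eq_matI) (auto simp: rank_mat_def)
  then show ?case using GL_one[of 0] GL_one[of nc] by blast
next
  case (Suc nr)
  show ?case
  proof (cases "A = 0\<^sub>m (Suc nr) nc")
    case True
    then have "1\<^sub>m (Suc nr) * A * 1\<^sub>m nc = rank_mat (Suc nr) nc 0"
      by (intro eq_matI) (auto simp: rank_mat_def)
    then show ?thesis using GL_one[of "Suc nr"] GL_one[of nc] by blast
  next
    case False
    then obtain i j where ij: "i < Suc nr" "j < nc" "A $$ (i, j) \<noteq> 0"
      using Suc.prems by (metis carrier_matD eq_matI index_zero_mat)
    then obtain nc' where nc: "nc = Suc nc'" by (cases nc) auto
    obtain P0 Q0 where PQ0: "P0 \<in> carrier (GL (Suc nr))" "Q0 \<in> carrier (GL nc)"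
      and corner: "(P0 * A * Q0) $$ (0, 0) = A $$ (i, j)"
      using move_entry_to_corner[OF Suc.prems ij(1,2)] .
    note c0 = PQ0[THEN GL_carrier_mat]
    have "P0 * A * Q0 \<in> carrier_mat (1 + nr) (1 + nc')" using c0 Suc.prems nc by simp
    then obtain a x y B where bl: "a \<in> carrier_mat 1 1" "x \<in> carrier_mat 1 nc'" "y \<in> carrier_mat nr 1"
      "B \<in> carrier_mat nr nc'" "P0 * A * Q0 = four_block_mat a x y B"
      by (rule four_block_mat_cases)
    \<comment> \<open>Inverse of the pivot: \<open>L\<close> normalises the corner to 1 and clears
      the column below it, after which \<open>R\<close> clears the row.\<close>
    define \<beta> where "\<beta> = inverse (a $$ (0, 0))"
    have a0: "a $$ (0, 0) \<noteq> 0" using corner ij bl by simp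
    define L where "L = four_block_mat (\<beta> \<cdot>\<^sub>m 1\<^sub>m 1) (0\<^sub>m 1 nr) (- (\<beta> \<cdot>\<^sub>m y)) (1\<^sub>m nr)"
    define R where "R = four_block_mat (1\<^sub>m 1) (- (\<beta> \<cdot>\<^sub>m x)) (0\<^sub>m nc' 1) (1\<^sub>m nc')"
    define B' where "B' = - (\<beta> \<cdot>\<^sub>m y) * x + B"
    have L: "L \<in> carrier (GL (Suc nr))"
      using GL_four_block_lower(1)[of "\<beta> \<cdot>\<^sub>m 1\<^sub>m 1" 1 "1\<^sub>m nr" nr "- (\<beta> \<cdot>\<^sub>m y)"] a0 bl
      by (simp add: L_def carrier_GL \<beta>_def)
    have R: "R \<in> carrier (GL nc)"
      using GL_four_block_upper(1)[of "1\<^sub>m 1" 1 "1\<^sub>m nc'" nc' "- (\<beta> \<cdot>\<^sub>m x)"] bl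
      by (simp add: R_def carrier_GL nc)
    have B': "B' \<in> carrier_mat nr nc'" using bl by (simp add: B'_def)
    have "L * (P0 * A * Q0) = four_block_mat ((\<beta> \<cdot>\<^sub>m 1\<^sub>m 1) * a + 0\<^sub>m 1 nr * y)
        ((\<beta> \<cdot>\<^sub>m 1\<^sub>m 1) * x + 0\<^sub>m 1 nr * B) (- (\<beta> \<cdot>\<^sub>m y) * a + 1\<^sub>m nr * y) (- (\<beta> \<cdot>\<^sub>m y) * x + 1\<^sub>m nr * B)"
      unfolding L_def bl(5) by (rule mult_four_block_mat) (use bl in auto)
    also have "(\<beta> \<cdot>\<^sub>m 1\<^sub>m 1) * a + 0\<^sub>m 1 nr * y = 1\<^sub>m 1"
      using bl a0 by (intro eq_matI) (auto simp: \<beta>_def scalar_prod_def)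
    also have "(\<beta> \<cdot>\<^sub>m 1\<^sub>m 1) * x + 0\<^sub>m 1 nr * B = \<beta> \<cdot>\<^sub>m x"
      using bl by (intro eq_matI) (auto simp: \<beta>_def scalar_prod_def)
    also have "- (\<beta> \<cdot>\<^sub>m y) * a + 1\<^sub>m nr * y = 0\<^sub>m nr 1"
      using bl a0 by (intro eq_matI) (auto simp: \<beta>_def scalar_prod_def)
    also have "- (\<beta> \<cdot>\<^sub>m y) * x + 1\<^sub>m nr * B = B'" using bl by (simp add: B'_def)
    finally have LA: "L * (P0 * A * Q0) = four_block_mat (1\<^sub>m 1) (\<beta> \<cdot>\<^sub>m x) (0\<^sub>m nr 1) B'" .
    have "L * (P0 * A * Q0) * R = four_block_mat (1\<^sub>m 1 * 1\<^sub>m 1 + (\<beta> \<cdot>\<^sub>m x) * 0\<^sub>m nc' 1)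
        (1\<^sub>m 1 * (- (\<beta> \<cdot>\<^sub>m x)) + (\<beta> \<cdot>\<^sub>m x) * 1\<^sub>m nc') (0\<^sub>m nr 1 * 1\<^sub>m 1 + B' * 0\<^sub>m nc' 1)
        (0\<^sub>m nr 1 * (- (\<beta> \<cdot>\<^sub>m x)) + B' * 1\<^sub>m nc')"
      unfolding LA R_def by (rule mult_four_block_mat) (use bl B' in auto)
    also have "\<dots> = four_block_mat (1\<^sub>m 1) (0\<^sub>m 1 nc') (0\<^sub>m nr 1) B'"
      using bl B' by (intro cong_four_block_mat) (auto intro!: eq_matI)
    finally have LAR: "L * (P0 * A * Q0) * R = four_block_mat (1\<^sub>m 1) (0\<^sub>m 1 nc') (0\<^sub>m nr 1) B'" .
    obtain P1 Q1 r where PQ1: "P1 \<in> carrier (GL nr)" "Q1 \<in> carrier (GL nc')" and r: "r \<le> min nr nc'"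
      and eq: "P1 * B' * Q1 = rank_mat nr nc' r"
      using Suc.IH[OF B'] by blast
    note c1 = PQ1[THEN GL_carrier_mat]
    define P2 where "P2 = four_block_mat (1\<^sub>m 1) (0\<^sub>m 1 nr) (0\<^sub>m nr 1) P1"
    define Q2 where "Q2 = four_block_mat (1\<^sub>m 1) (0\<^sub>m 1 nc') (0\<^sub>m nc' 1) Q1"
    have P2: "P2 \<in> carrier (GL (Suc nr))" and Q2: "Q2 \<in> carrier (GL nc)"
      using GL_four_block_upper(1)[of "1\<^sub>m 1" 1 P1 nr "0\<^sub>m 1 nr"] PQ1
        GL_four_block_upper(1)[of "1\<^sub>m 1" 1 Q1 nc' "0\<^sub>m 1 nc'"]
      by (simp_all add: P2_def Q2_def nc GL_one)
    have "P2 * (L * (P0 * A * Q0) * R) = four_block_mat (1\<^sub>m 1) (0\<^sub>m 1 nc') (0\<^sub>m nr 1) (P1 * B')"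
      unfolding LAR P2_def
      by (subst mult_four_block_mat[of _ 1 1 _ nr _ nr _ _ 1 _ nc']) (use c1 B' in auto)
    then have "P2 * (L * (P0 * A * Q0) * R) * Q2
        = four_block_mat (1\<^sub>m 1) (0\<^sub>m 1 nc') (0\<^sub>m nr 1) (P1 * B')
          * four_block_mat (1\<^sub>m 1) (0\<^sub>m 1 nc') (0\<^sub>m nc' 1) Q1"
      by (simp add: Q2_def)
    also have "\<dots> = four_block_mat (1\<^sub>m 1) (0\<^sub>m 1 nc') (0\<^sub>m nr 1) (P1 * B' * Q1)"
      by (subst mult_four_block_mat[of _ 1 1 _ nc' _ nr _ _ 1 _ nc']) (use c1 B' in auto)
    also have "\<dots> = rank_mat (Suc nr) nc (Suc r)"
      unfolding eq by (intro eq_matI) (auto simp: rank_mat_def nc)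
    also have "P2 * (L * (P0 * A * Q0) * R) * Q2 = (P2 * (L * P0)) * A * (Q0 * R * Q2)"
      using c0 P2[THEN GL_carrier_mat] Q2[THEN GL_carrier_mat] L[THEN GL_carrier_mat]
        R[THEN GL_carrier_mat] Suc.prems
      by (simp add: sandwich_mult[of _ "Suc nr" _ _ nc] del: assoc_mult_mat)
    finally have "P2 * (L * P0) * A * (Q0 * R * Q2) = rank_mat (Suc nr) nc (Suc r)" .
    moreover have "P2 * (L * P0) \<in> carrier (GL (Suc nr))" "Q0 * R * Q2 \<in> carrier (GL nc)"
      using P2 Q2 L R PQ0 by (simp_all add: GL_mult_closed)
    moreover have "Suc r \<le> min (Suc nr) nc" using r nc by simp
    ultimately show ?thesis by blast
  qed
qed

section \<open>Double cosets of the parabolic and the Levi subgroup\<close>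

lemma mult_right_inverse_mat:
  fixes M :: "'a::semiring_1 mat"
  assumes "M \<in> carrier_mat m n" "Q \<in> carrier_mat n n" "Q' \<in> carrier_mat n n" "Q * Q' = 1\<^sub>m n"
  shows "M * Q * Q' = M"
  using assms assoc_mult_mat[OF assms(1-3)] by simp

lemma mult_left_inverse_mat:
  fixes M :: "'a::semiring_1 mat"
  assumes "M \<in> carrier_mat n m" "Q \<in> carrier_mat n n" "Q' \<in> carrier_mat n n" "Q' * Q = 1\<^sub>m n"
  shows "Q' * (Q * M) = M"
  using assms assoc_mult_mat[OF assms(3,2,1)] by simp

section \<open>Coordinate projections and the orbit representatives\<close>

definition coord_proj :: "nat \<Rightarrow> nat set \<Rightarrow> 'a::{zero,one} mat" where
  "coord_proj n S = mat n n (\<lambda>(i, j). if i = j \<and> i \<in> S then 1 else 0)"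

lemma coord_proj_carrier [simp]: "coord_proj n S \<in> carrier_mat n n"
  "dim_row (coord_proj n S) = n" "dim_col (coord_proj n S) = n"
  by (simp_all add: coord_proj_def)

lemma coord_proj_UNIV: "{..<n} \<subseteq> S \<Longrightarrow> coord_proj n S = 1\<^sub>m n"
  by (intro eq_matI) (auto simp: coord_proj_def)

lemma coord_proj_empty: "{..<n} \<inter> S = {} \<Longrightarrow> coord_proj n S = 0\<^sub>m n n"
  by (intro eq_matI) (auto simp: coord_proj_def)

lemma coord_proj_block:
  "coord_proj (a + b) {..<a} = four_block_mat (1\<^sub>m a) (0\<^sub>m a b) (0\<^sub>m b a) (0\<^sub>m b b)"
  "coord_proj (a + b) (- {..<a}) = four_block_mat (0\<^sub>m a a) (0\<^sub>m a b) (0\<^sub>m b a) (1\<^sub>m b)"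
  "coord_proj (a + b) {a..} = four_block_mat (0\<^sub>m a a) (0\<^sub>m a b) (0\<^sub>m b a) (1\<^sub>m b)"
  by (intro eq_matI; auto simp: coord_proj_def)+

lemma coord_proj_mult:
  fixes A :: "'a::semiring_1 mat"
  assumes "A \<in> carrier_mat n m"
  shows "coord_proj n S * A = mat n m (\<lambda>(i, j). if i \<in> S then A $$ (i, j) else 0)"
proof (rule eq_matI)
  fix i j assume ij: "i < dim_row (mat n m (\<lambda>(i, j). if i \<in> S then A $$ (i, j) else 0))"
    "j < dim_col (mat n m (\<lambda>(i, j). if i \<in> S then A $$ (i, j) else 0))"
  then have "(coord_proj n S * A) $$ (i, j) = (\<Sum>k<n. (if i = k \<and> i \<in> S then 1 else 0) * A $$ (k, j))"
    using assms by (simp add: coord_proj_def scalar_prod_def lessThan_atLeast0)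
  also have "\<dots> = (\<Sum>k<n. if k = i then if i \<in> S then A $$ (i, j) else 0 else 0)"
    by (rule sum.cong) auto
  finally have "(coord_proj n S * A) $$ (i, j) = \<dots>" .
  then show "(coord_proj n S * A) $$ (i, j) = mat n m (\<lambda>(i, j). if i \<in> S then A $$ (i, j) else 0) $$ (i, j)"
    using ij by simp
qed (use assms in auto)

lemma mult_coord_proj:
  fixes A :: "'a::semiring_1 mat"
  assumes "A \<in> carrier_mat m n"
  shows "A * coord_proj n S = mat m n (\<lambda>(i, j). if j \<in> S then A $$ (i, j) else 0)"
proof (rule eq_matI)
  fix i j assume ij: "i < dim_row (mat m n (\<lambda>(i, j). if j \<in> S then A $$ (i, j) else 0))"
    "j < dim_col (mat m n (\<lambda>(i, j). if j \<in> S then A $$ (i, j) else 0))"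
  then have "(A * coord_proj n S) $$ (i, j) = (\<Sum>k<n. A $$ (i, k) * (if k = j \<and> k \<in> S then 1 else 0))"
    using assms by (simp add: coord_proj_def scalar_prod_def lessThan_atLeast0)
  also have "\<dots> = (\<Sum>k<n. if k = j then if j \<in> S then A $$ (i, j) else 0 else 0)"
    by (rule sum.cong) auto
  finally have "(A * coord_proj n S) $$ (i, j) = \<dots>" .
  then show "(A * coord_proj n S) $$ (i, j) = mat m n (\<lambda>(i, j). if j \<in> S then A $$ (i, j) else 0) $$ (i, j)"
    using ij by simp
qed (use assms in auto)

text \<open>With \<open>S = {..<r}\<close> and \<open>T = {..<c} \<union> {r..}\<close> the lower half has \<open>a = r - c\<close> and \<open>b = n - r\<close> in the notation of
  the introduction.\<close>

definition orbit_mat :: "nat \<Rightarrow> nat set \<Rightarrow> nat set \<Rightarrow> 'a::field mat" where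
  "orbit_mat n S T = four_block_mat (coord_proj n (- S)) (coord_proj n S) (coord_proj n S) (coord_proj n T)"

text \<open>The two lower blocks commute, so the determinant is that of a single n x n matrix. It is
  diagonal with entries -1 on \<open>S\<close> and, since the complement of \<open>S\<close> lies in
  \<open>T\<close>, entries 1 elsewhere.\<close>

lemma orbit_mat_GL:
  assumes "S \<union> T = UNIV"
  shows "orbit_mat n S T \<in> carrier (GL (2 * n) :: 'a::field mat monoid)"
proof -
  let ?E = "coord_proj n S :: 'a mat" and ?E' = "coord_proj n (- S) :: 'a mat" and ?F = "coord_proj n T :: 'a mat"
  let ?M = "mat n n (\<lambda>(i, j). if i = j then if i \<in> S then - 1 else 1 else 0) :: 'a mat"
  have "det (orbit_mat n S T :: 'a mat) = det (?E' * ?F - ?E * ?E)"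
    unfolding orbit_mat_def
    by (rule det_four_block_mat) (auto simp: coord_proj_mult[of _ n n] intro!: eq_matI, auto simp: coord_proj_def)
  also have "?E' * ?F - ?E * ?E = ?M"
    using assms by (auto simp: coord_proj_mult[of _ n n] intro!: eq_matI, auto simp: coord_proj_def)
  also have "det ?M = prod_list (diag_mat ?M)"
    by (rule det_upper_triangular[of _ n]) auto
  also have "\<dots> \<noteq> 0" by (auto simp: diag_mat_def prod_list_zero_iff)
  finally show ?thesis by (simp add: carrier_GL orbit_mat_def mult_2)
qed

lemma block_diag_carrier [simp]:
  "g1 \<in> carrier_mat k k \<Longrightarrow> g2 \<in> carrier_mat k k \<Longrightarrow> block_diag k g1 g2 \<in> carrier_mat (2 * k) (2 * k)"
  by (simp add: block_diag_def mult_2)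

lemma block_diag_mult:
  assumes "g1 \<in> carrier_mat k k" "g2 \<in> carrier_mat k k" "h1 \<in> carrier_mat k k" "h2 \<in> carrier_mat k k"
  shows "block_diag k (g1 * h1) (g2 * h2) = block_diag k g1 g2 * block_diag k h1 h2"
  unfolding block_diag_def
  by (subst mult_four_block_mat[of _ k k _ k _ k _ _ k _ k]) (use assms in auto)

lemma block_diag_one: "block_diag k (1\<^sub>m k) (1\<^sub>m k) = 1\<^sub>m (2 * k)"
  by (simp add: block_diag_def mult_2)

lemma block_diag_GL:
  assumes "g1 \<in> carrier (GL k)" "g2 \<in> carrier (GL k)"
  shows "block_diag k g1 g2 \<in> carrier (GL (2 * k))" "det (block_diag k g1 g2) = det g1 * det g2"
  using GL_four_block_upper[OF assms, of "0\<^sub>m k k"] by (simp_all add: block_diag_def mult_2)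

lemma parabolic_GL:
  assumes "A \<in> carrier (GL n)" "D \<in> carrier (GL n)" "X \<in> carrier_mat n n"
  shows "four_block_mat A X (0\<^sub>m n n) D \<in> carrier (GL (2 * n))"
  using GL_four_block_upper(1)[OF assms] by (simp add: mult_2)

text \<open>The quotient of the two matrices has the lower half of the identity, so it lies in the
  parabolic; its block \<open>P\<close> is invertible because the whole quotient is. Hence only
  lower halves need to be classified.\<close>

lemma same_lower_blocks:
  assumes g: "four_block_mat A B C D \<in> carrier (GL (2 * n))"
    and g': "four_block_mat A' B' C D \<in> carrier (GL (2 * n))"
    and c: "A \<in> carrier_mat n n" "B \<in> carrier_mat n n" "C \<in> carrier_mat n n" "D \<in> carrier_mat n n"
      "A' \<in> carrier_mat n n" "B' \<in> carrier_mat n n"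
  shows "\<exists>P\<in>carrier (GL n). \<exists>X\<in>carrier_mat n n.
    four_block_mat A' B' C D = four_block_mat P X (0\<^sub>m n n) (1\<^sub>m n) * four_block_mat A B C D"
proof -
  let ?g = "four_block_mat A B C D" and ?g' = "four_block_mat A' B' C D"
  obtain h where h: "h \<in> carrier (GL (2 * n))" "?g * h = 1\<^sub>m (2 * n)" "h * ?g = 1\<^sub>m (2 * n)"
    using GL_obtain_inv[OF g] .
  obtain h1 h2 h3 h4 where hb: "h1 \<in> carrier_mat n n" "h2 \<in> carrier_mat n n"
      "h3 \<in> carrier_mat n n" "h4 \<in> carrier_mat n n" "h = four_block_mat h1 h2 h3 h4"
    using h(1) by (auto simp: carrier_GL mult_2 elim: four_block_mat_cases)
  have "four_block_mat (A * h1 + B * h3) (A * h2 + B * h4) (C * h1 + D * h3) (C * h2 + D * h4)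
      = four_block_mat (1\<^sub>m n) (0\<^sub>m n n) (0\<^sub>m n n) (1\<^sub>m n)"
    using h(2) unfolding hb(5) mult_four_block_mat[OF c(1-4) hb(1-4)] by (simp add: mult_2)
  from four_block_mat_eqD(3,4)[OF _ _ _ _ _ _ _ _ this, of n n n n]
  have low: "C * h1 + D * h3 = 0\<^sub>m n n" "C * h2 + D * h4 = 1\<^sub>m n" using c hb by auto
  define P X where "P = A' * h1 + B' * h3" and "X = A' * h2 + B' * h4"
  have PX: "P \<in> carrier_mat n n" "X \<in> carrier_mat n n" using c hb by (auto simp: P_def X_def)
  have g'h: "?g' * h = four_block_mat P X (0\<^sub>m n n) (1\<^sub>m n)"
    unfolding hb(5) mult_four_block_mat[OF c(5,6,3,4) hb(1-4)] low P_def X_def ..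
  have "?g' * h \<in> carrier (GL (2 * n))" using g' h(1) by (rule GL_mult_closed)
  then have "det P \<noteq> 0"
    using PX det_four_block_mat_lower_left_zero[of P n X n "0\<^sub>m n n" "1\<^sub>m n"] by (simp add: g'h carrier_GL)
  moreover have "?g' * h * ?g = ?g'"
    using h(1,3) g g' mult_right_inverse_mat[of ?g' "2 * n" "2 * n" h ?g] by (simp add: carrier_GL)
  ultimately have "P \<in> carrier (GL n)"
    "?g' = four_block_mat P X (0\<^sub>m n n) (1\<^sub>m n) * ?g" using PX g'h by (simp_all add: carrier_GL)
  then show ?thesis using PX(2) by blast
qed

definition block_swap :: "nat \<Rightarrow> nat \<Rightarrow> 'a::{zero,one} mat" where
  "block_swap a b = four_block_mat (0\<^sub>m b a) (1\<^sub>m b) (1\<^sub>m a) (0\<^sub>m a b)"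

lemma block_swap_carrier [simp]: "block_swap a b \<in> carrier_mat (a + b) (a + b)"
  by (intro carrier_matI) (auto simp: block_swap_def)

lemma block_swap_swap: "block_swap a b * block_swap b a = (1\<^sub>m (a + b) :: 'a::semiring_1 mat)"
  unfolding block_swap_def
  by (subst mult_four_block_mat[of _ b a _ b _ a _ _ b _ a]) (auto simp: add.commute)

lemma block_swap_GL: "block_swap a b \<in> carrier (GL (a + b) :: 'a::field mat monoid)"
proof -
  have "det (block_swap a b :: 'a mat) * det (block_swap b a :: 'a mat) = 1"
    using det_mult[of "block_swap a b :: 'a mat" "a + b" "block_swap b a"] block_swap_carrier[of b a]
    by (simp add: block_swap_swap add.commute)
  then show ?thesis by (auto simp: carrier_GL)
qed

lemma block_swap_conj:
  fixes x y :: "'a::semiring_1 mat"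
  assumes "x \<in> carrier_mat a a" "y \<in> carrier_mat b b"
  shows "block_swap a b * four_block_mat x (0\<^sub>m a b) (0\<^sub>m b a) y
    = four_block_mat y (0\<^sub>m b a) (0\<^sub>m a b) x * block_swap a b"
  unfolding block_swap_def
  by (subst (1 2) mult_four_block_mat[of _ b _ _ _ _ a _ _ a _ b]) (use assms in auto)

text \<open>The hypothesis is full row rank, phrased in the form in which invertibility of the
  surrounding matrix delivers it.\<close>

lemma lower_rows_normal_form:
  fixes D :: "'a::field mat"
  assumes D: "D \<in> carrier_mat b (a + b)"
    and rows: "\<And>U i. U \<in> carrier (GL b) \<Longrightarrow> i < b \<Longrightarrow> row (U * D) i \<noteq> 0\<^sub>v (a + b)"
  shows "\<exists>U\<in>carrier (GL b). \<exists>Q\<in>carrier (GL (a + b)).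
    U * D * Q = mat b (a + b) (\<lambda>(i, j). if j = i + a then 1 else 0)"
proof -
  let ?n = "a + b"
  obtain U Q r where UQ: "U \<in> carrier (GL b)" "Q \<in> carrier (GL ?n)" and r: "r \<le> min b ?n"
    and eq: "U * D * Q = rank_mat b ?n r"
    using rank_normal_form[OF D] by blast
  note c = UQ[THEN GL_carrier_mat]
  \<comment> \<open>Otherwise row \<open>r\<close> of the rank form vanishes, and with it row
    \<open>r\<close> of \<open>U * D\<close>.\<close>
  have "r = b"
  proof (rule ccontr)
    assume "r \<noteq> b"
    then have r': "r < b" using r by simp
    obtain Q' where Q': "Q' \<in> carrier (GL ?n)" "Q * Q' = 1\<^sub>m ?n" using GL_obtain_inv[OF UQ(2)] by blast
    have "U * D = U * D * Q * Q'"
      using c D Q' GL_carrier_mat[OF Q'(1)] mult_right_inverse_mat[of "U * D" b ?n Q Q'] by simp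
    then have "row (U * D) r = row (rank_mat b ?n r * Q') r" by (simp add: eq)
    also have "\<dots> = 0\<^sub>v ?n"
      using r' GL_carrier_mat[OF Q'(1)]
      by (intro eq_vecI) (auto simp: rank_mat_def scalar_prod_def)
    finally show False using rows[OF UQ(1) r'] by simp
  qed
  \<comment> \<open>Moves the identity block of the rank form from the first \<open>b\<close>
    columns to the last \<open>b\<close>.\<close>
  let ?W = "block_swap a b :: 'a mat"
  have W: "?W \<in> carrier (GL ?n)" by (rule block_swap_GL)
  have "U * D * (Q * ?W) = U * D * Q * ?W"
    using c D GL_carrier_mat[OF W] by (intro assoc_mult_mat[of _ b ?n _ ?n _ ?n, symmetric]) auto
  also have "U * D * Q = rank_mat b ?n b" using eq \<open>r = b\<close> by simp
  also have "rank_mat b ?n b = four_block_mat (1\<^sub>m b) (0\<^sub>m b a) (0\<^sub>m 0 b) (0\<^sub>m 0 a :: 'a mat)"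
    by (intro eq_matI) (auto simp: rank_mat_def)
  also have "\<dots> * ?W = four_block_mat (0\<^sub>m b a) (1\<^sub>m b) (0\<^sub>m 0 a) (0\<^sub>m 0 b)"
    unfolding block_swap_def by (subst mult_four_block_mat[of _ b b _ a _ 0 _ _ a _ b]) auto
  also have "\<dots> = mat b ?n (\<lambda>(i, j). if j = i + a then 1 else 0)"
    by (intro eq_matI) auto
  finally show ?thesis using UQ(1) GL_mult_closed[OF UQ(2) W] by blast
qed


section \<open>Classification of the lower halves\<close>

lemma GL_row_nonzero:
  assumes "M \<in> carrier (GL n)" "i < n"
  shows "row M i \<noteq> 0\<^sub>v n"
proof
  assume 0: "row M i = 0\<^sub>v n"
  obtain N where N: "N \<in> carrier (GL n)" "M * N = 1\<^sub>m n" using GL_obtain_inv[OF assms(1)] by blast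
  have "(M * N) $$ (i, i) = row M i \<bullet> col N i"
    using assms GL_carrier_mat[OF assms(1)] GL_carrier_mat[OF N(1)] by simp
  also have "\<dots> = 0" using GL_carrier_mat[OF N(1)] by (simp add: 0 scalar_prod_def)
  finally show False using assms by (simp add: N(2))
qed

lemma append_rows_mult:
  fixes A :: "'a::semiring_1 mat"
  assumes "A \<in> carrier_mat a n" "B \<in> carrier_mat b n" "Q \<in> carrier_mat n m"
  shows "(A @\<^sub>r B) * Q = (A * Q) @\<^sub>r (B * Q)"
proof (rule eq_matI)
  fix i j assume "i < dim_row ((A * Q) @\<^sub>r (B * Q))" "j < dim_col ((A * Q) @\<^sub>r (B * Q))"
  then show "((A @\<^sub>r B) * Q) $$ (i, j) = ((A * Q) @\<^sub>r (B * Q)) $$ (i, j)"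
    using assms by (auto simp: append_rows_def scalar_prod_def intro!: sum.cong)
qed (use assms in \<open>auto simp: append_rows_def\<close>)

lemma diag_mult_append_rows:
  fixes A :: "'a::semiring_1 mat"
  assumes "A \<in> carrier_mat a n" "B \<in> carrier_mat b n" "U \<in> carrier_mat a a" "V \<in> carrier_mat b b"
  shows "four_block_mat U (0\<^sub>m a b) (0\<^sub>m b a) V * (A @\<^sub>r B) = (U * A) @\<^sub>r (V * B)"
  unfolding append_rows_def
  by (subst mult_four_block_mat[of _ a a _ b _ b _ _ n _ 0]) (use assms in \<open>auto intro!: cong_four_block_mat\<close>)

text \<open>Equivalence of lower halves: the row operation is common to both blocks and comes from
  the lower diagonal block of the parabolic, the column operations are independent and come from the
  two factors of H.\<close>

definition pair_equiv :: "nat \<Rightarrow> 'a::field mat \<Rightarrow> 'a mat \<Rightarrow> 'a mat \<Rightarrow> 'a mat \<Rightarrow> bool" where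
  "pair_equiv n C D C' D' \<longleftrightarrow> (\<exists>U\<in>carrier (GL n). \<exists>H1\<in>carrier (GL n). \<exists>H2\<in>carrier (GL n).
     C' = U * C * H1 \<and> D' = U * D * H2)"

lemma pair_equivI:
  assumes "U \<in> carrier (GL n)" "H1 \<in> carrier (GL n)" "H2 \<in> carrier (GL n)"
    and "U * C * H1 = C'" "U * D * H2 = D'"
  shows "pair_equiv n C D C' D'"
  using assms unfolding pair_equiv_def by blast

lemma pair_equiv_trans:
  assumes "pair_equiv n C D C' D'" "pair_equiv n C' D' C'' D''"
    and "C \<in> carrier_mat n n" "D \<in> carrier_mat n n"
  shows "pair_equiv n C D C'' D''"
proof -
  obtain U H1 H2 V K1 K2 where *: "U \<in> carrier (GL n)" "H1 \<in> carrier (GL n)" "H2 \<in> carrier (GL n)"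
      "V \<in> carrier (GL n)" "K1 \<in> carrier (GL n)" "K2 \<in> carrier (GL n)"
    and eq: "C' = U * C * H1" "D' = U * D * H2" "C'' = V * C' * K1" "D'' = V * D' * K2"
    using assms by (auto simp: pair_equiv_def)
  have "C'' = (V * U) * C * (H1 * K1)" "D'' = (V * U) * D * (H2 * K2)"
    unfolding eq using *[THEN GL_carrier_mat] assms(3,4) by (simp_all add: sandwich_mult del: assoc_mult_mat)
  then show ?thesis using * GL_mult_closed unfolding pair_equiv_def by blast
qed

text \<open>The new upper blocks may be arbitrary, since \<open>same_lower_blocks\<close> absorbs
  them into the parabolic.\<close>

lemma pair_equiv_lower_blocks:
  fixes C D :: "'a::field mat"
  assumes c: "A \<in> carrier_mat n n" "B \<in> carrier_mat n n" "C \<in> carrier_mat n n" "D \<in> carrier_mat n n"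
    and e: "pair_equiv n C D C' D'"
  shows "\<exists>U\<in>carrier (GL n). \<exists>H1\<in>carrier (GL n). \<exists>H2\<in>carrier (GL n).
    \<exists>A'\<in>carrier_mat n n. \<exists>B'\<in>carrier_mat n n.
    block_diag n (1\<^sub>m n) U * four_block_mat A B C D * block_diag n H1 H2 = four_block_mat A' B' C' D'"
proof -
  obtain U H1 H2 where *: "U \<in> carrier (GL n)" "H1 \<in> carrier (GL n)" "H2 \<in> carrier (GL n)"
    and eq: "C' = U * C * H1" "D' = U * D * H2" using e by (auto simp: pair_equiv_def)
  have "block_diag n (1\<^sub>m n) U * four_block_mat A B C D = four_block_mat A B (U * C) (U * D)"
    unfolding block_diag_def
    by (subst mult_four_block_mat[of _ n n _ n _ n _ _ n _ n]) (use c *[THEN GL_carrier_mat] in auto)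
  also have "\<dots> * block_diag n H1 H2 = four_block_mat (A * H1) (B * H2) C' D'"
    unfolding block_diag_def eq
    by (subst mult_four_block_mat[of _ n n _ n _ n _ _ n _ n]) (use c *[THEN GL_carrier_mat] in auto)
  finally show ?thesis using * c *[THEN GL_carrier_mat] by (meson mult_carrier_mat)
qed

text \<open>The pair of lower blocks is reduced in stages. \<open>C\<close> is brought to rank form;
  the rows of \<open>D\<close> opposite the zero rows of \<open>C\<close> are then independent and
  become a zero block followed by an identity block; the rest of \<open>D\<close> is cleared down to
  a square block \<open>X\<close>, whose rank is \<open>c\<close>. Each later stage preserves the
  shape reached before.\<close>

lemma orbit_classification:
  fixes g :: "'a::field mat"
  assumes g: "g \<in> carrier (GL (2 * n))"
  shows "\<exists>c r. c \<le> r \<and> r \<le> n \<and> (\<exists>A\<in>carrier (GL n). \<exists>D\<in>carrier (GL n). \<exists>X\<in>carrier_mat n n.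
    \<exists>h1\<in>carrier (GL n). \<exists>h2\<in>carrier (GL n).
    g = four_block_mat A X (0\<^sub>m n n) D * orbit_mat n {..<r} ({..<c} \<union> {r..}) * block_diag n h1 h2)"
proof -
  obtain A0 B0 C0 D0 where bl0: "A0 \<in> carrier_mat n n" "B0 \<in> carrier_mat n n"
      "C0 \<in> carrier_mat n n" "D0 \<in> carrier_mat n n" and g0: "g = four_block_mat A0 B0 C0 D0"
    using g by (auto simp: carrier_GL mult_2 elim: four_block_mat_cases)
  note lower = pair_equiv_lower_blocks[OF bl0, folded g0]
  obtain U0 H0 r where UH: "U0 \<in> carrier (GL n)" "H0 \<in> carrier (GL n)" and r: "r \<le> n"
    and C0: "U0 * C0 * H0 = rank_mat n n r"
    using rank_normal_form[OF bl0(3)] by auto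
  define D1 where "D1 = U0 * D0"
  have D1: "D1 \<in> carrier_mat n n" using GL_carrier_mat[OF UH(1)] bl0 by (simp add: D1_def)
  have e1: "pair_equiv n C0 D0 (rank_mat n n r) D1"
    using UH C0 D1 GL_one[of n] by (intro pair_equivI[of U0 n H0 "1\<^sub>m n"]) (auto simp: D1_def)
  define b where "b = n - r"
  have n: "n = r + b" using r by (simp add: b_def)
  have C1: "rank_mat n n r = four_block_mat (1\<^sub>m r) (0\<^sub>m r b) (0\<^sub>m b r) (0\<^sub>m b b :: 'a mat)"
    by (intro eq_matI) (auto simp: rank_mat_def n)
  obtain Dt E1 Db E2 where Db: "Dt \<in> carrier_mat r n" "E1 \<in> carrier_mat r 0" "Db \<in> carrier_mat b n"
      "E2 \<in> carrier_mat b 0" "D1 = four_block_mat Dt E1 Db E2"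
    using D1 n by (auto intro: four_block_mat_cases[of D1 r b "r + b" 0])
  have "E1 = 0\<^sub>m r 0" "E2 = 0\<^sub>m b 0" using Db by auto
  then have D1': "D1 = Dt @\<^sub>r Db" using Db by (simp add: append_rows_def)
  \<comment> \<open>As \<open>C\<close> vanishes in these rows, a zero row of \<open>U * Db\<close>
    would be a zero row of an invertible matrix.\<close>
  have rows: "row (U * Db) i \<noteq> 0\<^sub>v (r + b)" if U: "U \<in> carrier (GL b)" and i: "i < b" for U i
  proof
    assume 0: "row (U * Db) i = 0\<^sub>v (r + b)"
    let ?U = "four_block_mat (1\<^sub>m r) (0\<^sub>m r b) (0\<^sub>m b r) U"
    note Uc = GL_carrier_mat[OF U]
    have UC: "?U * rank_mat n n r = rank_mat n n r"
      unfolding C1 by (subst mult_four_block_mat[of _ r r _ b _ b _ _ r _ b]) (use Uc in auto)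
    have UD: "?U * D1 = Dt @\<^sub>r (U * Db)" unfolding D1'
      by (subst diag_mult_append_rows) (use Db Uc in auto)
    have "?U \<in> carrier (GL n)" using GL_four_block_upper(1)[OF GL_one U, of "0\<^sub>m r b"] by (simp add: n)
    then have "pair_equiv n (rank_mat n n r) D1 (rank_mat n n r) (Dt @\<^sub>r (U * Db))"
      using GL_carrier_mat[of ?U n] UC UD D1 Db Uc n
      by (intro pair_equivI[of ?U n "1\<^sub>m n" "1\<^sub>m n"]) (simp_all add: GL_one right_mult_one_mat[of _ "r + b"] append_rows_def)
    from lower[OF pair_equiv_trans[OF e1 this bl0(3,4)]] obtain V K1 K2 A' B' where
      *: "V \<in> carrier (GL n)" "K1 \<in> carrier (GL n)" "K2 \<in> carrier (GL n)"
         "A' \<in> carrier_mat n n" "B' \<in> carrier_mat n n"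
      and eq: "block_diag n (1\<^sub>m n) V * g * block_diag n K1 K2
         = four_block_mat A' B' (rank_mat n n r) (Dt @\<^sub>r (U * Db))" (is "_ = ?M") by blast
    have M: "?M \<in> carrier (GL (2 * n))"
      unfolding eq[symmetric] by (intro GL_mult_closed block_diag_GL * GL_one g)
    have "row ?M (n + (r + i)) = 0\<^sub>v (2 * n)"
    proof (rule eq_vecI)
      fix j assume "j < dim_vec (0\<^sub>v (2 * n) :: 'a vec)"
      then have j: "j < 2 * n" by simp
      have "(U * Db) $$ (i, k) = 0" if "k < n" for k
      proof -
        have "(U * Db) $$ (i, k) = row (U * Db) i $ k" using that Uc Db i by simp
        then show ?thesis using that by (simp add: 0 n)
      qed
      then show "row ?M (n + (r + i)) $ j = 0\<^sub>v (2 * n) $ j"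
        using * Db Uc i j n by (auto simp: append_rows_def rank_mat_def)
    qed (use * Db Uc i n in \<open>auto simp: append_rows_def\<close>)
    then show False using GL_row_nonzero[OF M, of "n + (r + i)"] i n by simp
  qed
  obtain U Q where UQ: "U \<in> carrier (GL b)" "Q \<in> carrier (GL n)"
    and eqD: "U * Db * Q = mat b n (\<lambda>(i, j). if j = i + r then 1 else 0)"
    using lower_rows_normal_form[of Db b r] rows Db(3) unfolding n by blast
  note UQc = UQ[THEN GL_carrier_mat]
  have "Dt * Q \<in> carrier_mat (r + 0) (r + b)" using Db UQc n by simp
  then obtain X Y E3 E4 where XY: "X \<in> carrier_mat r r" "Y \<in> carrier_mat r b"
      "E3 \<in> carrier_mat 0 r" "E4 \<in> carrier_mat 0 b" "Dt * Q = four_block_mat X Y E3 E4"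
    by (rule four_block_mat_cases)
  let ?U = "four_block_mat (1\<^sub>m r) (0\<^sub>m r b) (0\<^sub>m b r) U"
  have U: "?U \<in> carrier (GL n)" using GL_four_block_upper(1)[OF GL_one UQ(1), of "0\<^sub>m r b"] by (simp add: n)
  have "?U * D1 * Q = (Dt * Q) @\<^sub>r (U * Db * Q)" unfolding D1'
    by (subst diag_mult_append_rows) (use Db UQc append_rows_mult[of Dt r n "U * Db" b Q n] in auto)
  also have "\<dots> = four_block_mat X Y (0\<^sub>m b r) (1\<^sub>m b)"
    unfolding eqD using Db UQc XY n by (intro eq_matI) (auto simp: append_rows_def)
  finally have D2: "?U * D1 * Q = four_block_mat X Y (0\<^sub>m b r) (1\<^sub>m b)" .
  have "?U * rank_mat n n r = rank_mat n n r"
    unfolding C1 by (subst mult_four_block_mat[of _ r r _ b _ b _ _ r _ b]) (use UQc in auto)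
  then have e2: "pair_equiv n (rank_mat n n r) D1 (rank_mat n n r) (four_block_mat X Y (0\<^sub>m b r) (1\<^sub>m b))"
    using U UQ D2 by (intro pair_equivI[of ?U n "1\<^sub>m n" Q]) (simp_all add: GL_one right_mult_one_mat[of _ n])
  obtain P R c where PR: "P \<in> carrier (GL r)" "R \<in> carrier (GL r)" and c: "c \<le> r"
    and eqX: "P * X * R = rank_mat r r c" using rank_normal_form[OF XY(1)] by auto
  obtain P' where P': "P' \<in> carrier (GL r)" "P * P' = 1\<^sub>m r" using GL_obtain_inv[OF PR(1)] by blast
  note PRc = PR[THEN GL_carrier_mat] GL_carrier_mat[OF P'(1)]
  \<comment> \<open>\<open>?V\<close> applies \<open>P\<close> to \<open>X\<close> and clears
    \<open>Y\<close> against the identity block below it; \<open>?K1\<close> undoes the effect of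
    \<open>P\<close> on \<open>C\<close>, while \<open>?K2\<close> supplies the column operation
    \<open>R\<close> for \<open>D\<close> alone.\<close>
  let ?V = "four_block_mat P (- (P * Y)) (0\<^sub>m b r) (1\<^sub>m b)"
  let ?K1 = "four_block_mat P' (0\<^sub>m r b) (0\<^sub>m b r) (1\<^sub>m b)"
  let ?K2 = "four_block_mat R (0\<^sub>m r b) (0\<^sub>m b r) (1\<^sub>m b)"
  have VK: "?V \<in> carrier (GL n)" "?K1 \<in> carrier (GL n)" "?K2 \<in> carrier (GL n)"
    using GL_four_block_upper(1)[OF PR(1) GL_one, of "- (P * Y)" b] GL_four_block_upper(1)[OF PR(2) GL_one, of "0\<^sub>m r b"]
      GL_four_block_upper(1)[OF P'(1) GL_one, of "0\<^sub>m r b"] PRc XY by (simp_all add: n)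
  have "?V * rank_mat n n r = four_block_mat P (0\<^sub>m r b) (0\<^sub>m b r) (0\<^sub>m b b)"
    unfolding C1 by (subst mult_four_block_mat[of _ r r _ b _ b _ _ r _ b]) (use PRc XY in auto)
  then have "?V * rank_mat n n r * ?K1 = four_block_mat P (0\<^sub>m r b) (0\<^sub>m b r) (0\<^sub>m b b) * ?K1" by simp
  also have "\<dots> = rank_mat n n r"
    unfolding C1 by (subst mult_four_block_mat[of _ r r _ b _ b _ _ r _ b]) (use PRc P'(2) in auto)
  finally have e3: "?V * rank_mat n n r * ?K1 = rank_mat n n r" .
  have "?V * four_block_mat X Y (0\<^sub>m b r) (1\<^sub>m b) = four_block_mat (P * X) (0\<^sub>m r b) (0\<^sub>m b r) (1\<^sub>m b)"
    by (subst mult_four_block_mat[of _ r r _ b _ b _ _ r _ b]) (use PRc XY in \<open>auto intro!: cong_four_block_mat\<close>)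
  then have "?V * four_block_mat X Y (0\<^sub>m b r) (1\<^sub>m b) * ?K2 = four_block_mat (P * X) (0\<^sub>m r b) (0\<^sub>m b r) (1\<^sub>m b) * ?K2"
    by simp
  also have "\<dots> = four_block_mat (rank_mat r r c) (0\<^sub>m r b) (0\<^sub>m b r) (1\<^sub>m b)"
    unfolding eqX[symmetric] by (subst mult_four_block_mat[of _ r r _ b _ b _ _ r _ b]) (use PRc XY in auto)
  also have "\<dots> = coord_proj n ({..<c} \<union> {r..})"
    using c by (intro eq_matI) (auto simp: coord_proj_def rank_mat_def n)
  finally have e4: "?V * four_block_mat X Y (0\<^sub>m b r) (1\<^sub>m b) * ?K2 = coord_proj n ({..<c} \<union> {r..})" .
  have C2: "rank_mat n n r = (coord_proj n {..<r} :: 'a mat)"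
    by (intro eq_matI) (auto simp: coord_proj_def rank_mat_def)
  have "pair_equiv n (rank_mat n n r) (four_block_mat X Y (0\<^sub>m b r) (1\<^sub>m b))
      (rank_mat n n r) (coord_proj n ({..<c} \<union> {r..}))"
    using VK e3 e4 by (rule pair_equivI)
  then have "pair_equiv n C0 D0 (rank_mat n n r) (coord_proj n ({..<c} \<union> {r..}))"
    using e1 e2 pair_equiv_trans[of n] bl0(3,4) rank_mat_carrier D1 by metis
  from lower[OF this[unfolded C2]] obtain V K1 K2 A' B' where
    *: "V \<in> carrier (GL n)" "K1 \<in> carrier (GL n)" "K2 \<in> carrier (GL n)"
       "A' \<in> carrier_mat n n" "B' \<in> carrier_mat n n"
    and eq: "block_diag n (1\<^sub>m n) V * g * block_diag n K1 K2
       = four_block_mat A' B' (coord_proj n {..<r}) (coord_proj n ({..<c} \<union> {r..}))" (is "?l = ?M")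
    by blast
  have M: "?M \<in> carrier (GL (2 * n))"
    unfolding eq[symmetric] by (intro GL_mult_closed block_diag_GL * GL_one g)
  have "{..<r} \<union> ({..<c} \<union> {r..}) = UNIV" by auto
  note orb = orbit_mat_GL[OF this, of n, where 'a = 'a]
  \<comment> \<open>So far only the lower halves agree with the representative; the discrepancy of
    the upper halves is a factor in the parabolic.\<close>
  obtain P X where PX: "P \<in> carrier (GL n)" "X \<in> carrier_mat n n"
    and M_eq: "?M = four_block_mat P X (0\<^sub>m n n) (1\<^sub>m n) * orbit_mat n {..<r} ({..<c} \<union> {r..})"
    using same_lower_blocks[OF orb[unfolded orbit_mat_def] M] *
    unfolding orbit_mat_def by auto
  obtain V' where V': "V' \<in> carrier (GL n)" "V' * V = 1\<^sub>m n" using GL_obtain_inv[OF *(1)] by blast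
  obtain K1' where K1': "K1' \<in> carrier (GL n)" "K1 * K1' = 1\<^sub>m n" using GL_obtain_inv[OF *(2)] by blast
  obtain K2' where K2': "K2' \<in> carrier (GL n)" "K2 * K2' = 1\<^sub>m n" using GL_obtain_inv[OF *(3)] by blast
  note cs = *(1-3)[THEN GL_carrier_mat] V'(1)[THEN GL_carrier_mat] K1'(1)[THEN GL_carrier_mat] K2'(1)[THEN GL_carrier_mat]
  have i1: "block_diag n (1\<^sub>m n) V' * block_diag n (1\<^sub>m n) V = 1\<^sub>m (2 * n)"
    and i2: "block_diag n K1 K2 * block_diag n K1' K2' = 1\<^sub>m (2 * n)"
    using cs V' K1' K2' by (simp_all add: block_diag_mult[symmetric] block_diag_one)
  have "g = block_diag n (1\<^sub>m n) V' * ?l * block_diag n K1' K2'"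
    using cs GL_carrier_mat[OF g] i1 i2 sandwich_mult[of "block_diag n (1\<^sub>m n) V'" "2 * n" "block_diag n (1\<^sub>m n) V" g "2 * n"]
    by simp
  also have "\<dots> = block_diag n (1\<^sub>m n) V' * four_block_mat P X (0\<^sub>m n n) (1\<^sub>m n)
      * orbit_mat n {..<r} ({..<c} \<union> {r..}) * block_diag n K1' K2'"
    unfolding eq M_eq
    using cs parabolic_GL[OF PX(1) GL_one PX(2)] orb
    by (subst assoc_mult_mat[of "block_diag n (1\<^sub>m n) V'" "2 * n" "2 * n" _ "2 * n" _ "2 * n"]) (auto simp: carrier_GL)
  also have "block_diag n (1\<^sub>m n) V' * four_block_mat P X (0\<^sub>m n n) (1\<^sub>m n) = four_block_mat P X (0\<^sub>m n n) V'"
    unfolding block_diag_def using PX cs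
    by (subst mult_four_block_mat[of _ n n _ n _ n _ _ n _ n]) (auto simp: carrier_GL)
  finally show ?thesis using c r PX V'(1) K1'(1) K2'(1) by blast
qed

section \<open>Stabilizers of the representatives\<close>

lemma unipotent_radical_single:
  "unipotent_radical (a + b) {a}
    = {four_block_mat (1\<^sub>m a) X (0\<^sub>m b a) (1\<^sub>m b) |X. X \<in> carrier_mat a b}" (is "?U = ?V")
proof
  show "?U \<subseteq> ?V"
  proof
    fix u :: "'a mat" assume u: "u \<in> ?U"
    let ?X = "mat a b (\<lambda>(i, j). u $$ (i, j + a))"
    have "u = four_block_mat (1\<^sub>m a) ?X (0\<^sub>m b a) (1\<^sub>m b)"
      using u by (intro eq_matI) (auto simp: unipotent_radical_def)
    moreover have "?X \<in> carrier_mat a b" by simp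
    ultimately show "u \<in> ?V" by (simp only: mem_Collect_eq) (intro exI conjI)
  qed
  show "?V \<subseteq> ?U" by (auto simp: unipotent_radical_def)
qed

text \<open>The off-diagonal entries of \<open>u\<close> lie in rows below \<open>c\<close> and
  columns from \<open>c\<close> on. These rows belong to both index sets, so in each lower block the
  action of \<open>u\<close> from the left can be moved to the right as the part of \<open>u\<close>
  in the columns kept by that block. The corner \<open>X\<close> repairs the upper right block; its
  columns start at \<open>r\<close>, so it does not disturb the upper left one.\<close>

lemma orbit_mat_unipotent:
  fixes u :: "'a::field mat"
  assumes "c \<le> r" "r \<le> n" and u: "u \<in> unipotent_radical n {c}"
  shows "\<exists>X\<in>carrier_mat n n. \<exists>h1\<in>carrier (GL n). \<exists>h2\<in>carrier (GL n). det h1 = 1 \<and> det h2 = 1 \<and>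
    four_block_mat (1\<^sub>m n) X (0\<^sub>m n n) u * orbit_mat n {..<r} ({..<c} \<union> {r..})
    = orbit_mat n {..<r} ({..<c} \<union> {r..}) * block_diag n h1 h2"
proof -
  let ?S = "{..<r}" and ?T = "{..<c} \<union> {r..}"
  define h where "h S = mat n n (\<lambda>(i, j). if i = j then 1 else if j \<in> S then u $$ (i, j) else 0)" for S :: "nat set"
  define X where "X = mat n n (\<lambda>(i, j). if i \<noteq> j \<and> j \<in> ?T then u $$ (i, j) else 0)"
  have uc: "u \<in> carrier_mat n n" and u1: "\<And>i. i < n \<Longrightarrow> u $$ (i, i) = 1"
    and u0: "\<And>i j. i < n \<Longrightarrow> j < n \<Longrightarrow> i \<noteq> j \<Longrightarrow> \<not> (i < c \<and> c \<le> j) \<Longrightarrow> u $$ (i, j) = 0"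
    using u by (auto simp: unipotent_radical_def)
  have det: "det (h S) = 1" for S
  proof -
    have "det (h S) = prod_list (diag_mat (h S))"
      using u0 by (intro det_upper_triangular[of _ n]) (auto simp: h_def)
    also have "diag_mat (h S) = map (\<lambda>_. 1) [0..<n]" by (auto simp: diag_mat_def h_def)
    also have "prod_list \<dots> = 1" by (induction n) auto
    finally show ?thesis .
  qed
  have hc [simp]: "h S \<in> carrier_mat n n" for S by (simp add: h_def)
  have Xc [simp]: "X \<in> carrier_mat n n" by (simp add: X_def)
  have "four_block_mat (1\<^sub>m n) X (0\<^sub>m n n) u * orbit_mat n ?S ?T
     = four_block_mat (coord_proj n (- ?S) + X * coord_proj n ?S) (coord_proj n ?S + X * coord_proj n ?T)
       (u * coord_proj n ?S) (u * coord_proj n ?T)"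
    unfolding orbit_mat_def
    by (subst mult_four_block_mat[of _ n n _ n _ n _ _ n _ n]) (use uc in \<open>auto intro!: cong_four_block_mat\<close>)
  also have "\<dots> = four_block_mat (coord_proj n (- ?S) * h ?S) (coord_proj n ?S * h ?T)
       (coord_proj n ?S * h ?S) (coord_proj n ?T * h ?T)"
    using assms(1,2) u0 u1 uc
    by (intro cong_four_block_mat)
      (auto simp: coord_proj_mult[of _ n n] mult_coord_proj[of _ n n] intro!: eq_matI,
       auto simp: coord_proj_def h_def X_def)
  also have "\<dots> = orbit_mat n ?S ?T * block_diag n (h ?S) (h ?T)"
    unfolding orbit_mat_def block_diag_def
    by (subst mult_four_block_mat[of _ n n _ n _ n _ _ n _ n])
      (auto simp: left_add_zero_mat[of _ n n] right_add_zero_mat[of _ n n] mult_carrier_mat[of _ n n _ n])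
  finally show ?thesis
    using det by (intro bexI[of _ X] bexI[of _ "h ?S"] bexI[of _ "h ?T"]) (auto simp: carrier_GL)
qed

text \<open>For c = 0 the row space W is spanned by coordinate vectors, \<open>a\<close> of them in
  E_1 and \<open>b\<close> in E_2. The first factor of H acts by \<open>x1\<close> on W and by
  \<open>y1\<close> on the quotient, the second by \<open>y2\<close> on W and by \<open>x2\<close>
  on the quotient, and these four blocks are independent.\<close>

lemma orbit_mat_diag:
  fixes x1 x2 y1 y2 :: "'a::field mat"
  assumes "x1 \<in> carrier_mat a a" "x2 \<in> carrier_mat a a" "y1 \<in> carrier_mat b b" "y2 \<in> carrier_mat b b"
  defines "d \<equiv> \<lambda>x y. four_block_mat x (0\<^sub>m a b) (0\<^sub>m b a) y"
  shows "block_diag (a + b) (d x2 y1) (d x1 y2) * orbit_mat (a + b) {..<a} {a..}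
    = orbit_mat (a + b) {..<a} {a..} * block_diag (a + b) (d x1 y1) (d x2 y2)"
proof -
  let ?n = "a + b"
  let ?P = "four_block_mat (1\<^sub>m a) (0\<^sub>m a b) (0\<^sub>m b a) (0\<^sub>m b b) :: 'a mat"
  let ?Q = "four_block_mat (0\<^sub>m a a) (0\<^sub>m a b) (0\<^sub>m b a) (1\<^sub>m b) :: 'a mat"
  have c [simp]: "?P \<in> carrier_mat ?n ?n" "?Q \<in> carrier_mat ?n ?n" by auto
  have dc [simp]: "d x y \<in> carrier_mat ?n ?n" if "x \<in> carrier_mat a a" "y \<in> carrier_mat b b" for x y
    using that by (simp add: d_def)
  have m: "d x y * ?P = d x (0\<^sub>m b b)" "d x y * ?Q = d (0\<^sub>m a a) y"
    "?P * d x y = d x (0\<^sub>m b b)" "?Q * d x y = d (0\<^sub>m a a) y"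
    if "x \<in> carrier_mat a a" "y \<in> carrier_mat b b" for x y
    unfolding d_def using that
    by (subst mult_four_block_mat[of _ a a _ b _ b _ _ a _ b]; simp)+
  have o: "orbit_mat ?n {..<a} {a..} = four_block_mat ?Q ?P ?P ?Q"
    by (simp add: orbit_mat_def coord_proj_block)
  have "block_diag ?n (d x2 y1) (d x1 y2) * orbit_mat ?n {..<a} {a..}
     = four_block_mat (d x2 y1 * ?Q) (d x2 y1 * ?P) (d x1 y2 * ?P) (d x1 y2 * ?Q)"
    unfolding o block_diag_def
    by (subst mult_four_block_mat[of _ ?n ?n _ ?n _ ?n _ _ ?n _ ?n])
      (use assms(1-4) in \<open>auto simp: left_add_zero_mat[of _ ?n ?n] right_add_zero_mat[of _ ?n ?n]
        mult_carrier_mat[of _ ?n ?n _ ?n]\<close>)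
  also have "\<dots> = four_block_mat (?Q * d x1 y1) (?P * d x2 y2) (?P * d x1 y1) (?Q * d x2 y2)"
    using assms(1-4) by (simp add: m)
  also have "\<dots> = orbit_mat ?n {..<a} {a..} * block_diag ?n (d x1 y1) (d x2 y2)"
    unfolding o block_diag_def
    by (subst mult_four_block_mat[of _ ?n ?n _ ?n _ ?n _ _ ?n _ ?n])
      (use assms(1-4) in \<open>auto simp: left_add_zero_mat[of _ ?n ?n] right_add_zero_mat[of _ ?n ?n]
        mult_carrier_mat[of _ ?n ?n _ ?n]\<close>)
  finally show ?thesis .
qed

text \<open>The lower half spans the diagonal of the sum of E_1 and E_2, which is the orbit with c =
  n.\<close>

definition open_mat :: "nat \<Rightarrow> 'a::field mat" where
  "open_mat n = four_block_mat (0\<^sub>m n n) (1\<^sub>m n) (1\<^sub>m n) (1\<^sub>m n)"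

lemma open_mat_eq_orbit_mat: "(open_mat n :: 'a::field mat) = orbit_mat n {..<n} UNIV"
proof -
  have "coord_proj n (- {..<n}) = (0\<^sub>m n n :: 'a mat)" by (rule coord_proj_empty) auto
  then show ?thesis by (simp only: open_mat_def orbit_mat_def coord_proj_UNIV[OF order_refl] coord_proj_UNIV[OF subset_UNIV])
qed

lemma open_mat_GL: "open_mat n \<in> carrier (GL (2 * n))"
  unfolding open_mat_eq_orbit_mat by (rule orbit_mat_GL) simp

lemma parabolic_mult_open_mat:
  assumes "A \<in> carrier_mat n n" "D \<in> carrier_mat n n" "X \<in> carrier_mat n n"
  shows "four_block_mat A X (0\<^sub>m n n) D * open_mat n = four_block_mat X (A + X) D D"
  unfolding open_mat_def
  by (subst mult_four_block_mat[of _ n n _ n _ n _ _ n _ n]) (use assms in \<open>auto intro!: cong_four_block_mat\<close>)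

lemma open_mat_mult_block_diag:
  assumes "h1 \<in> carrier_mat n n" "h2 \<in> carrier_mat n n"
  shows "open_mat n * block_diag n h1 h2 = four_block_mat (0\<^sub>m n n) h2 h1 h2"
  unfolding open_mat_def block_diag_def
  by (subst mult_four_block_mat[of _ n n _ n _ n _ _ n _ n]) (use assms in \<open>auto intro!: cong_four_block_mat\<close>)

lemma open_mat_diag:
  assumes "g \<in> carrier_mat n n"
  shows "block_diag n g g * open_mat n = open_mat n * block_diag n g g"
  using parabolic_mult_open_mat[OF assms assms zero_carrier_mat] open_mat_mult_block_diag[OF assms assms] assms
  by (simp add: block_diag_def)

text \<open>Converse of \<open>open_mat_diag\<close>: comparing blocks forces \<open>X\<close> to be
  0 and all diagonal parts to agree. It guarantees that invariance under the diagonal is all that a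
  value at \<open>open_mat\<close> has to satisfy.\<close>

lemma open_mat_stabilizer:
  assumes c: "A \<in> carrier_mat n n" "D \<in> carrier_mat n n" "X \<in> carrier_mat n n"
    "h1 \<in> carrier_mat n n" "h2 \<in> carrier_mat n n"
    and "four_block_mat A X (0\<^sub>m n n) D * open_mat n = open_mat n * block_diag n h1 h2"
  shows "A = h1" "D = h1" "h2 = h1"
proof -
  have eq: "four_block_mat X (A + X) D D = four_block_mat (0\<^sub>m n n) h2 h1 h2"
    using assms(6) parabolic_mult_open_mat[OF c(1-3)] open_mat_mult_block_diag[OF c(4,5)] by simp
  note four_block_mat_eqD[OF _ _ _ _ _ _ _ _ eq, of n n n n]
  with c show "A = h1" "D = h1" "h2 = h1" by auto
qed

text \<open>The permutation of the upper half that distinguishes this representative from \<open>orbit_mat\<close> makes \<open>\<chi>\<^sub>1\<close> and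
  \<open>\<chi>\<^sub>2\<close> appear in the same order in both diagonal blocks of the stabilizer.\<close>

definition closed_mat :: "nat \<Rightarrow> 'a::field mat" where
  "closed_mat m = four_block_mat
     (four_block_mat (0\<^sub>m m m) (1\<^sub>m m) (0\<^sub>m m m) (0\<^sub>m m m)) (four_block_mat (0\<^sub>m m m) (0\<^sub>m m m) (1\<^sub>m m) (0\<^sub>m m m))
     (four_block_mat (1\<^sub>m m) (0\<^sub>m m m) (0\<^sub>m m m) (0\<^sub>m m m)) (four_block_mat (0\<^sub>m m m) (0\<^sub>m m m) (0\<^sub>m m m) (1\<^sub>m m))"

lemma closed_mat_eq_orbit_mat:
  "closed_mat m = block_diag (m + m) (block_swap m m) (1\<^sub>m (m + m)) * orbit_mat (m + m) {..<m} {m..}"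
  unfolding closed_mat_def orbit_mat_def block_diag_def coord_proj_block block_swap_def
  by (subst mult_four_block_mat[of _ "m + m" "m + m" _ "m + m" _ "m + m" _ _ "m + m" _ "m + m"], simp_all,
     subst (1 2) mult_four_block_mat[of _ m m _ m _ m _ _ m _ m], simp_all)

lemma closed_mat_GL: "closed_mat m \<in> carrier (GL (2 * (m + m)))"
  unfolding closed_mat_eq_orbit_mat
  by (intro GL_mult_closed block_diag_GL block_swap_GL GL_one orbit_mat_GL) auto

text \<open>In blocks of size \<open>m\<close>, \<open>closed_mat\<close> is a permutation matrix;
  from the right it merely permutes block columns, and from the left, in the next lemma, block
  rows.\<close>

lemma parabolic_mult_closed_mat:
  fixes A11 :: "'a::field mat"
  assumes "A11 \<in> carrier_mat m m" "A12 \<in> carrier_mat m m" "A21 \<in> carrier_mat m m" "A22 \<in> carrier_mat m m"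
    "X11 \<in> carrier_mat m m" "X12 \<in> carrier_mat m m" "X21 \<in> carrier_mat m m" "X22 \<in> carrier_mat m m"
    "D11 \<in> carrier_mat m m" "D12 \<in> carrier_mat m m" "D21 \<in> carrier_mat m m" "D22 \<in> carrier_mat m m"
  shows "four_block_mat (four_block_mat A11 A12 A21 A22) (four_block_mat X11 X12 X21 X22)
      (0\<^sub>m (m + m) (m + m)) (four_block_mat D11 D12 D21 D22) * closed_mat m
    = four_block_mat (four_block_mat X11 A11 X21 A21) (four_block_mat A12 X12 A22 X22)
      (four_block_mat D11 (0\<^sub>m m m) D21 (0\<^sub>m m m)) (four_block_mat (0\<^sub>m m m) D12 (0\<^sub>m m m) D22)"
proof -
  have add: "four_block_mat P Q R S + four_block_mat P' Q' R' S' = four_block_mat (P + P') (Q + Q') (R + R') (S + S')"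
    if "P \<in> carrier_mat m m" "Q \<in> carrier_mat m m" "R \<in> carrier_mat m m" "S \<in> carrier_mat m m"
      "P' \<in> carrier_mat m m" "Q' \<in> carrier_mat m m" "R' \<in> carrier_mat m m" "S' \<in> carrier_mat m m"
    for P Q R S P' Q' R' S' :: "'a mat"
    using that by (rule add_four_block_mat)
  show ?thesis
    unfolding closed_mat_def
    apply (subst mult_four_block_mat[of _ "m + m" "m + m" _ "m + m" _ "m + m" _ _ "m + m" _ "m + m"])
            apply (use assms in auto)[8]
    apply (subst (1 2 3 4 5 6) mult_four_block_mat[of _ m m _ m _ m _ _ m _ m])
    using assms by (auto simp: add)
qed

lemma closed_mat_mult_block_diag:
  fixes H11 :: "'a::field mat"
  assumes "H11 \<in> carrier_mat m m" "H12 \<in> carrier_mat m m" "H21 \<in> carrier_mat m m" "H22 \<in> carrier_mat m m"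
    "K11 \<in> carrier_mat m m" "K12 \<in> carrier_mat m m" "K21 \<in> carrier_mat m m" "K22 \<in> carrier_mat m m"
  shows "closed_mat m * block_diag (m + m) (four_block_mat H11 H12 H21 H22) (four_block_mat K11 K12 K21 K22)
    = four_block_mat (four_block_mat H21 H22 (0\<^sub>m m m) (0\<^sub>m m m)) (four_block_mat (0\<^sub>m m m) (0\<^sub>m m m) K11 K12)
      (four_block_mat H11 H12 (0\<^sub>m m m) (0\<^sub>m m m)) (four_block_mat (0\<^sub>m m m) (0\<^sub>m m m) K21 K22)"
  unfolding closed_mat_def block_diag_def
  apply (subst mult_four_block_mat[of _ "m + m" "m + m" _ "m + m" _ "m + m" _ _ "m + m" _ "m + m"])
          apply (use assms in auto)[8]
  apply (subst (1 2 3 4) mult_four_block_mat[of _ m m _ m _ m _ _ m _ m])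
  using assms by auto

lemma closed_mat_diag:
  fixes x1 x2 y1 y2 :: "'a::field mat"
  assumes "x1 \<in> carrier_mat m m" "x2 \<in> carrier_mat m m" "y1 \<in> carrier_mat m m" "y2 \<in> carrier_mat m m"
  shows "block_diag (m + m) (block_diag m y1 x2) (block_diag m x1 y2) * closed_mat m
    = closed_mat m * block_diag (m + m) (block_diag m x1 y1) (block_diag m x2 y2)"
  using assms closed_mat_mult_block_diag[of x1 m "0\<^sub>m m m" "0\<^sub>m m m" y1 x2 "0\<^sub>m m m" "0\<^sub>m m m" y2]
    parabolic_mult_closed_mat[of y1 m "0\<^sub>m m m" "0\<^sub>m m m" x2 "0\<^sub>m m m" "0\<^sub>m m m" "0\<^sub>m m m" "0\<^sub>m m m" x1 "0\<^sub>m m m" "0\<^sub>m m m" y2]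
  by (simp add: block_diag_def)

text \<open>Comparison of the sixteen blocks makes \<open>A\<close> and \<open>D\<close> block
  diagonal, but \<open>h1\<close> and \<open>h2\<close> only block triangular. Their remaining
  blocks are harmless, because the character sees \<open>h1\<close> and \<open>h2\<close> through
  their determinants alone.\<close>

lemma closed_mat_stabilizer:
  fixes A D X h1 h2 :: "'a::field mat"
  assumes A: "A \<in> carrier (GL (m + m))" and D: "D \<in> carrier (GL (m + m))" and X: "X \<in> carrier_mat (m + m) (m + m)"
    and h: "h1 \<in> carrier_mat (m + m) (m + m)" "h2 \<in> carrier_mat (m + m) (m + m)"
    and eq: "four_block_mat A X (0\<^sub>m (m + m) (m + m)) D * closed_mat m = closed_mat m * block_diag (m + m) h1 h2"
  shows "\<exists>x1\<in>carrier (GL m). \<exists>x2\<in>carrier (GL m). \<exists>y1\<in>carrier (GL m). \<exists>y2\<in>carrier (GL m).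
    A = block_diag m y1 x2 \<and> D = block_diag m x1 y2 \<and> det h1 = det x1 * det y1 \<and> det h2 = det x2 * det y2"
proof -
  obtain A11 A12 A21 A22 where bA: "A11 \<in> carrier_mat m m" "A12 \<in> carrier_mat m m"
      "A21 \<in> carrier_mat m m" "A22 \<in> carrier_mat m m" "A = four_block_mat A11 A12 A21 A22"
    using GL_carrier_mat[OF A] by (rule four_block_mat_cases)
  obtain X11 X12 X21 X22 where bX: "X11 \<in> carrier_mat m m" "X12 \<in> carrier_mat m m"
      "X21 \<in> carrier_mat m m" "X22 \<in> carrier_mat m m" "X = four_block_mat X11 X12 X21 X22"
    using X by (rule four_block_mat_cases)
  obtain D11 D12 D21 D22 where bD: "D11 \<in> carrier_mat m m" "D12 \<in> carrier_mat m m"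
      "D21 \<in> carrier_mat m m" "D22 \<in> carrier_mat m m" "D = four_block_mat D11 D12 D21 D22"
    using GL_carrier_mat[OF D] by (rule four_block_mat_cases)
  obtain H11 H12 H21 H22 where bH: "H11 \<in> carrier_mat m m" "H12 \<in> carrier_mat m m"
      "H21 \<in> carrier_mat m m" "H22 \<in> carrier_mat m m" "h1 = four_block_mat H11 H12 H21 H22"
    using h(1) by (rule four_block_mat_cases)
  obtain K11 K12 K21 K22 where bK: "K11 \<in> carrier_mat m m" "K12 \<in> carrier_mat m m"
      "K21 \<in> carrier_mat m m" "K22 \<in> carrier_mat m m" "h2 = four_block_mat K11 K12 K21 K22"
    using h(2) by (rule four_block_mat_cases)
  note b = bA(1-4) bX(1-4) bD(1-4) bH(1-4) bK(1-4)
  have eq': "four_block_mat (four_block_mat X11 A11 X21 A21) (four_block_mat A12 X12 A22 X22)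
      (four_block_mat D11 (0\<^sub>m m m) D21 (0\<^sub>m m m)) (four_block_mat (0\<^sub>m m m) D12 (0\<^sub>m m m) D22)
    = four_block_mat (four_block_mat H21 H22 (0\<^sub>m m m) (0\<^sub>m m m)) (four_block_mat (0\<^sub>m m m) (0\<^sub>m m m) K11 K12)
      (four_block_mat H11 H12 (0\<^sub>m m m) (0\<^sub>m m m)) (four_block_mat (0\<^sub>m m m) (0\<^sub>m m m) K21 K22)"
    using eq unfolding bA(5) bX(5) bD(5) bH(5) bK(5)
    by (simp only: parabolic_mult_closed_mat[OF b(1-12)] closed_mat_mult_block_diag[OF b(13-20)])
  have Q: "four_block_mat X11 A11 X21 A21 = four_block_mat H21 H22 (0\<^sub>m m m) (0\<^sub>m m m)"
    "four_block_mat A12 X12 A22 X22 = four_block_mat (0\<^sub>m m m) (0\<^sub>m m m) K11 K12"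
    "four_block_mat D11 (0\<^sub>m m m) D21 (0\<^sub>m m m) = four_block_mat H11 H12 (0\<^sub>m m m) (0\<^sub>m m m)"
    "four_block_mat (0\<^sub>m m m) D12 (0\<^sub>m m m) D22 = four_block_mat (0\<^sub>m m m) (0\<^sub>m m m) K21 K22"
    using four_block_mat_eqD[OF _ _ _ _ _ _ _ _ eq', of "m + m" "m + m" "m + m" "m + m"] b by auto
  have *: "A11 = H22" "A21 = 0\<^sub>m m m" "A12 = 0\<^sub>m m m" "A22 = K11" "D11 = H11" "D21 = 0\<^sub>m m m"
    "D12 = 0\<^sub>m m m" "D22 = K22" "H12 = 0\<^sub>m m m" "K21 = 0\<^sub>m m m"
    using four_block_mat_eqD[OF _ _ _ _ _ _ _ _ Q(1), of m m m m]
      four_block_mat_eqD[OF _ _ _ _ _ _ _ _ Q(2), of m m m m]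
      four_block_mat_eqD[OF _ _ _ _ _ _ _ _ Q(3), of m m m m]
      four_block_mat_eqD[OF _ _ _ _ _ _ _ _ Q(4), of m m m m] b by auto
  have A': "A = block_diag m H22 K11" and D': "D = block_diag m H11 K22"
    by (simp_all add: bA(5) bD(5) * block_diag_def)
  have "det A = det H22 * det K11" "det D = det H11 * det K22"
    unfolding A' D' block_diag_def
    using b det_four_block_mat_lower_left_zero[OF _ _ refl] by (metis zero_carrier_mat)+
  then have GL: "H22 \<in> carrier (GL m)" "K11 \<in> carrier (GL m)" "H11 \<in> carrier (GL m)" "K22 \<in> carrier (GL m)"
    using A D b by (auto simp: carrier_GL)
  have "det h1 = det H11 * det H22" "det h2 = det K11 * det K22"
    unfolding bH(5) bK(5) * using GL b GL_four_block_lower(2) GL_four_block_upper(2) by metis+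
  then show ?thesis using GL A' D' by blast
qed

lemma det_coord_proj_block: "m \<ge> 1 \<Longrightarrow> det (four_block_mat (1\<^sub>m m) (0\<^sub>m m m) (0\<^sub>m m m) (0\<^sub>m m m) :: 'a::field mat) = 0"
  using det_four_block_mat_lower_left_zero[of "1\<^sub>m m :: 'a mat" m "0\<^sub>m m m" m "0\<^sub>m m m" "0\<^sub>m m m"] by simp

text \<open>In either equation the lower left blocks equate an invertible matrix with a product
  containing a projection of rank \<open>m\<close>, which is singular in size 2m. Thus a function
  supported on one of the two cosets vanishes at the representative of the other.\<close>

lemma open_closed_disjoint:
  fixes A D X h1 h2 :: "'a::field mat"
  assumes "m \<ge> 1" and c: "A \<in> carrier_mat (m + m) (m + m)" "D \<in> carrier (GL (m + m))" "X \<in> carrier_mat (m + m) (m + m)"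
    and h: "h1 \<in> carrier (GL (m + m))" "h2 \<in> carrier (GL (m + m))"
  shows "four_block_mat A X (0\<^sub>m (m + m) (m + m)) D * open_mat (m + m) \<noteq> closed_mat m * block_diag (m + m) h1 h2"
    "four_block_mat A X (0\<^sub>m (m + m) (m + m)) D * closed_mat m \<noteq> open_mat (m + m) * block_diag (m + m) h1 h2"
proof -
  let ?n = "m + m"
  let ?P = "four_block_mat (1\<^sub>m m) (0\<^sub>m m m) (0\<^sub>m m m) (0\<^sub>m m m) :: 'a mat"
  have P: "?P \<in> carrier_mat ?n ?n" by simp
  note cs = c h[THEN GL_carrier_mat] GL_carrier_mat[OF c(2)]
  show "four_block_mat A X (0\<^sub>m ?n ?n) D * open_mat ?n \<noteq> closed_mat m * block_diag ?n h1 h2"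
  proof
    assume "four_block_mat A X (0\<^sub>m ?n ?n) D * open_mat ?n = closed_mat m * block_diag ?n h1 h2"
    then have eq: "four_block_mat X (A + X) D D = closed_mat m * block_diag ?n h1 h2"
      using cs by (simp add: parabolic_mult_open_mat)
    have "D = ?P * h1"
      using eq unfolding closed_mat_def block_diag_def
      apply (subst (asm) mult_four_block_mat[of _ ?n ?n _ ?n _ ?n _ _ ?n _ ?n])
              apply (use cs in auto)[8]
      apply (drule four_block_mat_eqD(3)[of _ ?n ?n _ ?n _ ?n, rotated -1])
      using cs by (auto simp: left_mult_zero_mat[of _ ?n])
    then have "det D = 0" using det_mult[OF P cs(4)] det_coord_proj_block[OF assms(1), where 'a = 'a] by simp
    then show False using c by (simp add: carrier_GL)
  qed
  show "four_block_mat A X (0\<^sub>m ?n ?n) D * closed_mat m \<noteq> open_mat ?n * block_diag ?n h1 h2"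
  proof
    assume "four_block_mat A X (0\<^sub>m ?n ?n) D * closed_mat m = open_mat ?n * block_diag ?n h1 h2"
    then have eq: "four_block_mat A X (0\<^sub>m ?n ?n) D * closed_mat m = four_block_mat (0\<^sub>m ?n ?n) h2 h1 h2"
      using cs by (simp add: open_mat_mult_block_diag)
    have "h1 = D * ?P"
      using eq[symmetric] unfolding closed_mat_def
      apply (subst (asm) mult_four_block_mat[of _ ?n ?n _ ?n _ ?n _ _ ?n _ ?n])
              apply (use cs in auto)[8]
      apply (drule four_block_mat_eqD(3)[of _ ?n ?n _ ?n _ ?n, rotated -1])
      using cs by (auto simp: left_mult_zero_mat[of _ ?n])
    then have "det h1 = 0" using det_mult[OF cs(6) P] det_coord_proj_block[OF assms(1), where 'a = 'a] by simp
    then show False using h by (simp add: carrier_GL)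
  qed
qed

section \<open>Finite-dimensional complex representations\<close>

lemma vector_space_fun_scale: "vector_space fun_scale"
  by standard (auto simp: fun_scale_def algebra_simps)

lemma vector_space_complex: "vector_space ((*) :: complex \<Rightarrow> complex \<Rightarrow> complex)"
  by standard (auto simp: algebra_simps)

interpretation fs: vector_space "fun_scale :: complex \<Rightarrow> ('x \<Rightarrow> complex) \<Rightarrow> 'x \<Rightarrow> complex"
  by (rule vector_space_fun_scale)

lemma fun_scale_apply [simp]: "fun_scale c f x = c * f x"
  by (simp add: fun_scale_def)

lemma sum_fun_apply: "(\<Sum>i\<in>I. f i) x = (\<Sum>i\<in>I. f i x)"
  by (induction I rule: infinite_finite_induct) auto

lemma lin_on_add: "lin_on V s1 s2 T \<Longrightarrow> v \<in> V \<Longrightarrow> w \<in> V \<Longrightarrow> T (v + w) = T v + T w"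
  by (simp add: lin_on_def)

lemma lin_on_scale: "lin_on V s1 s2 T \<Longrightarrow> v \<in> V \<Longrightarrow> T (s1 c v) = s2 c (T v)"
  by (simp add: lin_on_def)

text \<open>Linearity is relative to \<open>V\<close>, because actions and functionals are only
  controlled on the representation space and not on the whole type.\<close>

locale lin_on_subspace = s1: vector_space s1 + s2: vector_space s2
  for s1 :: "complex \<Rightarrow> 'v::ab_group_add \<Rightarrow> 'v" and s2 :: "complex \<Rightarrow> 'w::ab_group_add \<Rightarrow> 'w" +
  fixes V :: "'v set" and T :: "'v \<Rightarrow> 'w"
  assumes sub: "s1.subspace V" and lin: "lin_on V s1 s2 T"
begin

lemma map_0: "T 0 = 0"
  using lin_on_scale[OF lin s1.subspace_0[OF sub], of 0] by simp

lemma map_diff: "v \<in> V \<Longrightarrow> w \<in> V \<Longrightarrow> T (v - w) = T v - T w"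
  using lin_on_add[OF lin, of "v - w" w] s1.subspace_diff[OF sub] by (simp add: algebra_simps)

lemma map_sum: "(\<And>i. i \<in> I \<Longrightarrow> f i \<in> V) \<Longrightarrow> T (\<Sum>i\<in>I. f i) = (\<Sum>i\<in>I. T (f i))"
proof (induction I rule: infinite_finite_induct)
  case (insert i I)
  then have "(\<Sum>i\<in>I. f i) \<in> V" by (intro s1.subspace_sum[OF sub]) auto
  with insert show ?case by (simp add: lin_on_add[OF lin])
qed (simp_all add: map_0)

lemma map_lincomb: "(\<And>i. i \<in> I \<Longrightarrow> f i \<in> V) \<Longrightarrow> T (\<Sum>i\<in>I. s1 (c i) (f i)) = (\<Sum>i\<in>I. s2 (c i) (T (f i)))"
  by (subst map_sum) (auto intro: s1.subspace_scale[OF sub] simp: lin_on_scale[OF lin])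

end

text \<open>Duality makes the vectors independent. They span because subtracting from
  \<open>x\<close> the combination with coefficients \<open>l s x\<close> leaves a vector killed by
  every \<open>l s\<close>. Finite dimension is a result here, so the lemma applies directly to a
  function space.\<close>

lemma dim_eq_card_dual:
  fixes sc :: "complex \<Rightarrow> 'v::ab_group_add \<Rightarrow> 'v"
  assumes vs: "vector_space sc" and V: "module.subspace sc V" and S: "finite S"
    and v: "\<And>s. s \<in> S \<Longrightarrow> v s \<in> V" and l: "\<And>s. s \<in> S \<Longrightarrow> lin_on V sc (*) (l s)"
    and dual: "\<And>s t. s \<in> S \<Longrightarrow> t \<in> S \<Longrightarrow> l t (v s) = (if s = t then 1 else 0)"
    and sep: "\<And>x. x \<in> V \<Longrightarrow> (\<And>s. s \<in> S \<Longrightarrow> l s x = 0) \<Longrightarrow> x = 0"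
  shows "vector_space.dim sc V = card S"
proof -
  interpret vector_space sc by (rule vs)
  have L: "lin_on_subspace sc (*) V (l s)" if "s \<in> S" for s
    using vs vector_space_complex V l[OF that]
    by (simp add: lin_on_subspace_def lin_on_subspace_axioms_def)
  have coef: "l t (\<Sum>s\<in>S. sc (c s) (v s)) = c t" if "t \<in> S" for c t
    using lin_on_subspace.map_lincomb[OF L[OF that], of S v c] v dual that S
    by (simp add: if_distrib[of "\<lambda>x. _ * x"] cong: if_cong)
  have inj: "inj_on v S"
    by (rule inj_onI) (metis dual zero_neq_one)
  have "independent (v ` S)"
  proof (rule independent_if_scalars_zero)
    fix f x assume 0: "(\<Sum>x\<in>v ` S. sc (f x) x) = 0" and x: "x \<in> v ` S"
    then obtain t where t: "t \<in> S" "x = v t" by auto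
    have "(\<Sum>s\<in>S. sc (f (v s)) (v s)) = 0" using 0 by (simp add: sum.reindex[OF inj])
    with coef[OF t(1), of "\<lambda>s. f (v s)"] show "f x = 0"
      using lin_on_subspace.map_0[OF L[OF t(1)]] t by simp
  qed (use S in simp)
  moreover have "V \<subseteq> span (v ` S)"
  proof
    fix x assume x: "x \<in> V"
    let ?y = "\<Sum>s\<in>S. sc (l s x) (v s)"
    have y: "?y \<in> V" using v by (intro subspace_sum[OF V] subspace_scale[OF V])
    have "x - ?y = 0"
      using sep[of "x - ?y"] x y coef lin_on_subspace.map_diff[OF L] subspace_diff[OF V] by simp
    moreover have "?y \<in> span (v ` S)" by (intro span_sum span_scale span_base) auto
    ultimately show "x \<in> span (v ` S)" by simp
  qed
  ultimately have "card (v ` S) = dim V" using v by (intro basis_card_eq_dim) auto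
  then show ?thesis by (simp add: card_image[OF inj])
qed

text \<open>Among all pairs of a nonzero polynomial p and a nonzero vector v with p(T) v = 0, take
  one of least degree and split off a root: p = (X - c) q. Then q(T) kills T v - c v, which by
  minimality must be 0.\<close>

lemma exists_eigenvector:
  fixes sc :: "complex \<Rightarrow> 'v::ab_group_add \<Rightarrow> 'v"
  assumes vs: "vector_space sc" and V: "module.subspace sc V" and lin: "lin_on V sc sc T"
    and T: "\<And>v. v \<in> V \<Longrightarrow> T v \<in> V"
    and fin: "finite B" "V \<subseteq> module.span sc B" and nz: "v0 \<in> V" "v0 \<noteq> 0"
  shows "\<exists>v\<in>V. \<exists>c. v \<noteq> 0 \<and> T v = sc c v"
proof -
  interpret vector_space sc by (rule vs)
  interpret l: lin_on_subspace sc sc V T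
    using vs V lin by (simp add: lin_on_subspace_def lin_on_subspace_axioms_def)
  have pow: "(T ^^ i) v \<in> V" if "v \<in> V" for i v
    by (induction i) (use that T in auto)
  \<comment> \<open>This is p(T) v; the sum may be extended past the degree.\<close>
  define E where "E p v = (\<Sum>i\<le>degree p. sc (coeff p i) ((T ^^ i) v))" for p v
  have E_bound: "E p v = (\<Sum>i\<le>N. sc (coeff p i) ((T ^^ i) v))" if "degree p \<le> N" for p v N
    unfolding E_def
    by (rule sum.mono_neutral_left) (use that in \<open>auto simp: coeff_eq_0\<close>)
  have ex: "\<exists>p. p \<noteq> 0 \<and> E p v0 = 0"
  \<comment> \<open>Linear dependence is a property of sets, hence useful only if the iterates of
    \<open>v0\<close> are distinct; a repeated iterate gives the polynomial X^i - X^j at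
    once.\<close>
  proof (cases "inj_on (\<lambda>i. (T ^^ i) v0) {..card B}")
    case True
    let ?S = "(\<lambda>i. (T ^^ i) v0) ` {..card B}"
    have "dependent ?S"
      using independent_span_bound[OF fin(1), of ?S] pow[OF nz(1)] fin(2) card_image[OF True] by force
    then obtain u x where u: "(\<Sum>y\<in>?S. sc (u y) y) = 0" and x: "x \<in> ?S" "u x \<noteq> 0"
      using dependent_finite[of ?S] by auto
    then obtain j where j: "j \<le> card B" "x = (T ^^ j) v0" by auto
    define p where "p = (\<Sum>i\<le>card B. monom (u ((T ^^ i) v0)) i)"
    have c: "coeff p i = (if i \<le> card B then u ((T ^^ i) v0) else 0)" for i
      by (simp add: p_def coeff_sum coeff_monom)
    have "degree p \<le> card B" by (rule degree_le) (simp add: c)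
    then have "E p v0 = (\<Sum>i\<le>card B. sc (u ((T ^^ i) v0)) ((T ^^ i) v0))"
      by (simp add: E_bound c)
    also have "\<dots> = 0" using u by (simp add: sum.reindex[OF True])
    finally have "E p v0 = 0" .
    moreover have "p \<noteq> 0" using c[of j] j x by auto
    ultimately show ?thesis by blast
  next
    case False
    then obtain i j where ij: "i < j" "(T ^^ i) v0 = (T ^^ j) v0"
      unfolding inj_on_def by (metis nat_neq_iff)
    define p where "p = monom (1::complex) i - monom 1 j"
    have c: "coeff p k = (if k = i then 1 else if k = j then - 1 else 0)" for k
      using ij by (simp add: p_def coeff_monom)
    have "degree p \<le> j" using ij by (intro degree_le) (simp add: c)
    then have "E p v0 = (\<Sum>k\<le>j. sc (coeff p k) ((T ^^ k) v0))" by (rule E_bound)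
    also have "\<dots> = (\<Sum>k\<in>{i, j}. sc (coeff p k) ((T ^^ k) v0))"
      by (rule sum.mono_neutral_right) (use ij in \<open>auto simp: c\<close>)
    also have "\<dots> = 0" using ij by (simp add: c)
    finally have "E p v0 = 0" .
    moreover have "p \<noteq> 0" using c[of i] by auto
    ultimately show ?thesis by blast
  qed
  \<comment> \<open>The vector varies together with the polynomial: the descent below replaces
    \<open>v\<close> by \<open>w\<close>.\<close>
  define P where "P d \<longleftrightarrow> (\<exists>p. \<exists>v\<in>V. degree p = d \<and> p \<noteq> 0 \<and> v \<noteq> 0 \<and> E p v = 0)" for d
  have "\<exists>d. P d" using ex nz unfolding P_def by blast
  then have "P (LEAST d. P d)" by (rule LeastI_ex)
  then obtain p v where p: "degree p = (LEAST d. P d)" "p \<noteq> 0" and v: "v \<in> V" "v \<noteq> 0" and E0: "E p v = 0"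
    unfolding P_def by blast
  have "degree p \<noteq> 0"
  proof
    assume d: "degree p = 0"
    then have "sc (coeff p 0) v = 0" using E0 by (simp add: E_def)
    moreover have "coeff p 0 \<noteq> 0" using p(2) d leading_coeff_0_iff[of p] by simp
    ultimately show False using v by simp
  qed
  then have "\<not> constant (poly p)" by (simp add: constant_degree)
  then obtain c where "poly p c = 0" using fundamental_theorem_of_algebra by blast
  then obtain q where q: "p = [:- c, 1:] * q" by (auto simp: poly_eq_0_iff_dvd elim: dvdE)
  have q0: "q \<noteq> 0" using p(2) q by auto
  have "degree ([:- c, 1:] * q) = degree [:- c, 1:] + degree q" by (rule degree_mult_eq) (use q0 in auto)
  then have dq: "degree p = Suc (degree q)" by (simp only: q) simp
  define w where "w = T v - sc c v"
  have w: "w \<in> V" unfolding w_def by (intro subspace_diff[OF V] subspace_scale[OF V] T v)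
  have pow_w: "(T ^^ i) w = (T ^^ Suc i) v - sc c ((T ^^ i) v)" for i
  proof (induction i)
    case (Suc i)
    have "(T ^^ Suc i) w = T ((T ^^ Suc i) v - sc c ((T ^^ i) v))" by (simp only: funpow.simps(2) o_apply Suc)
    also have "\<dots> = T ((T ^^ Suc i) v) - T (sc c ((T ^^ i) v))"
      using pow[OF v(1), of "Suc i"] subspace_scale[OF V pow[OF v(1), of i]] by (rule l.map_diff)
    also have "\<dots> = (T ^^ Suc (Suc i)) v - sc c ((T ^^ Suc i) v)"
      using lin_on_scale[OF lin pow[OF v(1)]] by simp
    finally show ?case .
  qed (simp add: w_def)
  have pq: "coeff p i = (case i of 0 \<Rightarrow> 0 | Suc k \<Rightarrow> coeff q k) - c * coeff q i" for i
    by (simp add: q coeff_pCons split: nat.split)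
  have "E p v = (\<Sum>i\<le>Suc (degree q). sc (case i of 0 \<Rightarrow> 0 | Suc k \<Rightarrow> coeff q k) ((T ^^ i) v))
      - (\<Sum>i\<le>Suc (degree q). sc (c * coeff q i) ((T ^^ i) v))"
    using dq by (simp only: E_def pq scale_left_diff_distrib sum_subtractf)
  also have "(\<Sum>i\<le>Suc (degree q). sc (case i of 0 \<Rightarrow> 0 | Suc k \<Rightarrow> coeff q k) ((T ^^ i) v))
      = (\<Sum>i\<le>degree q. sc (coeff q i) ((T ^^ Suc i) v))"
    by (subst sum.atMost_Suc_shift) simp
  also have "(\<Sum>i\<le>Suc (degree q). sc (c * coeff q i) ((T ^^ i) v))
      = (\<Sum>i\<le>degree q. sc (c * coeff q i) ((T ^^ i) v))"
    by (simp add: coeff_eq_0)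
  also have "(\<Sum>i\<le>degree q. sc (coeff q i) ((T ^^ Suc i) v)) - (\<Sum>i\<le>degree q. sc (c * coeff q i) ((T ^^ i) v)) = E q w"
    by (simp add: E_def pow_w scale_right_diff_distrib sum_subtractf mult.commute del: funpow.simps)
  finally have "E q w = 0" using E0 by simp
  have "w = 0"
  proof (rule ccontr)
    assume "w \<noteq> 0"
    then have "P (degree q)" unfolding P_def using w q0 \<open>E q w = 0\<close> by blast
    then have "(LEAST d. P d) \<le> degree q" by (rule Least_le)
    then show False using p dq by simp
  qed
  then show ?thesis using v by (auto simp: w_def)
qed


lemma (in vector_space) obtain_finite_basis:
  assumes V: "subspace V" and fin: "finite S" "V \<subseteq> span S"
  obtains B where "finite B" "B \<subseteq> V" "independent B" "span B = V" "card B = dim V"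
proof -
  obtain B where B: "B \<subseteq> V" "independent B" "V \<subseteq> span B" "card B = dim V"
    using basis_exists by blast
  have "finite B" using independent_span_bound[OF fin(1) B(2)] B(1) fin(2) by auto
  moreover have "span B = V" using B V by (simp add: span_subspace)
  ultimately show ?thesis using that B by blast
qed

section \<open>Representations and their dual spaces\<close>

locale representation =
  fixes G :: "('g, 'b) monoid_scheme" and \<pi> :: "('g, 'v::ab_group_add) rep"
  assumes group_G: "group G" and rep: "is_rep G \<pi>"
begin

sublocale vs: vector_space "rep_scale \<pi>"
  using rep by (simp add: is_rep_def)

abbreviation "V \<equiv> rep_space \<pi>"
abbreviation "sc \<equiv> rep_scale \<pi>"
abbreviation "act \<equiv> rep_act \<pi>"
abbreviation "F \<equiv> functionals \<pi>"

lemma V_subspace: "vs.subspace V"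
  and V_fin: "\<exists>B. finite B \<and> V = vs.span B"
  and act_closed: "g \<in> carrier G \<Longrightarrow> v \<in> V \<Longrightarrow> act g v \<in> V"
  and act_lin: "g \<in> carrier G \<Longrightarrow> lin_on V sc sc (act g)"
  and act_one: "v \<in> V \<Longrightarrow> act \<one>\<^bsub>G\<^esub> v = v"
  and act_mult: "g \<in> carrier G \<Longrightarrow> h \<in> carrier G \<Longrightarrow> v \<in> V \<Longrightarrow> act (g \<otimes>\<^bsub>G\<^esub> h) v = act g (act h v)"
  using rep unfolding is_rep_def by blast+

lemmas V_0 = vs.subspace_0[OF V_subspace]
  and V_add = vs.subspace_add[OF V_subspace]
  and V_scale = vs.subspace_scale[OF V_subspace]
  and V_sum = vs.subspace_sum[OF V_subspace]

lemma act_lin_on: "g \<in> carrier G \<Longrightarrow> lin_on_subspace sc sc V (act g)"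
  using V_subspace act_lin by (simp add: lin_on_subspace_def lin_on_subspace_axioms_def vs.vector_space_axioms)

lemma act_inv:
  assumes "g \<in> carrier G" "v \<in> V"
  shows "act g (act (inv\<^bsub>G\<^esub> g) v) = v" "act (inv\<^bsub>G\<^esub> g) (act g v) = v"
proof -
  interpret group G by (rule group_G)
  show "act g (act (inv\<^bsub>G\<^esub> g) v) = v" "act (inv\<^bsub>G\<^esub> g) (act g v) = v"
    using assms by (simp_all add: act_mult[symmetric] act_one)
qed

lemma F_lin: "\<phi> \<in> F \<Longrightarrow> lin_on V sc (*) \<phi>"
  by (simp add: functionals_def)

lemma F_lin_on: "\<phi> \<in> F \<Longrightarrow> lin_on_subspace sc (*) V \<phi>"
  using V_subspace F_lin vector_space_complex
  by (simp add: lin_on_subspace_def lin_on_subspace_axioms_def vs.vector_space_axioms)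

lemma F_outside: "\<phi> \<in> F \<Longrightarrow> v \<notin> V \<Longrightarrow> \<phi> v = 0"
  by (simp add: functionals_def)

lemma F_eqI: "\<phi> \<in> F \<Longrightarrow> \<psi> \<in> F \<Longrightarrow> (\<And>v. v \<in> V \<Longrightarrow> \<phi> v = \<psi> v) \<Longrightarrow> \<phi> = \<psi>"
  by (rule ext) (metis F_outside)

lemma F_subspace: "fs.subspace F"
  by (rule fs.subspaceI) (auto simp: functionals_def lin_on_def algebra_simps)

lemmas F_0 = fs.subspace_0[OF F_subspace]
  and F_add = fs.subspace_add[OF F_subspace]
  and F_diff = fs.subspace_diff[OF F_subspace]
  and F_scale = fs.subspace_scale[OF F_subspace]
  and F_sum = fs.subspace_sum[OF F_subspace]

lemma pullback_apply [simp]: "v \<in> V \<Longrightarrow> pullback \<pi> g \<phi> v = \<phi> (act g v)"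
  by (simp add: pullback_def)

lemma pullback_closed: "g \<in> carrier G \<Longrightarrow> \<phi> \<in> F \<Longrightarrow> pullback \<pi> g \<phi> \<in> F"
  using act_lin[of g] act_closed[of g] V_add V_scale
  by (auto simp: functionals_def lin_on_def pullback_def)

lemma pullback_lin: "g \<in> carrier G \<Longrightarrow> lin_on F fun_scale fun_scale (pullback \<pi> g)"
  by (auto simp: lin_on_def pullback_def)

lemma pullback_mult:
  assumes "g \<in> carrier G" "h \<in> carrier G"
  shows "pullback \<pi> (g \<otimes>\<^bsub>G\<^esub> h) \<phi> = pullback \<pi> h (pullback \<pi> g \<phi>)"
  by (rule ext) (use assms in \<open>auto simp: pullback_def act_mult act_closed\<close>)

lemma pullback_one: "\<phi> \<in> F \<Longrightarrow> pullback \<pi> \<one>\<^bsub>G\<^esub> \<phi> = \<phi>"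
  by (rule ext) (auto simp: pullback_def act_one F_outside)

lemma pullback_inv:
  assumes "g \<in> carrier G" "\<phi> \<in> F"
  shows "pullback \<pi> g (pullback \<pi> (inv\<^bsub>G\<^esub> g) \<phi>) = \<phi>" "pullback \<pi> (inv\<^bsub>G\<^esub> g) (pullback \<pi> g \<phi>) = \<phi>"
proof -
  interpret group G by (rule group_G)
  show "pullback \<pi> g (pullback \<pi> (inv\<^bsub>G\<^esub> g) \<phi>) = \<phi>" "pullback \<pi> (inv\<^bsub>G\<^esub> g) (pullback \<pi> g \<phi>) = \<phi>"
    using assms by (simp_all add: pullback_mult[symmetric] pullback_one)
qed

text \<open>The coordinate functionals of a basis of \<open>V\<close>, cut off to 0 outside
  \<open>V\<close> as the encoding of functionals demands.\<close>

lemma dual_basis: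
  obtains B \<beta> where "finite B" "B \<subseteq> V" "\<And>b. b \<in> B \<Longrightarrow> \<beta> b \<in> F"
    "\<And>v. v \<in> V \<Longrightarrow> v = (\<Sum>b\<in>B. sc (\<beta> b v) b)"
    "\<And>\<phi>. \<phi> \<in> F \<Longrightarrow> \<phi> = (\<Sum>b\<in>B. fun_scale (\<phi> b) (\<beta> b))"
proof -
  obtain S where "finite S" "V \<subseteq> vs.span S" using V_fin by auto
  then obtain B where B: "finite B" "B \<subseteq> V" "vs.independent B" "vs.span B = V"
    using vs.obtain_finite_basis[OF V_subspace] by metis
  define \<beta> where "\<beta> b v = (if v \<in> V then vs.representation B v b else 0)" for b v
  have F: "\<beta> b \<in> F" if "b \<in> B" for b
    using B V_add V_scale
    by (auto simp: functionals_def lin_on_def \<beta>_def vs.representation_add vs.representation_scale)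
  have exp: "v = (\<Sum>b\<in>B. sc (\<beta> b v) b)" if "v \<in> V" for v
    using vs.sum_representation_eq[OF B(3) _ B(1), of v] that B(4) by (simp add: \<beta>_def)
  have "\<phi> = (\<Sum>b\<in>B. fun_scale (\<phi> b) (\<beta> b))" if \<phi>: "\<phi> \<in> F" for \<phi>
  proof (rule F_eqI[OF \<phi>])
    show "(\<Sum>b\<in>B. fun_scale (\<phi> b) (\<beta> b)) \<in> F" by (intro F_sum F_scale F)
    fix v assume v: "v \<in> V"
    have "\<phi> v = \<phi> (\<Sum>b\<in>B. sc (\<beta> b v) b)" using exp[OF v] by simp
    also have "\<dots> = (\<Sum>b\<in>B. \<beta> b v * \<phi> b)"
      using B(2) by (intro lin_on_subspace.map_lincomb[OF F_lin_on[OF \<phi>]]) auto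
    finally show "\<phi> v = (\<Sum>b\<in>B. fun_scale (\<phi> b) (\<beta> b)) v" by (simp add: sum_fun_apply mult.commute)
  qed
  with that B(1,2) F exp show ?thesis by blast
qed

lemma F_fin: "\<exists>S. finite S \<and> F \<subseteq> fs.span S"
proof -
  obtain B \<beta> where B: "finite B" "\<And>\<phi>. \<phi> \<in> F \<Longrightarrow> \<phi> = (\<Sum>b\<in>B. fun_scale (\<phi> b) (\<beta> b))"
    by (rule dual_basis) metis
  have "\<phi> \<in> fs.span (\<beta> ` B)" if "\<phi> \<in> F" for \<phi>
  proof -
    have "(\<Sum>b\<in>B. fun_scale (\<phi> b) (\<beta> b)) \<in> fs.span (\<beta> ` B)"
      by (intro fs.span_sum fs.span_scale fs.span_base) auto
    then show ?thesis using B(2)[OF that] by simp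
  qed
  then show ?thesis using B(1) by blast
qed

lemma separation:
  assumes "v \<in> V" "w \<in> V" "\<And>\<phi>. \<phi> \<in> F \<Longrightarrow> \<phi> v = \<phi> w"
  shows "v = w"
proof -
  obtain B \<beta> where B: "\<And>b. b \<in> B \<Longrightarrow> \<beta> b \<in> F" "\<And>v. v \<in> V \<Longrightarrow> v = (\<Sum>b\<in>B. sc (\<beta> b v) b)"
    by (rule dual_basis) metis
  have "v = (\<Sum>b\<in>B. sc (\<beta> b v) b)" using B(2) assms by blast
  also have "\<dots> = (\<Sum>b\<in>B. sc (\<beta> b w) b)" by (rule sum.cong) (use B(1) assms(3) in auto)
  also have "\<dots> = w" using B(2) assms by metis
  finally show ?thesis .
qed

text \<open>A linear form on the dual is determined by its values on the coordinate functionals,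
  which serve as the coordinates of the vector sought. This is what turns a slice of a bilinear form
  into a vector.\<close>

lemma reflexivity:
  assumes L: "lin_on F fun_scale (*) L"
  shows "\<exists>v\<in>V. \<forall>\<phi>\<in>F. L \<phi> = \<phi> v"
proof -
  obtain B \<beta> where B: "finite B" "B \<subseteq> V" "\<And>b. b \<in> B \<Longrightarrow> \<beta> b \<in> F"
    "\<And>\<phi>. \<phi> \<in> F \<Longrightarrow> \<phi> = (\<Sum>b\<in>B. fun_scale (\<phi> b) (\<beta> b))"
    by (rule dual_basis) metis
  interpret l: lin_on_subspace fun_scale "(*)" F L
    using L F_subspace vector_space_complex
    by (simp add: lin_on_subspace_def lin_on_subspace_axioms_def vector_space_fun_scale)
  show ?thesis
  proof (intro bexI ballI)
    show "(\<Sum>b\<in>B. sc (L (\<beta> b)) b) \<in> V" using B(2) by (intro V_sum V_scale) auto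
    fix \<phi> assume \<phi>: "\<phi> \<in> F"
    have "L \<phi> = L (\<Sum>b\<in>B. fun_scale (\<phi> b) (\<beta> b))" using B(4)[OF \<phi>] by simp
    also have "\<dots> = (\<Sum>b\<in>B. \<phi> b * L (\<beta> b))" by (rule l.map_lincomb) (rule B(3))
    also have "\<dots> = (\<Sum>b\<in>B. L (\<beta> b) * \<phi> b)" by (simp add: mult.commute)
    also have "\<dots> = \<phi> (\<Sum>b\<in>B. sc (L (\<beta> b)) b)"
      using B(2) by (intro lin_on_subspace.map_lincomb[OF F_lin_on[OF \<phi>], symmetric]) auto
    finally show "L \<phi> = \<phi> (\<Sum>b\<in>B. sc (L (\<beta> b)) b)" .
  qed
qed

text \<open>Independence allows a linear form on the dual with prescribed values on
  \<open>I\<close>; by reflexivity it is evaluation at a vector.\<close>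

lemma dual_vectors:
  assumes I: "finite I" "I \<subseteq> F" "fs.independent I"
  obtains v where "\<And>\<alpha>. \<alpha> \<in> I \<Longrightarrow> v \<alpha> \<in> V" "\<And>\<alpha> \<beta>. \<alpha> \<in> I \<Longrightarrow> \<beta> \<in> I \<Longrightarrow> \<beta> (v \<alpha>) = (if \<alpha> = \<beta> then 1 else 0)"
proof -
  interpret p: vector_space_pair "fun_scale :: complex \<Rightarrow> ('v \<Rightarrow> complex) \<Rightarrow> _" "(*) :: complex \<Rightarrow> complex \<Rightarrow> complex"
    using vector_space_fun_scale vector_space_complex by (simp add: vector_space_pair_def)
  have "\<exists>v\<in>V. \<forall>\<beta>\<in>I. \<beta> v = (if \<alpha> = \<beta> then 1 else 0)" for \<alpha>
  proof -
    obtain L where L: "Vector_Spaces.linear fun_scale (*) L" "\<forall>\<beta>\<in>I. L \<beta> = (if \<alpha> = \<beta> then 1 else 0)"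
      using p.linear_independent_extend[OF I(3), of "\<lambda>\<beta>. if \<alpha> = \<beta> then 1 else 0"] by blast
    have "lin_on F fun_scale (*) L"
      using L(1) by (simp add: lin_on_def p.linear_add p.linear_scale)
    then obtain v where v: "v \<in> V" "\<forall>\<phi>\<in>F. L \<phi> = \<phi> v" using reflexivity[of L] by auto
    have "\<beta> v = (if \<alpha> = \<beta> then 1 else 0)" if "\<beta> \<in> I" for \<beta>
      using that v L(2) I(2) by (metis subsetD)
    then show ?thesis using v(1) by blast
  qed
  then show ?thesis using that by metis
qed

end

section \<open>Averaging against a character\<close>

lemma sum_group_translate:
  assumes "group K" "l \<in> carrier K"
  shows "(\<Sum>k\<in>carrier K. f (l \<otimes>\<^bsub>K\<^esub> k)) = (\<Sum>k\<in>carrier K. f k)"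
    "(\<Sum>k\<in>carrier K. f (k \<otimes>\<^bsub>K\<^esub> l)) = (\<Sum>k\<in>carrier K. f k)"
proof -
  interpret group K by (rule assms)
  show "(\<Sum>k\<in>carrier K. f (l \<otimes>\<^bsub>K\<^esub> k)) = (\<Sum>k\<in>carrier K. f k)"
    by (rule sum.reindex_bij_witness[where i = "\<lambda>k. inv\<^bsub>K\<^esub> l \<otimes>\<^bsub>K\<^esub> k" and j = "\<lambda>k. l \<otimes>\<^bsub>K\<^esub> k"])
      (use assms(2) in \<open>auto simp: m_assoc[symmetric]\<close>)
  show "(\<Sum>k\<in>carrier K. f (k \<otimes>\<^bsub>K\<^esub> l)) = (\<Sum>k\<in>carrier K. f k)"
    by (rule sum.reindex_bij_witness[where i = "\<lambda>k. k \<otimes>\<^bsub>K\<^esub> inv\<^bsub>K\<^esub> l" and j = "\<lambda>k. k \<otimes>\<^bsub>K\<^esub> l"])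
      (use assms(2) in \<open>auto simp: m_assoc\<close>)
qed

locale character_average = representation G \<pi>
  for G :: "('g, 'b) monoid_scheme" and \<pi> :: "('g, 'v::ab_group_add) rep" +
  fixes K :: "('k, 'c) monoid_scheme" and \<rho> :: "'k \<Rightarrow> 'g" and \<chi> :: "'k \<Rightarrow> complex"
  assumes group_K: "group K" and finite_K: "finite (carrier K)" and \<rho>: "\<rho> \<in> hom K G"
    and \<chi>_mult: "\<And>k l. k \<in> carrier K \<Longrightarrow> l \<in> carrier K \<Longrightarrow> \<chi> (k \<otimes>\<^bsub>K\<^esub> l) = \<chi> k * \<chi> l"
    and \<chi>_nonzero: "\<And>k. k \<in> carrier K \<Longrightarrow> \<chi> k \<noteq> 0"
begin

text \<open>The projector onto the isotypic part of the character.\<close>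

definition avg :: "'v \<Rightarrow> 'v" where
  "avg v = sc (1 / of_nat (card (carrier K))) (\<Sum>k\<in>carrier K. sc (inverse (\<chi> k)) (act (\<rho> k) v))"

definition eigvecs :: "'v set" where
  "eigvecs = {v \<in> V. \<forall>k\<in>carrier K. act (\<rho> k) v = sc (\<chi> k) v}"

definition eigfuns :: "('v \<Rightarrow> complex) set" where
  "eigfuns = {\<phi> \<in> F. \<forall>k\<in>carrier K. \<forall>v\<in>V. \<phi> (act (\<rho> k) v) = \<chi> k * \<phi> v}"

lemma \<rho>_closed: "k \<in> carrier K \<Longrightarrow> \<rho> k \<in> carrier G"
  and \<rho>_mult: "k \<in> carrier K \<Longrightarrow> l \<in> carrier K \<Longrightarrow> \<rho> (k \<otimes>\<^bsub>K\<^esub> l) = \<rho> k \<otimes>\<^bsub>G\<^esub> \<rho> l"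
  using \<rho> by (auto simp: hom_def)

lemma card_K: "of_nat (card (carrier K)) \<noteq> (0 :: complex)"
proof -
  interpret group K by (rule group_K)
  show ?thesis using finite_K by (auto simp: card_eq_0_iff)
qed

lemma avg_closed: "v \<in> V \<Longrightarrow> avg v \<in> V"
  unfolding avg_def by (intro V_scale V_sum act_closed \<rho>_closed)

lemma avg_lin: "lin_on V sc sc avg"
proof -
  have "avg (v + w) = avg v + avg w" if "v \<in> V" "w \<in> V" for v w
    using that lin_on_add[OF act_lin[OF \<rho>_closed]]
    by (simp add: avg_def vs.scale_right_distrib sum.distrib)
  moreover have "avg (sc c v) = sc c (avg v)" if "v \<in> V" for c v
    using that lin_on_scale[OF act_lin[OF \<rho>_closed]]
    by (simp add: avg_def vs.scale_sum_right mult.left_commute mult.commute)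
  ultimately show ?thesis by (simp add: lin_on_def)
qed

lemma avg_eigvec:
  assumes v: "v \<in> V"
  shows "avg v \<in> eigvecs"
proof -
  let ?n = "1 / of_nat (card (carrier K)) :: complex"
  let ?f = "\<lambda>k. sc (inverse (\<chi> k)) (act (\<rho> k) v)"
  have S: "(\<Sum>k\<in>carrier K. ?f k) \<in> V" by (intro V_sum V_scale act_closed \<rho>_closed v)
  have "act (\<rho> l) (avg v) = sc (\<chi> l) (avg v)" if l: "l \<in> carrier K" for l
  proof -
    interpret a: lin_on_subspace sc sc V "act (\<rho> l)" by (rule act_lin_on[OF \<rho>_closed[OF l]])
    have "act (\<rho> l) (avg v) = sc ?n (act (\<rho> l) (\<Sum>k\<in>carrier K. ?f k))"
      unfolding avg_def by (rule lin_on_scale[OF a.lin S])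
    also have "act (\<rho> l) (\<Sum>k\<in>carrier K. ?f k) = (\<Sum>k\<in>carrier K. sc (inverse (\<chi> k)) (act (\<rho> l) (act (\<rho> k) v)))"
      by (rule a.map_lincomb) (intro act_closed \<rho>_closed v)
    also have "\<dots> = (\<Sum>k\<in>carrier K. sc (\<chi> l) (?f (l \<otimes>\<^bsub>K\<^esub> k)))"
      by (rule sum.cong) (use l v \<chi>_nonzero in \<open>auto simp: \<chi>_mult \<rho>_mult act_mult \<rho>_closed\<close>)
    also have "\<dots> = sc (\<chi> l) (\<Sum>k\<in>carrier K. ?f k)"
      by (subst sum_group_translate(1)[OF group_K l]) (simp add: vs.scale_sum_right)
    finally show ?thesis by (simp add: avg_def mult.commute)
  qed
  then show ?thesis using avg_closed[OF v] by (simp add: eigvecs_def)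
qed

lemma avg_fixes: "v \<in> eigvecs \<Longrightarrow> avg v = v"
  using \<chi>_nonzero card_K by (simp add: avg_def eigvecs_def vs.sum_constant_scale)

lemma eigfun_avg:
  assumes "\<phi> \<in> eigfuns" "v \<in> V"
  shows "\<phi> (avg v) = \<phi> v"
proof -
  have \<phi>: "\<phi> \<in> F" using assms by (simp add: eigfuns_def)
  interpret l: lin_on_subspace sc "(*)" V \<phi> by (rule F_lin_on[OF \<phi>])
  have "(\<Sum>k\<in>carrier K. sc (inverse (\<chi> k)) (act (\<rho> k) v)) \<in> V"
    by (intro V_sum V_scale act_closed \<rho>_closed assms)
  then have "\<phi> (avg v) = 1 / of_nat (card (carrier K)) * \<phi> (\<Sum>k\<in>carrier K. sc (inverse (\<chi> k)) (act (\<rho> k) v))"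
    unfolding avg_def by (rule lin_on_scale[OF l.lin])
  also have "\<phi> (\<Sum>k\<in>carrier K. sc (inverse (\<chi> k)) (act (\<rho> k) v))
      = (\<Sum>k\<in>carrier K. inverse (\<chi> k) * \<phi> (act (\<rho> k) v))"
    by (rule l.map_lincomb) (intro act_closed \<rho>_closed assms)
  also have "\<dots> = (\<Sum>k\<in>carrier K. \<phi> v)"
    by (rule sum.cong) (use assms \<chi>_nonzero in \<open>auto simp: eigfuns_def\<close>)
  finally show ?thesis using card_K by simp
qed

lemma avg_act:
  assumes v: "v \<in> V" and l: "l \<in> carrier K"
  shows "avg (act (\<rho> l) v) = sc (\<chi> l) (avg v)"
proof -
  let ?f = "\<lambda>k. sc (inverse (\<chi> k)) (act (\<rho> k) v)"
  have "(\<Sum>k\<in>carrier K. sc (inverse (\<chi> k)) (act (\<rho> k) (act (\<rho> l) v)))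
      = (\<Sum>k\<in>carrier K. sc (\<chi> l) (?f (k \<otimes>\<^bsub>K\<^esub> l)))"
    by (rule sum.cong) (use l v \<chi>_nonzero in \<open>auto simp: \<chi>_mult \<rho>_mult act_mult \<rho>_closed\<close>)
  also have "\<dots> = sc (\<chi> l) (\<Sum>k\<in>carrier K. ?f k)"
    by (subst sum_group_translate(2)[OF group_K l]) (simp add: vs.scale_sum_right)
  finally show ?thesis by (simp add: avg_def mult.commute)
qed

lemma comp_avg_eigfun:
  assumes "\<phi> \<in> F"
  shows "(\<lambda>v. if v \<in> V then \<phi> (avg v) else 0) \<in> eigfuns"
proof -
  have "(\<lambda>v. if v \<in> V then \<phi> (avg v) else 0) \<in> F"
    using F_lin[OF assms] avg_lin avg_closed V_add V_scale by (auto simp: functionals_def lin_on_def)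
  then show ?thesis
    using avg_act avg_closed act_closed \<rho>_closed lin_on_scale[OF F_lin[OF assms]]
    by (auto simp: eigfuns_def)
qed

lemma eigfuns_subspace: "fs.subspace eigfuns"
  using F_0 F_add F_scale by (intro fs.subspaceI) (auto simp: eigfuns_def algebra_simps)

text \<open>Averaging a vector does not change the values of eigenfunctionals on it, so vectors dual
  to a basis of eigenfunctionals can be replaced by eigenvectors. Conversely any functional composed
  with \<open>avg\<close> is an eigenfunctional and agrees with the original on eigenvectors, so
  eigenfunctionals separate them.\<close>

lemma eigvecs_dual_basis:
  obtains I a where "finite I" "I \<subseteq> eigfuns" "card I = fs.dim eigfuns" "\<And>\<alpha>. \<alpha> \<in> I \<Longrightarrow> a \<alpha> \<in> eigvecs"
    "\<And>\<alpha> \<beta>. \<alpha> \<in> I \<Longrightarrow> \<beta> \<in> I \<Longrightarrow> \<beta> (a \<alpha>) = (if \<alpha> = \<beta> then 1 else 0)"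
    "\<And>v. v \<in> eigvecs \<Longrightarrow> (\<And>\<alpha>. \<alpha> \<in> I \<Longrightarrow> \<alpha> v = 0) \<Longrightarrow> v = 0"
proof -
  have EF: "eigfuns \<subseteq> F" by (auto simp: eigfuns_def)
  obtain S where "finite S" "F \<subseteq> fs.span S" using F_fin by blast
  then obtain I where I: "finite I" "I \<subseteq> eigfuns" "fs.independent I" "fs.span I = eigfuns" "card I = fs.dim eigfuns"
    using fs.obtain_finite_basis[OF eigfuns_subspace] EF by (metis order_trans)
  obtain v where v: "\<And>\<alpha>. \<alpha> \<in> I \<Longrightarrow> v \<alpha> \<in> V"
      "\<And>\<alpha> \<beta>. \<alpha> \<in> I \<Longrightarrow> \<beta> \<in> I \<Longrightarrow> \<beta> (v \<alpha>) = (if \<alpha> = \<beta> then 1 else 0)"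
    using dual_vectors[OF I(1) _ I(3)] I(2) EF by (metis order_trans)
  have sep: "w = 0" if w: "w \<in> eigvecs" and 0: "\<And>\<alpha>. \<alpha> \<in> I \<Longrightarrow> \<alpha> w = 0" for w
  proof (rule separation)
    show "w \<in> V" using w by (simp add: eigvecs_def)
    show "0 \<in> V" by (rule V_0)
    have kill: "\<psi> w = 0" if "\<psi> \<in> eigfuns" for \<psi>
    proof -
      have "\<psi> \<in> fs.span I" using that I(4) by simp
      then show ?thesis by (induction rule: fs.span_induct_alt) (auto simp: 0)
    qed
    fix \<phi> assume \<phi>: "\<phi> \<in> F"
    have "\<phi> w = \<phi> (avg w)" using avg_fixes[OF w] by simp
    also have "\<dots> = 0" using kill[OF comp_avg_eigfun[OF \<phi>]] w by (simp add: eigvecs_def)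
    finally show "\<phi> w = \<phi> 0" using lin_on_subspace.map_0[OF F_lin_on[OF \<phi>]] by simp
  qed
  show ?thesis
  proof (rule that[of I "\<lambda>\<alpha>. avg (v \<alpha>)"])
    show "avg (v \<alpha>) \<in> eigvecs" if "\<alpha> \<in> I" for \<alpha> using avg_eigvec v(1)[OF that] by blast
    show "\<beta> (avg (v \<alpha>)) = (if \<alpha> = \<beta> then 1 else 0)" if "\<alpha> \<in> I" "\<beta> \<in> I" for \<alpha> \<beta>
      using eigfun_avg v that I(2) by auto
  qed (use I sep in auto)
qed

end


section \<open>Tensor products as spaces of bilinear forms\<close>

text \<open>The model of the tensor product used throughout; the cut-off to 0 makes a form
  determined by its values on genuine functionals.\<close>

definition bilinear_form ::
  "('g, 'v::ab_group_add) rep \<Rightarrow> ('h, 'w::ab_group_add) rep \<Rightarrow> (('v \<Rightarrow> complex) \<times> ('w \<Rightarrow> complex) \<Rightarrow> complex) \<Rightarrow> bool"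
  where "bilinear_form \<pi>1 \<pi>2 B \<longleftrightarrow>
    (\<forall>\<phi>\<in>functionals \<pi>1. lin_on (functionals \<pi>2) fun_scale (*) (\<lambda>\<psi>. B (\<phi>, \<psi>))) \<and>
    (\<forall>\<psi>\<in>functionals \<pi>2. lin_on (functionals \<pi>1) fun_scale (*) (\<lambda>\<phi>. B (\<phi>, \<psi>))) \<and>
    (\<forall>\<phi> \<psi>. \<phi> \<notin> functionals \<pi>1 \<or> \<psi> \<notin> functionals \<pi>2 \<longrightarrow> B (\<phi>, \<psi>) = 0)"

lemma bilinear_form_subspace: "fs.subspace (Collect (bilinear_form \<pi>1 \<pi>2))"
  by (rule fs.subspaceI) (auto simp: bilinear_form_def lin_on_def algebra_simps)

lemma bilinear_form_eqI:
  assumes "bilinear_form \<pi>1 \<pi>2 B" "bilinear_form \<pi>1 \<pi>2 B'"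
    and "\<And>\<phi> \<psi>. \<phi> \<in> functionals \<pi>1 \<Longrightarrow> \<psi> \<in> functionals \<pi>2 \<Longrightarrow> B (\<phi>, \<psi>) = B' (\<phi>, \<psi>)"
  shows "B = B'"
proof (rule ext)
  fix p show "B p = B' p"
    using assms unfolding bilinear_form_def by (cases p) metis
qed

lemma bilinear_form_swap:
  "bilinear_form \<pi>1 \<pi>2 B \<Longrightarrow> bilinear_form \<pi>2 \<pi>1 (\<lambda>(\<psi>, \<phi>). B (\<phi>, \<psi>))"
  by (auto simp: bilinear_form_def)

locale representation_pair = r1: representation G \<pi>1 + r2: representation H \<pi>2
  for G :: "('g, 'b) monoid_scheme" and \<pi>1 :: "('g, 'v::ab_group_add) rep"
    and H :: "('h, 'c) monoid_scheme" and \<pi>2 :: "('h, 'w::ab_group_add) rep"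
begin

lemma pure_tensor_bilinear:
  assumes "v \<in> r1.V" "w \<in> r2.V"
  shows "bilinear_form \<pi>1 \<pi>2 (pure_tensor \<pi>1 \<pi>2 v w)"
  using r1.F_add r2.F_add r1.F_scale r2.F_scale
  by (auto simp: bilinear_form_def pure_tensor_def lin_on_def algebra_simps)

lemma form_vector_fst:
  assumes "bilinear_form \<pi>1 \<pi>2 B" "\<psi> \<in> r2.F"
  shows "\<exists>v\<in>r1.V. \<forall>\<phi>\<in>r1.F. B (\<phi>, \<psi>) = \<phi> v"
  using r1.reflexivity[of "\<lambda>\<phi>. B (\<phi>, \<psi>)"] assms by (simp add: bilinear_form_def)

lemma form_vector_snd:
  assumes "bilinear_form \<pi>1 \<pi>2 B" "\<phi> \<in> r1.F"
  shows "\<exists>w\<in>r2.V. \<forall>\<psi>\<in>r2.F. B (\<phi>, \<psi>) = \<psi> w"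
  using r2.reflexivity[of "\<lambda>\<psi>. B (\<phi>, \<psi>)"] assms by (simp add: bilinear_form_def)

text \<open>Expanding the first argument in a dual basis writes \<open>B\<close> as the sum of the
  pure tensors of \<open>b\<close> with the vector representing the slice at the coordinate
  functional of \<open>b\<close>. The span in the definition is thereby replaced by a closed
  condition.\<close>

lemma tensor_space: "rep_space (tensor_rep \<pi>1 \<pi>2) = Collect (bilinear_form \<pi>1 \<pi>2)"
proof -
  let ?P = "{pure_tensor \<pi>1 \<pi>2 v w |v w. v \<in> r1.V \<and> w \<in> r2.V}"
  have "fs.span ?P = Collect (bilinear_form \<pi>1 \<pi>2)"
  proof
    show "fs.span ?P \<subseteq> Collect (bilinear_form \<pi>1 \<pi>2)"
      by (rule fs.span_minimal) (use pure_tensor_bilinear bilinear_form_subspace in auto)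
    show "Collect (bilinear_form \<pi>1 \<pi>2) \<subseteq> fs.span ?P"
    proof
      fix B assume "B \<in> Collect (bilinear_form \<pi>1 \<pi>2)"
      then have B: "bilinear_form \<pi>1 \<pi>2 B" by simp
      obtain S \<beta> where S: "finite S" "S \<subseteq> r1.V" "\<And>b. b \<in> S \<Longrightarrow> \<beta> b \<in> r1.F"
        "\<And>\<phi>. \<phi> \<in> r1.F \<Longrightarrow> \<phi> = (\<Sum>b\<in>S. fun_scale (\<phi> b) (\<beta> b))"
        by (rule r1.dual_basis) metis
      have "\<forall>b\<in>S. \<exists>w\<in>r2.V. \<forall>\<psi>\<in>r2.F. B (\<beta> b, \<psi>) = \<psi> w" using form_vector_snd[OF B S(3)] by blast
      then obtain w where w: "\<And>b. b \<in> S \<Longrightarrow> w b \<in> r2.V" "\<And>b \<psi>. b \<in> S \<Longrightarrow> \<psi> \<in> r2.F \<Longrightarrow> B (\<beta> b, \<psi>) = \<psi> (w b)"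
        by metis
      let ?T = "\<Sum>b\<in>S. pure_tensor \<pi>1 \<pi>2 b (w b)"
      have T: "?T \<in> fs.span ?P" using S(2) w(1) by (intro fs.span_sum fs.span_base) auto
      have "B = ?T"
      proof (rule bilinear_form_eqI[OF B])
        have "?T \<in> Collect (bilinear_form \<pi>1 \<pi>2)"
          by (rule fs.subspace_sum[OF bilinear_form_subspace]) (use pure_tensor_bilinear S(2) w(1) in auto)
        then show "bilinear_form \<pi>1 \<pi>2 ?T" by simp
        fix \<phi> \<psi> assume \<phi>: "\<phi> \<in> r1.F" and \<psi>: "\<psi> \<in> r2.F"
        interpret l: lin_on_subspace fun_scale "(*)" r1.F "\<lambda>\<phi>. B (\<phi>, \<psi>)"
          using B \<psi> r1.F_subspace vector_space_complex vector_space_fun_scale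
          by (simp add: lin_on_subspace_def lin_on_subspace_axioms_def bilinear_form_def)
        have "B (\<phi>, \<psi>) = B ((\<Sum>b\<in>S. fun_scale (\<phi> b) (\<beta> b)), \<psi>)" using S(4)[OF \<phi>] by simp
        also have "\<dots> = (\<Sum>b\<in>S. \<phi> b * B (\<beta> b, \<psi>))" by (rule l.map_lincomb) (rule S(3))
        also have "\<dots> = ?T (\<phi>, \<psi>)"
          using \<phi> \<psi> w(2) by (simp add: sum_fun_apply pure_tensor_def)
        finally show "B (\<phi>, \<psi>) = ?T (\<phi>, \<psi>)" .
      qed
      then show "B \<in> fs.span ?P" using T by simp
    qed
  qed
  then show ?thesis by (simp add: tensor_rep_def)
qed

definition form_act :: "'g \<Rightarrow> 'h \<Rightarrow> _ \<Rightarrow> (('v \<Rightarrow> complex) \<times> ('w \<Rightarrow> complex) \<Rightarrow> complex)" where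
  "form_act g h B = (\<lambda>(\<phi>, \<psi>). if \<phi> \<in> r1.F \<and> \<psi> \<in> r2.F then B (pullback \<pi>1 g \<phi>, pullback \<pi>2 h \<psi>) else 0)"

lemma tensor_act: "rep_act (tensor_rep \<pi>1 \<pi>2) (g, h) B = form_act g h B"
  by (simp add: tensor_rep_def form_act_def)

lemma form_act_bilinear:
  assumes "g \<in> carrier G" "h \<in> carrier H" "bilinear_form \<pi>1 \<pi>2 B"
  shows "bilinear_form \<pi>1 \<pi>2 (form_act g h B)"
  using assms r1.F_add r2.F_add r1.F_scale r2.F_scale
    r1.pullback_closed r2.pullback_closed r1.pullback_lin[of g] r2.pullback_lin[of h]
  by (auto simp: bilinear_form_def form_act_def lin_on_def)

end

section \<open>Invariant forms and Schur's lemma\<close>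

lemma field_units_hom:
  assumes "\<chi> \<in> hom (field_units :: 'f::field monoid) (field_units :: complex monoid)"
  shows "\<And>x y. x \<noteq> 0 \<Longrightarrow> y \<noteq> 0 \<Longrightarrow> \<chi> (x * y) = \<chi> x * \<chi> y" "\<And>x. x \<noteq> 0 \<Longrightarrow> \<chi> x \<noteq> 0"
    "\<chi> 1 = 1" "\<And>x. x \<noteq> 0 \<Longrightarrow> \<chi> (inverse x) = inverse (\<chi> x)"
proof -
  have c: "carrier (field_units :: 'a::field monoid) = {x. x \<noteq> 0}"
    by (auto simp: field_units_def units_of_def Units_def) (metis left_inverse right_inverse)
  have m: "x \<otimes>\<^bsub>field_units\<^esub> y = x * y" for x y :: "'a::field"
    by (simp add: field_units_def units_of_def)
  show mult: "\<chi> (x * y) = \<chi> x * \<chi> y" if "x \<noteq> 0" "y \<noteq> 0" for x y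
    using assms that hom_mult[OF assms, of x y] by (simp add: c m)
  show nz: "\<chi> x \<noteq> 0" if "x \<noteq> 0" for x
    using assms that by (auto simp: hom_def c)
  show one: "\<chi> 1 = 1" using mult[of 1 1] nz[of 1] by simp
  show "\<chi> (inverse x) = inverse (\<chi> x)" if "x \<noteq> 0" for x
    using mult[of x "inverse x"] that one nz[of x] by (simp add: field_simps)
qed

locale same_group_pair = representation_pair G \<pi>1 G \<pi>2
  for G :: "('g, 'b) monoid_scheme" and \<pi>1 :: "('g, 'v::ab_group_add) rep" and \<pi>2 :: "('g, 'w::ab_group_add) rep"

definition invariant_forms where
  "invariant_forms G \<pi>1 \<pi>2 \<chi> = {B. bilinear_form \<pi>1 \<pi>2 B \<and>
     (\<forall>g\<in>carrier G. \<forall>\<phi>\<in>functionals \<pi>1. \<forall>\<psi>\<in>functionals \<pi>2.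
        B (pullback \<pi>1 g \<phi>, pullback \<pi>2 g \<psi>) = \<chi> g * B (\<phi>, \<psi>))}"

lemma invariant_forms_swap:
  "B \<in> invariant_forms G \<pi>1 \<pi>2 \<chi> \<Longrightarrow> (\<lambda>(\<psi>, \<phi>). B (\<phi>, \<psi>)) \<in> invariant_forms G \<pi>2 \<pi>1 \<chi>"
  by (auto simp: invariant_forms_def bilinear_form_swap)

lemma invariant_forms_diff:
  assumes "B \<in> invariant_forms G \<pi>1 \<pi>2 \<chi>" "B' \<in> invariant_forms G \<pi>1 \<pi>2 \<chi>"
  shows "B' - fun_scale c B \<in> invariant_forms G \<pi>1 \<pi>2 \<chi>"
proof -
  have "B' - fun_scale c B \<in> Collect (bilinear_form \<pi>1 \<pi>2)"
    using assms by (intro fs.subspace_diff fs.subspace_scale bilinear_form_subspace) (auto simp: invariant_forms_def)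
  then show ?thesis using assms by (auto simp: invariant_forms_def algebra_simps)
qed

context same_group_pair
begin

lemma form_lin_snd:
  assumes "bilinear_form \<pi>1 \<pi>2 B" "\<phi> \<in> r1.F" "\<psi> \<in> r2.F" "\<psi>' \<in> r2.F"
  shows "B (\<phi>, \<psi> + \<psi>') = B (\<phi>, \<psi>) + B (\<phi>, \<psi>')" "B (\<phi>, fun_scale c \<psi>) = c * B (\<phi>, \<psi>)" "B (\<phi>, 0) = 0"
proof -
  have l: "lin_on r2.F fun_scale (*) (\<lambda>\<psi>. B (\<phi>, \<psi>))" using assms by (simp add: bilinear_form_def)
  show "B (\<phi>, \<psi> + \<psi>') = B (\<phi>, \<psi>) + B (\<phi>, \<psi>')" "B (\<phi>, fun_scale c \<psi>) = c * B (\<phi>, \<psi>)"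
    using lin_on_add[OF l] lin_on_scale[OF l] assms by simp_all
  show "B (\<phi>, 0) = 0" using lin_on_scale[OF l r2.F_0, of 0] by simp
qed

lemma form_lin_fst:
  assumes "bilinear_form \<pi>1 \<pi>2 B" "\<phi> \<in> r1.F" "\<phi>' \<in> r1.F" "\<psi> \<in> r2.F"
  shows "B (\<phi> + \<phi>', \<psi>) = B (\<phi>, \<psi>) + B (\<phi>', \<psi>)" "B (fun_scale c \<phi>, \<psi>) = c * B (\<phi>, \<psi>)" "B (0, \<psi>) = 0"
    "B (\<phi> - \<phi>', \<psi>) = B (\<phi>, \<psi>) - B (\<phi>', \<psi>)"
proof -
  have l: "lin_on r1.F fun_scale (*) (\<lambda>\<phi>. B (\<phi>, \<psi>))" using assms by (simp add: bilinear_form_def)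
  show "B (\<phi> + \<phi>', \<psi>) = B (\<phi>, \<psi>) + B (\<phi>', \<psi>)" "B (fun_scale c \<phi>, \<psi>) = c * B (\<phi>, \<psi>)"
    using lin_on_add[OF l] lin_on_scale[OF l] assms by simp_all
  show "B (0, \<psi>) = 0" using lin_on_scale[OF l r1.F_0, of 0] by simp
  show "B (\<phi> - \<phi>', \<psi>) = B (\<phi>, \<psi>) - B (\<phi>', \<psi>)"
    using lin_on_add[OF l r1.F_diff[OF assms(2,3)] assms(3)] by simp
qed

text \<open>The vectors that represent slices of \<open>B\<close> form a nonzero invariant subspace,
  which irreducibility makes the whole space.\<close>

lemma invariant_form_surj:
  assumes irr: "irreducible_rep G \<pi>1" and B: "B \<in> invariant_forms G \<pi>1 \<pi>2 \<chi>" and nz: "B \<noteq> (\<lambda>_. 0)"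
    and \<chi>: "\<And>g. g \<in> carrier G \<Longrightarrow> \<chi> g \<noteq> 0" and v: "v \<in> r1.V"
  shows "\<exists>\<psi>\<in>r2.F. \<forall>\<phi>\<in>r1.F. B (\<phi>, \<psi>) = \<phi> v"
proof -
  have bil: "bilinear_form \<pi>1 \<pi>2 B" using B by (simp add: invariant_forms_def)
  define W where "W = {v \<in> r1.V. \<exists>\<psi>\<in>r2.F. \<forall>\<phi>\<in>r1.F. B (\<phi>, \<psi>) = \<phi> v}"
  have lin: "\<phi> (v + w) = \<phi> v + \<phi> w" "\<phi> (r1.sc c v) = c * \<phi> v" "\<phi> 0 = 0"
    if "\<phi> \<in> r1.F" "v \<in> r1.V" "w \<in> r1.V" for \<phi> v w c
    using lin_on_add[OF r1.F_lin] lin_on_scale[OF r1.F_lin] lin_on_subspace.map_0[OF r1.F_lin_on] that by blast+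
  have W: "r1.vs.subspace W"
  proof (rule r1.vs.subspaceI)
    show "0 \<in> W"
      unfolding W_def using r1.V_0 r2.F_0 form_lin_snd(3)[OF bil _ r2.F_0 r2.F_0] lin(3)[OF _ r1.V_0 r1.V_0]
      by (intro CollectI conjI bexI[of _ 0] ballI) auto
    show "x + y \<in> W" if xy: "x \<in> W" "y \<in> W" for x y
    proof -
      obtain \<psi> \<psi>' where *: "\<psi> \<in> r2.F" "\<psi>' \<in> r2.F" "\<forall>\<phi>\<in>r1.F. B (\<phi>, \<psi>) = \<phi> x" "\<forall>\<phi>\<in>r1.F. B (\<phi>, \<psi>') = \<phi> y"
        using xy unfolding W_def by blast
      have "x \<in> r1.V" "y \<in> r1.V" using xy by (auto simp: W_def)
      then show ?thesis unfolding W_def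
        using * r1.V_add r2.F_add form_lin_snd(1)[OF bil] lin(1)
        by (intro CollectI conjI bexI[of _ "\<psi> + \<psi>'"] ballI) auto
    qed
    show "r1.sc c x \<in> W" if x: "x \<in> W" for c x
    proof -
      obtain \<psi> where *: "\<psi> \<in> r2.F" "\<forall>\<phi>\<in>r1.F. B (\<phi>, \<psi>) = \<phi> x"
        using x unfolding W_def by blast
      have "x \<in> r1.V" using x by (auto simp: W_def)
      then show ?thesis unfolding W_def
        using * r1.V_scale r2.F_scale form_lin_snd(2)[OF bil _ *(1) *(1)] lin(2)
        by (intro CollectI conjI bexI[of _ "fun_scale c \<psi>"] ballI) auto
    qed
  qed
  have "r1.act g ` W \<subseteq> W" if g: "g \<in> carrier G" for g
  proof
    fix y assume "y \<in> r1.act g ` W"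
    then obtain x \<psi> where x: "y = r1.act g x" "x \<in> r1.V" and \<psi>: "\<psi> \<in> r2.F" "\<forall>\<phi>\<in>r1.F. B (\<phi>, \<psi>) = \<phi> x"
      by (auto simp: W_def)
    interpret group G by (rule r1.group_G)
    \<comment> \<open>If \<open>\<psi>\<close> represents \<open>x\<close>, invariance of
      \<open>B\<close> shows that \<open>\<chi> g\<close> times this functional represents the image
      of \<open>x\<close> under \<open>g\<close>.\<close>
    let ?\<psi> = "pullback \<pi>2 (inv\<^bsub>G\<^esub> g) \<psi>"
    have \<psi>': "?\<psi> \<in> r2.F" using g \<psi> by (intro r2.pullback_closed) auto
    have "B (\<phi>, fun_scale (\<chi> g) ?\<psi>) = \<phi> y" if \<phi>: "\<phi> \<in> r1.F" for \<phi>
    proof -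
      have "B (\<phi>, fun_scale (\<chi> g) ?\<psi>) = \<chi> g * B (\<phi>, ?\<psi>)" by (rule form_lin_snd(2)[OF bil \<phi> \<psi>' \<psi>'])
      also have "\<dots> = B (pullback \<pi>1 g \<phi>, pullback \<pi>2 g ?\<psi>)"
        using B g \<phi> \<psi>' by (simp add: invariant_forms_def)
      also have "\<dots> = B (pullback \<pi>1 g \<phi>, \<psi>)" by (simp add: r2.pullback_inv(1)[OF g \<psi>(1)])
      also have "\<dots> = pullback \<pi>1 g \<phi> x" using \<psi> r1.pullback_closed[OF g \<phi>] by simp
      finally show ?thesis using x by simp
    qed
    then show "y \<in> W"
      unfolding W_def using x r1.act_closed[OF g] r2.F_scale[OF \<psi>']
      by (intro CollectI conjI bexI[of _ "fun_scale (\<chi> g) ?\<psi>"] ballI) auto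
  qed
  moreover have "W \<noteq> {0}"
  proof
    assume W0: "W = {0}"
    obtain \<phi> \<psi> where nz': "B (\<phi>, \<psi>) \<noteq> 0" using nz by (auto simp: fun_eq_iff)
    then have \<phi>\<psi>: "\<phi> \<in> r1.F" "\<psi> \<in> r2.F" using bil by (auto simp: bilinear_form_def)
    obtain x where "x \<in> r1.V" "\<forall>\<phi>\<in>r1.F. B (\<phi>, \<psi>) = \<phi> x" using form_vector_fst[OF bil \<phi>\<psi>(2)] by auto
    then have "x \<in> W" "B (\<phi>, \<psi>) = \<phi> x" using \<phi>\<psi> unfolding W_def by blast+
    then show False using W0 nz' lin(3)[OF \<phi>\<psi>(1) r1.V_0 r1.V_0] by simp
  qed
  ultimately have "W = r1.V"
    using irr W unfolding irreducible_rep_def W_def by blast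
  then show ?thesis using v unfolding W_def by blast
qed

text \<open>Every vector is represented by a slice, and on such a vector \<open>\<phi>\<close> takes
  a value of \<open>B\<close>.\<close>

lemma invariant_form_nondegenerate:
  assumes irr: "irreducible_rep G \<pi>1" and B: "B \<in> invariant_forms G \<pi>1 \<pi>2 \<chi>" and nz: "B \<noteq> (\<lambda>_. 0)"
    and \<chi>: "\<And>g. g \<in> carrier G \<Longrightarrow> \<chi> g \<noteq> 0" and \<phi>: "\<phi> \<in> r1.F" "\<And>\<psi>. \<psi> \<in> r2.F \<Longrightarrow> B (\<phi>, \<psi>) = 0"
  shows "\<phi> = 0"
proof (rule r1.F_eqI[OF \<phi>(1) r1.F_0])
  fix v assume "v \<in> r1.V"
  then obtain \<psi> where "\<psi> \<in> r2.F" "\<forall>\<phi>\<in>r1.F. B (\<phi>, \<psi>) = \<phi> v"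
    using invariant_form_surj[OF irr B nz \<chi>] by auto
  then show "\<phi> v = 0 v" using \<phi> by auto
qed

lemma invariant_form_surj_snd:
  assumes irr: "irreducible_rep G \<pi>2" and B: "B \<in> invariant_forms G \<pi>1 \<pi>2 \<chi>" and nz: "B \<noteq> (\<lambda>_. 0)"
    and \<chi>: "\<And>g. g \<in> carrier G \<Longrightarrow> \<chi> g \<noteq> 0" and w: "w \<in> r2.V"
  shows "\<exists>\<phi>\<in>r1.F. \<forall>\<psi>\<in>r2.F. B (\<phi>, \<psi>) = \<psi> w"
proof -
  interpret swap: same_group_pair G \<pi>2 \<pi>1 ..
  have "(\<lambda>(\<psi>, \<phi>). B (\<phi>, \<psi>)) \<noteq> (\<lambda>_. 0)" using nz by (auto simp: fun_eq_iff)
  then show ?thesis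
    using swap.invariant_form_surj[OF irr invariant_forms_swap[OF B] _ \<chi> w] by simp
qed

text \<open>The two forms differ by an operator, which has an eigenvector in the first argument; nondegeneracy then forces
  them to be proportional.\<close>

lemma invariant_form_unique:
  assumes irr1: "irreducible_rep G \<pi>1" and irr2: "irreducible_rep G \<pi>2"
    and B: "B \<in> invariant_forms G \<pi>1 \<pi>2 \<chi>" and nz: "B \<noteq> (\<lambda>_. 0)" and B': "B' \<in> invariant_forms G \<pi>1 \<pi>2 \<chi>"
    and \<chi>: "\<And>g. g \<in> carrier G \<Longrightarrow> \<chi> g \<noteq> 0"
  shows "\<exists>c. B' = fun_scale c B"
proof -
  have bil: "bilinear_form \<pi>1 \<pi>2 B" and bil': "bilinear_form \<pi>1 \<pi>2 B'" using B B' by (simp_all add: invariant_forms_def)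
  have "\<exists>\<phi>'\<in>r1.F. \<forall>\<psi>\<in>r2.F. B (\<phi>', \<psi>) = B' (\<phi>, \<psi>)" if \<phi>: "\<phi> \<in> r1.F" for \<phi>
  proof -
    obtain w where w: "w \<in> r2.V" "\<forall>\<psi>\<in>r2.F. B' (\<phi>, \<psi>) = \<psi> w" using form_vector_snd[OF bil' \<phi>] by auto
    then obtain \<phi>' where "\<phi>' \<in> r1.F" "\<forall>\<psi>\<in>r2.F. B (\<phi>', \<psi>) = \<psi> w"
      using invariant_form_surj_snd[OF irr2 B nz \<chi> w(1)] by auto
    then show ?thesis using w by (intro bexI[of _ \<phi>']) auto
  qed
  then obtain S where S: "\<And>\<phi>. \<phi> \<in> r1.F \<Longrightarrow> S \<phi> \<in> r1.F"
      "\<And>\<phi> \<psi>. \<phi> \<in> r1.F \<Longrightarrow> \<psi> \<in> r2.F \<Longrightarrow> B (S \<phi>, \<psi>) = B' (\<phi>, \<psi>)"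
    by metis
  have eqI: "\<phi> = \<phi>'" if "\<phi> \<in> r1.F" "\<phi>' \<in> r1.F" "\<And>\<psi>. \<psi> \<in> r2.F \<Longrightarrow> B (\<phi>, \<psi>) = B (\<phi>', \<psi>)" for \<phi> \<phi>'
    using invariant_form_nondegenerate[OF irr1 B nz \<chi> r1.F_diff[OF that(1,2)]] that form_lin_fst(4)[OF bil that(1,2)]
    by simp
  have lin: "lin_on r1.F fun_scale fun_scale S"
    unfolding lin_on_def
  proof (intro conjI ballI allI)
    fix \<phi> \<phi>' assume p: "\<phi> \<in> r1.F" "\<phi>' \<in> r1.F"
    show "S (\<phi> + \<phi>') = S \<phi> + S \<phi>'"
      by (rule eqI) (use p in \<open>auto simp: S r1.F_add form_lin_fst(1)[OF bil] form_lin_fst(1)[OF bil']\<close>)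
  next
    fix c \<phi> assume p: "\<phi> \<in> r1.F"
    show "S (fun_scale c \<phi>) = fun_scale c (S \<phi>)"
      by (rule eqI) (use p in \<open>auto simp: S r1.F_scale form_lin_fst(2)[OF bil _ S(1)[OF p]] form_lin_fst(2)[OF bil' p p]\<close>)
  qed
  obtain \<phi>0 \<psi>0 where nz': "B (\<phi>0, \<psi>0) \<noteq> 0" using nz by (auto simp: fun_eq_iff)
  then have \<phi>0: "\<phi>0 \<in> r1.F" "\<psi>0 \<in> r2.F" using bil by (auto simp: bilinear_form_def)
  have "\<phi>0 \<noteq> 0" using nz' form_lin_fst(3)[OF bil r1.F_0 r1.F_0 \<phi>0(2)] by auto
  moreover obtain Z where Z: "finite Z" "r1.F \<subseteq> fs.span Z" using r1.F_fin by blast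
  ultimately obtain \<phi> c where \<phi>: "\<phi> \<in> r1.F" "\<phi> \<noteq> 0" "S \<phi> = fun_scale c \<phi>"
    using exists_eigenvector[OF vector_space_fun_scale r1.F_subspace lin S(1) Z \<phi>0(1)] by auto
  let ?D = "B' - fun_scale c B"
  have D: "?D \<in> invariant_forms G \<pi>1 \<pi>2 \<chi>" by (rule invariant_forms_diff[OF B B'])
  have "?D (\<phi>, \<psi>) = 0" if "\<psi> \<in> r2.F" for \<psi>
    using S(2)[OF \<phi>(1) that] form_lin_fst(2)[OF bil \<phi>(1) \<phi>(1) that, of c] by (simp add: \<phi>(3))
  then have "?D = (\<lambda>_. 0)"
    using invariant_form_nondegenerate[OF irr1 D _ \<chi> \<phi>(1)] \<phi>(2) by blast
  then have "B' = fun_scale c B" by (simp add: fun_eq_iff)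
  then show ?thesis by blast
qed

end


lemma functionals_twist: "functionals (twist \<pi> \<chi>) = functionals \<pi>"
  by (simp add: functionals_def twist_def)

text \<open>An intertwiner \<open>T\<close> and a form \<open>B\<close> determine each other by
  \<open>B (\<phi>, \<psi>) = \<psi> (T \<phi>)\<close>. Moving the twist of the second
  representation to the other side produces the product of both characters. In the converse
  direction nondegeneracy makes \<open>T\<close> injective and representability of vectors makes it
  surjective.\<close>

lemma iso_dual_twist_iff:
  fixes \<pi>1 :: "('f::field mat, 'v::ab_group_add) rep" and \<pi>2 :: "('f mat, 'w::ab_group_add) rep"
  assumes irr1: "irreducible_rep (GL n) \<pi>1" and irr2: "irreducible_rep (GL n) \<pi>2"
    and hom1: "\<chi>1 \<in> hom field_units field_units" and hom2: "\<chi>2 \<in> hom field_units field_units"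
  shows "iso_rep (GL n) (dual_rep (GL n) (twist \<pi>1 (\<lambda>x. inverse (\<chi>1 x)))) (twist \<pi>2 (\<lambda>x. inverse (\<chi>2 x)))
    \<longleftrightarrow> (\<exists>B\<in>invariant_forms (GL n) \<pi>1 \<pi>2 (\<lambda>g. \<chi>1 (det g) * \<chi>2 (det g)). B \<noteq> (\<lambda>_. 0))" (is "?iso \<longleftrightarrow> ?ex")
proof -
  let ?G = "GL n :: 'f mat monoid"
  let ?\<chi> = "\<lambda>g :: 'f mat. \<chi>1 (det g) * \<chi>2 (det g)"
  have rep: "representation ?G \<pi>1" "representation ?G \<pi>2"
    using irr1 irr2 by (simp_all add: representation_def group_GL irreducible_rep_def)
  interpret same_group_pair ?G \<pi>1 \<pi>2
    by (simp add: same_group_pair_def representation_pair_def rep)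
  note \<chi>1 = field_units_hom[OF hom1] and \<chi>2 = field_units_hom[OF hom2]
  have dn: "det g \<noteq> 0" if "g \<in> carrier ?G" for g using that by (simp add: carrier_GL)
  have \<chi>_nz: "?\<chi> g \<noteq> 0" if "g \<in> carrier ?G" for g
    using \<chi>1(2)[OF dn[OF that]] \<chi>2(2)[OF dn[OF that]] by simp
  have det_inv: "det (inv\<^bsub>?G\<^esub> g) = inverse (det g)" if g: "g \<in> carrier ?G" for g
  proof -
    have "det g * det (inv\<^bsub>?G\<^esub> g) = 1"
      using GL_inv[OF g] g det_mult[of g n "inv\<^bsub>?G\<^esub> g"] by (simp add: carrier_GL)
    then show ?thesis using dn[OF g] by (simp add: field_simps)
  qed
  let ?\<sigma> = "dual_rep ?G (twist \<pi>1 (\<lambda>x. inverse (\<chi>1 x)))" and ?\<tau> = "twist \<pi>2 (\<lambda>x. inverse (\<chi>2 x))"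
  have sp: "rep_space ?\<sigma> = r1.F" "rep_scale ?\<sigma> = fun_scale" "rep_space ?\<tau> = r2.V" "rep_scale ?\<tau> = r2.sc"
    by (simp_all add: dual_rep_def functionals_twist) (simp_all add: twist_def)
  \<comment> \<open>The dual acts through the inverse of \<open>g\<close>, at which the inverse
    character returns \<open>\<chi>1 (det g)\<close>.\<close>
  have act\<sigma>: "rep_act ?\<sigma> g \<phi> = fun_scale (\<chi>1 (det g)) (pullback \<pi>1 (inv\<^bsub>?G\<^esub> g) \<phi>)"
    if g: "g \<in> carrier ?G" and \<phi>: "\<phi> \<in> r1.F" for g \<phi>
  proof
    fix v
    have gi: "inv\<^bsub>?G\<^esub> g \<in> carrier ?G" by (rule GL_inv(1)[OF g])
    show "rep_act ?\<sigma> g \<phi> v = fun_scale (\<chi>1 (det g)) (pullback \<pi>1 (inv\<^bsub>?G\<^esub> g) \<phi>) v"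
      using lin_on_scale[OF r1.F_lin[OF \<phi>] r1.act_closed[OF gi]] \<chi>1(4)[OF dn[OF g]] \<chi>1(2)[OF dn[OF g]]
      by (simp add: dual_rep_def pullback_def twist_def det_inv[OF g])
  qed
  have act\<tau>: "rep_act ?\<tau> g v = r2.sc (inverse (\<chi>2 (det g))) (r2.act g v)" for g v
    by (simp add: twist_def)
  show ?thesis
  proof
    assume ?iso
    then obtain T where bij: "bij_betw T r1.F r2.V" and lin: "lin_on r1.F fun_scale r2.sc T"
      and eq: "\<And>g \<phi>. g \<in> carrier ?G \<Longrightarrow> \<phi> \<in> r1.F \<Longrightarrow> T (rep_act ?\<sigma> g \<phi>) = rep_act ?\<tau> g (T \<phi>)"
      unfolding iso_rep_def sp by blast
    have TV: "T \<phi> \<in> r2.V" if "\<phi> \<in> r1.F" for \<phi> using bij that by (auto simp: bij_betw_def)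
    \<comment> \<open>Applying the intertwining relation to a pulled-back functional cancels the
      inverse in the dual action and gives the shape in which invariance of forms is stated.\<close>
    have eq': "r2.act g (T (pullback \<pi>1 g \<phi>)) = r2.sc (?\<chi> g) (T \<phi>)" if g: "g \<in> carrier ?G" and \<phi>: "\<phi> \<in> r1.F" for g \<phi>
    proof -
      have g\<phi>: "pullback \<pi>1 g \<phi> \<in> r1.F" by (rule r1.pullback_closed[OF g \<phi>])
      have "T (rep_act ?\<sigma> g (pullback \<pi>1 g \<phi>)) = r2.sc (\<chi>1 (det g)) (T \<phi>)"
        by (simp add: act\<sigma>[OF g g\<phi>] r1.pullback_inv(2)[OF g \<phi>] lin_on_scale[OF lin \<phi>])
      then have "r2.sc (inverse (\<chi>2 (det g))) (r2.act g (T (pullback \<pi>1 g \<phi>))) = r2.sc (\<chi>1 (det g)) (T \<phi>)"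
        using eq[OF g g\<phi>] by (simp add: act\<tau>)
      then have "r2.sc (\<chi>2 (det g)) (r2.sc (inverse (\<chi>2 (det g))) (r2.act g (T (pullback \<pi>1 g \<phi>))))
          = r2.sc (\<chi>2 (det g)) (r2.sc (\<chi>1 (det g)) (T \<phi>))" by simp
      then show ?thesis using \<chi>2(2)[OF dn[OF g]] by (simp add: mult.commute)
    qed
    define B where "B = (\<lambda>(\<phi>, \<psi>). if \<phi> \<in> r1.F \<and> \<psi> \<in> r2.F then \<psi> (T \<phi>) else 0)"
    have "bilinear_form \<pi>1 \<pi>2 B"
      using r1.F_add r1.F_scale r2.F_add r2.F_scale lin_on_add[OF lin] lin_on_scale[OF lin] TV
        lin_on_add[OF r2.F_lin] lin_on_scale[OF r2.F_lin]
      by (auto simp: bilinear_form_def B_def lin_on_def)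
    moreover have "B (pullback \<pi>1 g \<phi>, pullback \<pi>2 g \<psi>) = ?\<chi> g * B (\<phi>, \<psi>)"
      if g: "g \<in> carrier ?G" and \<phi>: "\<phi> \<in> r1.F" and \<psi>: "\<psi> \<in> r2.F" for g \<phi> \<psi>
      using eq'[OF g \<phi>] lin_on_scale[OF r2.F_lin[OF \<psi>] TV[OF \<phi>]] TV[OF r1.pullback_closed[OF g \<phi>]]
      by (simp add: B_def r1.pullback_closed g \<phi> r2.pullback_closed \<psi>)
    ultimately have inv: "B \<in> invariant_forms ?G \<pi>1 \<pi>2 ?\<chi>" by (simp add: invariant_forms_def)
    have "B \<noteq> (\<lambda>_. 0)"
    proof
      assume B0: "B = (\<lambda>_. 0)"
      have "w = 0" if w: "w \<in> r2.V" for w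
      proof (rule r2.separation[OF w r2.V_0])
        fix \<psi> assume \<psi>: "\<psi> \<in> r2.F"
        obtain \<phi> where "\<phi> \<in> r1.F" "w = T \<phi>" using bij w by (auto simp: bij_betw_def)
        then have "\<psi> w = B (\<phi>, \<psi>)" using \<psi> by (simp add: B_def)
        then show "\<psi> w = \<psi> 0" using lin_on_subspace.map_0[OF r2.F_lin_on[OF \<psi>]] by (simp add: B0)
      qed
      then show False using irr2 r2.V_0 unfolding irreducible_rep_def by blast
    qed
    then show ?ex using inv by blast
  next
    assume ?ex
    then obtain B where B: "B \<in> invariant_forms ?G \<pi>1 \<pi>2 ?\<chi>" and nz: "B \<noteq> (\<lambda>_. 0)" by blast
    have bil: "bilinear_form \<pi>1 \<pi>2 B" using B by (simp add: invariant_forms_def)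
    have "\<forall>\<phi>\<in>r1.F. \<exists>w\<in>r2.V. \<forall>\<psi>\<in>r2.F. B (\<phi>, \<psi>) = \<psi> w" using form_vector_snd[OF bil] by blast
    then obtain T where T: "\<And>\<phi>. \<phi> \<in> r1.F \<Longrightarrow> T \<phi> \<in> r2.V" "\<And>\<phi> \<psi>. \<phi> \<in> r1.F \<Longrightarrow> \<psi> \<in> r2.F \<Longrightarrow> B (\<phi>, \<psi>) = \<psi> (T \<phi>)"
      by metis
    have lin: "lin_on r1.F fun_scale r2.sc T"
      unfolding lin_on_def
    proof (intro conjI ballI allI)
      fix \<phi> \<phi>' assume p: "\<phi> \<in> r1.F" "\<phi>' \<in> r1.F"
      show "T (\<phi> + \<phi>') = T \<phi> + T \<phi>'"
        by (rule r2.separation)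
          (use p in \<open>auto simp: T(1) T(2)[symmetric] r1.F_add r2.V_add form_lin_fst(1)[OF bil] lin_on_add[OF r2.F_lin]\<close>)
    next
      fix c \<phi> assume p: "\<phi> \<in> r1.F"
      show "T (fun_scale c \<phi>) = r2.sc c (T \<phi>)"
        by (rule r2.separation)
          (use p in \<open>auto simp: T(1) T(2)[symmetric] r1.F_scale r2.V_scale form_lin_fst(2)[OF bil p p] lin_on_scale[OF r2.F_lin]\<close>)
    qed
    have inj: "inj_on T r1.F"
    proof (rule inj_onI)
      fix \<phi> \<phi>' assume p: "\<phi> \<in> r1.F" "\<phi>' \<in> r1.F" "T \<phi> = T \<phi>'"
      have "\<phi> - \<phi>' = 0"
        by (rule invariant_form_nondegenerate[OF irr1 B nz \<chi>_nz r1.F_diff[OF p(1,2)]])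
          (use p T(2) form_lin_fst(4)[OF bil p(1,2)] in simp_all)
      then show "\<phi> = \<phi>'" by simp
    qed
    have "w \<in> T ` r1.F" if w: "w \<in> r2.V" for w
    proof -
      obtain \<phi> where \<phi>: "\<phi> \<in> r1.F" "\<forall>\<psi>\<in>r2.F. B (\<phi>, \<psi>) = \<psi> w"
        using invariant_form_surj_snd[OF irr2 B nz \<chi>_nz w] by auto
      have "w = T \<phi>" by (rule r2.separation[OF w T(1)[OF \<phi>(1)]]) (use \<phi> T(2) in auto)
      then show ?thesis using \<phi> by blast
    qed
    then have "bij_betw T r1.F r2.V" using inj T(1) by (auto simp: bij_betw_def)
    moreover have "T (rep_act ?\<sigma> g \<phi>) = rep_act ?\<tau> g (T \<phi>)" if g: "g \<in> carrier ?G" and \<phi>: "\<phi> \<in> r1.F" for g \<phi>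
    proof (rule r2.separation)
      let ?\<phi> = "pullback \<pi>1 (inv\<^bsub>?G\<^esub> g) \<phi>"
      have g\<phi>: "?\<phi> \<in> r1.F" by (rule r1.pullback_closed[OF GL_inv(1)[OF g] \<phi>])
      show "T (rep_act ?\<sigma> g \<phi>) \<in> r2.V" by (simp add: act\<sigma>[OF g \<phi>] T r1.F_scale[OF g\<phi>])
      show "rep_act ?\<tau> g (T \<phi>) \<in> r2.V" by (simp add: act\<tau> r2.V_scale r2.act_closed g T \<phi>)
      fix \<psi> assume \<psi>: "\<psi> \<in> r2.F"
      have "\<psi> (r2.act g (T \<phi>)) = pullback \<pi>2 g \<psi> (T \<phi>)" using T(1)[OF \<phi>] by simp
      also have "\<dots> = B (pullback \<pi>1 g ?\<phi>, pullback \<pi>2 g \<psi>)"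
        by (simp add: T(2) \<phi> \<psi> g r2.pullback_closed r1.pullback_inv(1))
      also have "\<dots> = ?\<chi> g * B (?\<phi>, \<psi>)" using B g g\<phi> \<psi> by (simp add: invariant_forms_def)
      finally have e: "\<psi> (r2.act g (T \<phi>)) = ?\<chi> g * \<psi> (T ?\<phi>)" using T(2)[OF g\<phi> \<psi>] by simp
      show "\<psi> (T (rep_act ?\<sigma> g \<phi>)) = \<psi> (rep_act ?\<tau> g (T \<phi>))"
        using lin_on_scale[OF lin g\<phi>] lin_on_scale[OF r2.F_lin[OF \<psi>] T(1)[OF g\<phi>]]
          lin_on_scale[OF r2.F_lin[OF \<psi>] r2.act_closed[OF g T(1)[OF \<phi>]]] e \<chi>2(2)[OF dn[OF g]]
        by (simp add: act\<sigma>[OF g \<phi>] act\<tau>)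
    qed
    ultimately show ?iso unfolding iso_rep_def sp using lin by blast
  qed
qed

text \<open>The forms are pure tensors of eigenvectors dual to bases of eigenfunctionals. A pair of
  such functionals serves both as index and as point of evaluation, hence the expression
  \<open>b i j\<close>.\<close>

lemma (in representation_pair) eigenforms_dual_basis:
  assumes "character_average G \<pi>1 K \<rho> \<chi>" and "character_average H \<pi>2 L \<tau> \<xi>"
  obtains J b where "finite J" "card J = fs.dim (character_average.eigfuns \<pi>1 K \<rho> \<chi>) * fs.dim (character_average.eigfuns \<pi>2 L \<tau> \<xi>)"
    "\<And>j. j \<in> J \<Longrightarrow> bilinear_form \<pi>1 \<pi>2 (b j)"
    "\<And>j k l. j \<in> J \<Longrightarrow> k \<in> carrier K \<Longrightarrow> l \<in> carrier L \<Longrightarrow>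
       form_act (\<rho> k) (\<tau> l) (b j) = fun_scale (\<chi> k * \<xi> l) (b j)"
    "\<And>i j. i \<in> J \<Longrightarrow> j \<in> J \<Longrightarrow> b i j = (if i = j then 1 else 0)"
    "\<And>B. bilinear_form \<pi>1 \<pi>2 B \<Longrightarrow>
       (\<And>k l. k \<in> carrier K \<Longrightarrow> l \<in> carrier L \<Longrightarrow> form_act (\<rho> k) (\<tau> l) B = fun_scale (\<chi> k * \<xi> l) B) \<Longrightarrow>
       (\<And>j. j \<in> J \<Longrightarrow> B j = 0) \<Longrightarrow> B = (\<lambda>_. 0)"
proof -
  interpret c1: character_average G \<pi>1 K \<rho> \<chi> by (rule assms)
  interpret c2: character_average H \<pi>2 L \<tau> \<xi> by (rule assms)
  obtain I1 a1 where 1: "finite I1" "I1 \<subseteq> c1.eigfuns" "card I1 = fs.dim c1.eigfuns" "\<And>\<alpha>. \<alpha> \<in> I1 \<Longrightarrow> a1 \<alpha> \<in> c1.eigvecs"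
    "\<And>\<alpha> \<beta>. \<alpha> \<in> I1 \<Longrightarrow> \<beta> \<in> I1 \<Longrightarrow> \<beta> (a1 \<alpha>) = (if \<alpha> = \<beta> then 1 else 0)"
    "\<And>v. v \<in> c1.eigvecs \<Longrightarrow> (\<And>\<alpha>. \<alpha> \<in> I1 \<Longrightarrow> \<alpha> v = 0) \<Longrightarrow> v = 0"
    by (rule c1.eigvecs_dual_basis) blast
  obtain I2 a2 where 2: "finite I2" "I2 \<subseteq> c2.eigfuns" "card I2 = fs.dim c2.eigfuns" "\<And>\<alpha>. \<alpha> \<in> I2 \<Longrightarrow> a2 \<alpha> \<in> c2.eigvecs"
    "\<And>\<alpha> \<beta>. \<alpha> \<in> I2 \<Longrightarrow> \<beta> \<in> I2 \<Longrightarrow> \<beta> (a2 \<alpha>) = (if \<alpha> = \<beta> then 1 else 0)"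
    "\<And>v. v \<in> c2.eigvecs \<Longrightarrow> (\<And>\<alpha>. \<alpha> \<in> I2 \<Longrightarrow> \<alpha> v = 0) \<Longrightarrow> v = 0"
    by (rule c2.eigvecs_dual_basis) blast
  have IF: "I1 \<subseteq> r1.F" "I2 \<subseteq> r2.F" using 1(2) 2(2) by (auto simp: c1.eigfuns_def c2.eigfuns_def)
  have aV: "a1 \<alpha> \<in> r1.V" "a2 \<beta> \<in> r2.V" if "\<alpha> \<in> I1" "\<beta> \<in> I2" for \<alpha> \<beta>
    using 1(4)[OF that(1)] 2(4)[OF that(2)] by (auto simp: c1.eigvecs_def c2.eigvecs_def)
  let ?b = "\<lambda>(\<alpha>, \<beta>). pure_tensor \<pi>1 \<pi>2 (a1 \<alpha>) (a2 \<beta>)"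
  show ?thesis
  proof (rule that[of "I1 \<times> I2" ?b])
    show "finite (I1 \<times> I2)" using 1 2 by simp
    show "card (I1 \<times> I2) = fs.dim c1.eigfuns * fs.dim c2.eigfuns" using 1 2 by simp
    show "bilinear_form \<pi>1 \<pi>2 (?b j)" if "j \<in> I1 \<times> I2" for j
      using that pure_tensor_bilinear aV by auto
    show "form_act (\<rho> k) (\<tau> l) (?b j) = fun_scale (\<chi> k * \<xi> l) (?b j)"
      if j: "j \<in> I1 \<times> I2" and k: "k \<in> carrier K" and l: "l \<in> carrier L" for j k l
    proof
      fix p :: "('v \<Rightarrow> complex) \<times> ('w \<Rightarrow> complex)"
      obtain \<phi> \<psi> \<alpha> \<beta> where [simp]: "p = (\<phi>, \<psi>)" "j = (\<alpha>, \<beta>)" by (cases p, cases j)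
      have ab: "\<alpha> \<in> I1" "\<beta> \<in> I2" using j by auto
      have e: "r1.act (\<rho> k) (a1 \<alpha>) = r1.sc (\<chi> k) (a1 \<alpha>)" "r2.act (\<tau> l) (a2 \<beta>) = r2.sc (\<xi> l) (a2 \<beta>)"
        using 1(4)[OF ab(1)] 2(4)[OF ab(2)] k l by (auto simp: c1.eigvecs_def c2.eigvecs_def)
      show "form_act (\<rho> k) (\<tau> l) (?b j) p = fun_scale (\<chi> k * \<xi> l) (?b j) p"
      proof (cases "\<phi> \<in> r1.F \<and> \<psi> \<in> r2.F")
        case True
        then show ?thesis
          using aV[OF ab] lin_on_scale[OF r1.F_lin aV(1)[OF ab], of \<phi> "\<chi> k"] lin_on_scale[OF r2.F_lin aV(2)[OF ab], of \<psi> "\<xi> l"]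
            r1.pullback_closed[OF c1.\<rho>_closed[OF k]] r2.pullback_closed[OF c2.\<rho>_closed[OF l]]
          by (simp add: form_act_def pure_tensor_def e)
      qed (auto simp: form_act_def pure_tensor_def)
    qed
    show "?b i j = (if i = j then 1 else 0)" if "i \<in> I1 \<times> I2" "j \<in> I1 \<times> I2" for i j
    proof -
      obtain \<alpha> \<beta> \<gamma> \<delta> where [simp]: "i = (\<alpha>, \<beta>)" "j = (\<gamma>, \<delta>)" by (cases i, cases j)
      have "\<alpha> \<in> I1" "\<beta> \<in> I2" "\<gamma> \<in> I1" "\<delta> \<in> I2" using that by auto
      then show ?thesis using 1(5)[of \<alpha> \<gamma>] 2(5)[of \<beta> \<delta>] IF by (auto simp: pure_tensor_def)
    qed
    fix B assume bil: "bilinear_form \<pi>1 \<pi>2 B"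
      and inv: "\<And>k l. k \<in> carrier K \<Longrightarrow> l \<in> carrier L \<Longrightarrow> form_act (\<rho> k) (\<tau> l) B = fun_scale (\<chi> k * \<xi> l) B"
      and 0: "\<And>j. j \<in> I1 \<times> I2 \<Longrightarrow> B j = 0"
    interpret g1: group K by (rule c1.group_K)
    interpret g2: group L by (rule c2.group_K)
    \<comment> \<open>Setting one group element to the identity separates the joint equivariance
      into one condition per argument.\<close>
    have one1: "\<rho> \<one>\<^bsub>K\<^esub> = \<one>\<^bsub>G\<^esub>" "\<tau> \<one>\<^bsub>L\<^esub> = \<one>\<^bsub>H\<^esub>"
      using hom_one[OF c1.\<rho> c1.group_K r1.group_G] hom_one[OF c2.\<rho> c2.group_K r2.group_G] by auto
    have one2: "\<chi> \<one>\<^bsub>K\<^esub> = 1" "\<xi> \<one>\<^bsub>L\<^esub> = 1"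
      using c1.\<chi>_mult[of "\<one>\<^bsub>K\<^esub>" "\<one>\<^bsub>K\<^esub>"] c1.\<chi>_nonzero[of "\<one>\<^bsub>K\<^esub>"]
        c2.\<chi>_mult[of "\<one>\<^bsub>L\<^esub>" "\<one>\<^bsub>L\<^esub>"] c2.\<chi>_nonzero[of "\<one>\<^bsub>L\<^esub>"] by auto
    have inv1: "B (pullback \<pi>1 (\<rho> k) \<phi>, \<psi>) = \<chi> k * B (\<phi>, \<psi>)"
      if "k \<in> carrier K" "\<phi> \<in> r1.F" "\<psi> \<in> r2.F" for k \<phi> \<psi>
      using fun_cong[OF inv[OF that(1) g2.one_closed], of "(\<phi>, \<psi>)"] that
      by (simp add: form_act_def one1 one2 r2.pullback_one)
    have inv2: "B (\<phi>, pullback \<pi>2 (\<tau> l) \<psi>) = \<xi> l * B (\<phi>, \<psi>)"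
      if "l \<in> carrier L" "\<phi> \<in> r1.F" "\<psi> \<in> r2.F" for l \<phi> \<psi>
      using fun_cong[OF inv[OF g1.one_closed that(1)], of "(\<phi>, \<psi>)"] that
      by (simp add: form_act_def one1 one2 r1.pullback_one)
    \<comment> \<open>The slice at \<open>\<beta>\<close> is an eigenvector on which all of
      \<open>I1\<close> vanishes. The same argument in the second variable then removes the
      restriction of \<open>\<beta>\<close> to \<open>I2\<close>.\<close>
    have step: "B (\<phi>, \<beta>) = 0" if \<phi>: "\<phi> \<in> r1.F" and \<beta>: "\<beta> \<in> I2" for \<phi> \<beta>
    proof -
      have \<beta>F: "\<beta> \<in> r2.F" using IF \<beta> by blast
      obtain v where v: "v \<in> r1.V" "\<forall>\<phi>\<in>r1.F. B (\<phi>, \<beta>) = \<phi> v" using form_vector_fst[OF bil \<beta>F] by auto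
      have "v \<in> c1.eigvecs"
        unfolding c1.eigvecs_def
      proof (intro CollectI conjI ballI v(1))
        fix k assume k: "k \<in> carrier K"
        show "r1.act (\<rho> k) v = r1.sc (\<chi> k) v"
        proof (rule r1.separation)
          fix \<phi> assume \<phi>: "\<phi> \<in> r1.F"
          show "\<phi> (r1.act (\<rho> k) v) = \<phi> (r1.sc (\<chi> k) v)"
            using inv1[OF k \<phi> \<beta>F] v \<phi> r1.pullback_closed[OF c1.\<rho>_closed[OF k] \<phi>] lin_on_scale[OF r1.F_lin[OF \<phi>] v(1)]
            by simp
        qed (auto intro: r1.act_closed c1.\<rho>_closed k v r1.V_scale)
      qed
      moreover have "\<alpha> v = 0" if "\<alpha> \<in> I1" for \<alpha> using 0[of "(\<alpha>, \<beta>)"] that \<beta> v(2) IF by auto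
      ultimately have "v = 0" by (rule 1(6))
      then show ?thesis using v \<phi> lin_on_subspace.map_0[OF r1.F_lin_on[OF \<phi>]] by simp
    qed
    have "B (\<phi>, \<psi>) = 0" if \<phi>: "\<phi> \<in> r1.F" and \<psi>: "\<psi> \<in> r2.F" for \<phi> \<psi>
    proof -
      obtain w where w: "w \<in> r2.V" "\<forall>\<psi>\<in>r2.F. B (\<phi>, \<psi>) = \<psi> w" using form_vector_snd[OF bil \<phi>] by auto
      have "w \<in> c2.eigvecs"
        unfolding c2.eigvecs_def
      proof (intro CollectI conjI ballI w(1))
        fix l assume l: "l \<in> carrier L"
        show "r2.act (\<tau> l) w = r2.sc (\<xi> l) w"
        proof (rule r2.separation)
          fix \<psi> assume \<psi>: "\<psi> \<in> r2.F"
          show "\<psi> (r2.act (\<tau> l) w) = \<psi> (r2.sc (\<xi> l) w)"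
            using inv2[OF l \<phi> \<psi>] w \<psi> r2.pullback_closed[OF c2.\<rho>_closed[OF l] \<psi>] lin_on_scale[OF r2.F_lin[OF \<psi>] w(1)]
            by simp
        qed (auto intro: r2.act_closed c2.\<rho>_closed l w r2.V_scale)
      qed
      moreover have "\<beta> w = 0" if "\<beta> \<in> I2" for \<beta> using step[OF \<phi> that] that w(2) IF by auto
      ultimately have "w = 0" by (rule 2(6))
      then show ?thesis using w \<psi> lin_on_subspace.map_0[OF r2.F_lin_on[OF \<psi>]] by simp
    qed
    moreover have "B (\<phi>, \<psi>) = 0" if "\<not> (\<phi> \<in> r1.F \<and> \<psi> \<in> r2.F)" for \<phi> \<psi>
      using bil that by (simp add: bilinear_form_def)
    ultimately show "B = (\<lambda>_. 0)" by (simp only: fun_eq_iff split_paired_All) metis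
  qed
qed

section \<open>Block eigenvectors of cuspidal representations\<close>

text \<open>Modulo a maximal additive subgroup avoiding \<open>1\<close>, the field is cyclic of prime order, generated by \<open>1\<close>.\<close>

lemma exists_additive_character:
  "\<exists>\<theta> :: 'f::{field,finite} \<Rightarrow> complex. \<theta> 0 = 1 \<and> (\<forall>x y. \<theta> (x + y) = \<theta> x * \<theta> y) \<and> (\<exists>x. \<theta> x \<noteq> 1)"
proof -
  let ?p = "CHAR('f)"
  have p: "prime ?p" by (intro prime_CHAR_semidom finite_imp_CHAR_pos) simp
  define sg where "sg M \<longleftrightarrow> (0 :: 'f) \<in> M \<and> (\<forall>x\<in>M. \<forall>y\<in>M. x - y \<in> M)" for M :: "'f set"
  have sg_neg: "- x \<in> M" if "sg M" "x \<in> M" for M x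
    using that unfolding sg_def by (metis diff_0)
  have sg_add: "x + y \<in> M" if "sg M" "x \<in> M" "y \<in> M" for M x y
    using that sg_neg[OF that(1,3)] unfolding sg_def by (metis diff_minus_eq_add)
  have sg_nat: "of_nat k * x \<in> M" if "sg M" "x \<in> M" for M x k
    by (induction k) (use that sg_add in \<open>auto simp: sg_def algebra_simps\<close>)
  have "finite {M. sg M \<and> 1 \<notin> M}" by simp
  moreover have "{0} \<in> {M. sg M \<and> 1 \<notin> M}" by (auto simp: sg_def)
  ultimately obtain M where M: "sg M" "1 \<notin> M" and max: "\<And>N. sg N \<Longrightarrow> 1 \<notin> N \<Longrightarrow> M \<subseteq> N \<Longrightarrow> M = N"
    using finite_has_maximal[of "{M. sg M \<and> 1 \<notin> M}"] by blast
  \<comment> \<open>The multiples of 1 form the prime field, in which nonzero elements can be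
    inverted.\<close>
  have modinv: "\<exists>i. of_nat i * of_nat j = (1 :: 'f)" if "(of_nat j :: 'f) \<noteq> 0" for j
  proof -
    have "\<not> ?p dvd j" using that by (simp add: of_nat_eq_0_iff_char_dvd)
    then have "coprime j ?p" using p by (metis coprime_commute prime_imp_coprime)
    then obtain i where "[j * i = 1] (mod ?p)" using cong_solve_coprime_nat[of j ?p] by auto
    then have "(of_nat (j * i) :: 'f) = of_nat 1" by (simp only: of_nat_eq_iff_cong_CHAR)
    then show ?thesis by (auto simp: mult.commute)
  qed
  \<comment> \<open>If \<open>x\<close> is not in \<open>M\<close>, the larger subgroup generated by
    \<open>M\<close> and \<open>x\<close> contains 1 by maximality; inverting the coefficient of
    \<open>x\<close> expresses \<open>x\<close> modulo \<open>M\<close> as a multiple of 1.\<close>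
  have cover: "\<exists>k. x - of_nat k \<in> M" for x
  proof (cases "x \<in> M")
    case True
    then show ?thesis by (intro exI[of _ 0]) simp
  next
    case False
    define N where "N = {m + of_nat j * x |m j. m \<in> M}"
    have N_I: "m + of_nat j * x \<in> N" if "m \<in> M" for m j using that unfolding N_def by blast
    have "sg N"
      unfolding sg_def
    proof (intro conjI ballI)
      show "0 \<in> N" using N_I[of 0 0] M(1) by (simp add: sg_def)
      fix u v assume "u \<in> N" "v \<in> N"
      then obtain m j m' j' where uv: "u = m + of_nat j * x" "v = m' + of_nat j' * x" "m \<in> M" "m' \<in> M"
        by (auto simp: N_def)
      \<comment> \<open>\<open>N\<close> is built from natural multiples of \<open>x\<close>, so the
        negative of \<open>j'\<close> has to be represented by \<open>(?p - 1) * j'\<close>.\<close>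
      have c: "of_nat ((?p - 1) * j') = - (of_nat j' :: 'f)"
        using p prime_ge_1_nat[OF p] by (simp add: of_nat_diff)
      have "u - v = (m - m') + of_nat (j + (?p - 1) * j') * x"
        unfolding of_nat_add c uv by (simp add: algebra_simps)
      moreover have "m - m' \<in> M" using uv M(1) by (simp add: sg_def)
      ultimately show "u - v \<in> N" using N_I by metis
    qed
    moreover have "M \<subseteq> N" using N_I[of _ 0] by auto
    moreover have "x \<in> N" using N_I[of 0 1] M(1) by (simp add: sg_def)
    ultimately have "1 \<in> N" using max[of N] False by auto
    then obtain m j where mj: "1 = m + of_nat j * x" "m \<in> M" by (auto simp: N_def)
    have "(of_nat j :: 'f) \<noteq> 0" using mj M(2) by auto
    then obtain i where i: "of_nat i * of_nat j = (1 :: 'f)" using modinv by blast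
    have "x = of_nat i * (of_nat j * x)" using i by (simp add: mult.assoc[symmetric])
    also have "of_nat j * x = 1 - m" using mj by (simp add: algebra_simps)
    finally have "x - of_nat i = - (of_nat i * m)" by (simp add: algebra_simps)
    then show ?thesis using sg_neg[OF M(1) sg_nat[OF M(1) mj(2)]] by metis
  qed
  then obtain \<kappa> where \<kappa>: "\<And>x. x - of_nat (\<kappa> x) \<in> M" by metis
  \<comment> \<open>A nonzero difference of two such multiples of 1 would lie in \<open>M\<close>,
    and so would 1.\<close>
  have uniq: "[k = l] (mod ?p)" if "x - of_nat k \<in> M" "x - of_nat l \<in> M" for x k l
  proof -
    have wlog: "[k = l] (mod ?p)" if kl: "k \<le> l" "x - of_nat k \<in> M" "x - of_nat l \<in> M" for k l
    proof (rule ccontr)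
      assume n: "\<not> [k = l] (mod ?p)"
      have d: "(of_nat (l - k) :: 'f) = (x - of_nat k) - (x - of_nat l)" using kl by (simp add: of_nat_diff)
      then have in_M: "(of_nat (l - k) :: 'f) \<in> M" using kl M(1) unfolding sg_def by metis
      have "(of_nat (l - k) :: 'f) \<noteq> 0"
        using n kl(1) of_nat_eq_iff_cong_CHAR[of k l, where 'a = 'f] by (auto simp: of_nat_diff)
      then obtain i where "of_nat i * of_nat (l - k) = (1 :: 'f)" using modinv by blast
      then show False using sg_nat[OF M(1) in_M, of i] M(2) by simp
    qed
    show ?thesis using wlog[of k l] wlog[of l k] that by (cases "k \<le> l") (auto simp: cong_sym_eq)
  qed
  define \<theta> where "\<theta> x = cis (2 * pi * real (\<kappa> x) / real ?p)" for x
  have p0: "real ?p > 0" using prime_gt_0_nat[OF p] by simp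
  have \<theta>: "\<theta> x = cis (2 * pi * real k / real ?p)" if "x - of_nat k \<in> M" for x k
  proof -
    have c: "cis (2 * pi * real (l mod ?p) / real ?p) = cis (2 * pi * real l / real ?p)" for l
    proof -
      have "real l = real ?p * real (l div ?p) + real (l mod ?p)"
        by (metis mult_div_mod_eq of_nat_add of_nat_mult)
      then have "2 * pi * real l / real ?p = 2 * pi * real (l div ?p) + 2 * pi * real (l mod ?p) / real ?p"
        using p0 by (simp add: field_simps)
      moreover have "cis (2 * pi * real (l div ?p)) = 1" by (rule cis_multiple_2pi) simp
      ultimately show ?thesis by (simp add: cis_mult[symmetric])
    qed
    have "\<kappa> x mod ?p = k mod ?p" using uniq[OF \<kappa> that] by (simp add: cong_def)
    then show ?thesis using c[of "\<kappa> x"] c[of k] by (simp add: \<theta>_def)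
  qed
  have "\<theta> (x + y) = \<theta> x * \<theta> y" for x y
  proof -
    have "(x - of_nat (\<kappa> x)) + (y - of_nat (\<kappa> y)) \<in> M" by (rule sg_add[OF M(1) \<kappa> \<kappa>])
    then have "x + y - of_nat (\<kappa> x + \<kappa> y) \<in> M" by (simp add: algebra_simps)
    from \<theta>[OF this] show ?thesis by (simp add: \<theta>_def cis_mult add_divide_distrib distrib_left)
  qed
  moreover have "\<theta> 0 = 1" using \<theta>[of 0 0] M(1) by (simp add: sg_def)
  moreover have "\<theta> 1 \<noteq> 1"
  proof
    have "\<theta> 1 = cis (2 * pi / real ?p)" using \<theta>[of 1 1] M(1) by (simp add: sg_def)
    also assume "\<theta> 1 = 1"
    finally have "cos (2 * pi / real ?p) = 1" by (simp add: complex_eq_iff)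
    then obtain n where n: "2 * pi / real ?p = real_of_int n * 2 * pi" using cos_one_2pi_int by auto
    then have "1 = real_of_int n * real ?p" using p0 by (simp add: field_simps)
    then have "1 = n * int ?p" by (metis of_int_1 of_int_eq_iff of_int_mult of_int_of_nat_eq)
    then have "int ?p dvd 1" by (metis dvd_triv_right)
    then show False using prime_gt_1_nat[OF p] by simp
  qed
  ultimately show ?thesis by blast
qed


text \<open>This is the trace of the product of \<open>\<psi>\<close> and \<open>X\<close>; followed
  by an additive character of the field it gives characters of the additive group of
  matrices.\<close>

definition pairing :: "nat \<Rightarrow> nat \<Rightarrow> 'a::comm_ring_1 mat \<Rightarrow> 'a mat \<Rightarrow> 'a" where
  "pairing a b \<psi> X = (\<Sum>i<a. \<Sum>j<b. \<psi> $$ (j, i) * X $$ (i, j))"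

lemma pairing_add:
  assumes "X \<in> carrier_mat a b" "Y \<in> carrier_mat a b"
  shows "pairing a b \<psi> (X + Y) = pairing a b \<psi> X + pairing a b \<psi> Y"
  using assms by (simp add: pairing_def sum.distrib[symmetric] algebra_simps)

lemma pairing_add_left:
  assumes "\<psi> \<in> carrier_mat b a" "\<psi>' \<in> carrier_mat b a"
  shows "pairing a b (\<psi> + \<psi>') X = pairing a b \<psi> X + pairing a b \<psi>' X"
  using assms by (simp add: pairing_def sum.distrib[symmetric] algebra_simps)

lemma pairing_mult:
  assumes "\<psi> \<in> carrier_mat b a" "g \<in> carrier_mat a a" "X \<in> carrier_mat a b"
  shows "pairing a b (\<psi> * g) X = pairing a b \<psi> (g * X)"
proof -
  have "pairing a b (\<psi> * g) X = (\<Sum>i<a. \<Sum>j<b. \<Sum>k<a. \<psi> $$ (j, k) * g $$ (k, i) * X $$ (i, j))"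
    using assms by (simp add: pairing_def scalar_prod_def sum_distrib_right lessThan_atLeast0)
  also have "\<dots> = (\<Sum>k<a. \<Sum>j<b. \<Sum>i<a. \<psi> $$ (j, k) * g $$ (k, i) * X $$ (i, j))"
    by (subst sum.swap, subst (2) sum.swap, subst sum.swap, rule refl)
  also have "\<dots> = pairing a b \<psi> (g * X)"
    using assms by (simp add: pairing_def scalar_prod_def sum_distrib_left lessThan_atLeast0 mult.assoc)
  finally show ?thesis .
qed

text \<open>Translating the summation variable by a suitable \<open>E\<close> multiplies the sum by
  \<open>\<theta> z\<close>, which is not 1.\<close>

lemma character_sum_zero:
  fixes \<theta> :: "'f::{field,finite} \<Rightarrow> complex"
  assumes \<theta>: "\<And>x y. \<theta> (x + y) = \<theta> x * \<theta> y" "\<theta> z \<noteq> 1" and X: "X \<in> carrier_mat a b" "X \<noteq> 0\<^sub>m a b"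
  shows "(\<Sum>\<psi>\<in>carrier_mat b a. \<theta> (- pairing a b \<psi> X)) = 0"
proof -
  obtain i j where ij: "i < a" "j < b" "X $$ (i, j) \<noteq> 0"
    using X by (metis carrier_matD eq_matI index_zero_mat)
  \<comment> \<open>A multiple of an elementary matrix, placed against a nonzero entry of
    \<open>X\<close> so that the pairing equals \<open>- z\<close>.\<close>
  define E where "E = mat b a (\<lambda>(j', i'). if j' = j \<and> i' = i then - z / X $$ (i, j) else 0)"
  have E: "E \<in> carrier_mat b a" by (simp add: E_def)
  have "pairing a b E X = (\<Sum>i'<a. \<Sum>j'<b. if i' = i \<and> j' = j then - z else 0)"
    unfolding pairing_def using ij by (intro sum.cong) (auto simp: E_def)
  also have "\<dots> = (\<Sum>i'<a. if i' = i then - z else 0)"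
    using ij by (intro sum.cong) (auto simp: if_distrib if_bool_eq_conj)
  also have "\<dots> = - z" using ij by simp
  finally have pE: "pairing a b E X = - z" .
  let ?S = "\<Sum>\<psi>\<in>carrier_mat b a. \<theta> (- pairing a b \<psi> X)"
  have cancel: "\<psi> - E + E = \<psi>" "\<psi> + E - E = \<psi>" if "\<psi> \<in> carrier_mat b a" for \<psi>
    using that E by (auto intro!: eq_matI)
  have "?S = (\<Sum>\<psi>\<in>carrier_mat b a. \<theta> (- pairing a b (\<psi> + E) X))"
    by (rule sum.reindex_bij_witness[where i = "\<lambda>\<psi>. \<psi> + E" and j = "\<lambda>\<psi>. \<psi> - E"])
      (use E in \<open>auto simp: cancel\<close>)
  also have "\<dots> = (\<Sum>\<psi>\<in>carrier_mat b a. \<theta> z * \<theta> (- pairing a b \<psi> X))"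
    by (rule sum.cong) (use E in \<open>auto simp: pairing_add_left pE \<theta>(1)[symmetric]\<close>)
  also have "\<dots> = \<theta> z * ?S" by (simp add: sum_distrib_left)
  finally show ?thesis using \<theta>(2) by (metis mult_cancel_right1 mult.commute)
qed

text \<open>As \<open>b < a\<close>, the map \<open>\<psi>\<close> has a kernel; \<open>g\<close>
  places a kernel vector in its first column.\<close>

lemma exists_GL_first_column_zero:
  fixes \<psi> :: "'a::field mat"
  assumes \<psi>: "\<psi> \<in> carrier_mat b a" and ba: "b < a"
  shows "\<exists>g\<in>carrier (GL a). \<forall>j<b. (\<psi> * g) $$ (j, 0) = 0"
proof -
  obtain P Q r where PQ: "P \<in> carrier (GL b)" "Q \<in> carrier (GL a)" and r: "r \<le> min b a"
    and eq: "P * \<psi> * Q = rank_mat b a r" using rank_normal_form[OF \<psi>] by blast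
  obtain P' where P': "P' \<in> carrier (GL b)" "P' * P = 1\<^sub>m b" using GL_obtain_inv[OF PQ(1)] by blast
  note c = PQ[THEN GL_carrier_mat] GL_carrier_mat[OF P'(1)]
  \<comment> \<open>The rank form has a zero last column because its rank is at most
    \<open>b\<close>; this exchanges the last column with the first.\<close>
  let ?W = "swaprows_mat a 0 (a - 1) :: 'a mat"
  have W: "?W \<in> carrier (GL a)"
    using swaprows_mat_Unit[of 0 a "a - 1", where 'a = 'a and b = "()"] ba by (simp add: GL_def units_of_def)
  have "P' * (P * (\<psi> * Q)) = \<psi> * Q"
    by (rule mult_left_inverse_mat[of _ b a]) (use c \<psi> P' in auto)
  moreover have "P * (\<psi> * Q) = rank_mat b a r" using eq c \<psi> by simp
  ultimately have \<psi>Q: "\<psi> * Q = P' * rank_mat b a r" by simp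
  have "\<psi> * (Q * ?W) = \<psi> * Q * ?W" using \<psi> c by (intro assoc_mult_mat[symmetric]) auto
  also have "\<dots> = swapcols 0 (a - 1) (\<psi> * Q)"
    using swapcols_mat[of "\<psi> * Q" b a 0 "a - 1"] \<psi> c ba mult_carrier_mat[OF \<psi> c(2)] by simp
  finally have e: "\<psi> * (Q * ?W) = swapcols 0 (a - 1) (P' * rank_mat b a r)" by (simp add: \<psi>Q)
  have "(\<psi> * (Q * ?W)) $$ (j, 0) = 0" if j: "j < b" for j
  proof -
    have "(\<psi> * (Q * ?W)) $$ (j, 0) = (P' * rank_mat b a r) $$ (j, a - 1)"
      unfolding e using j ba c rank_mat_carrier[of b a r] by (simp add: carrier_matD[OF rank_mat_carrier])
    also have "\<dots> = (\<Sum>k<b. P' $$ (j, k) * rank_mat b a r $$ (k, a - 1))"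
      using j ba c by (simp add: scalar_prod_def lessThan_atLeast0 carrier_matD[OF rank_mat_carrier])
    also have "\<dots> = 0" using r ba by (intro sum.neutral) (auto simp: rank_mat_def)
    finally show ?thesis .
  qed
  then show ?thesis using GL_mult_closed[OF PQ(2) W] by blast
qed


context representation
begin

lemma act_lincomb_image:
  assumes "g \<in> carrier G" "\<And>i. i \<in> I \<Longrightarrow> f i \<in> V" "\<And>i. i \<in> I \<Longrightarrow> act g (f i) = sc c (h i)"
  shows "act g (\<Sum>i\<in>I. sc (w i) (f i)) = sc c (\<Sum>i\<in>I. sc (w i) (h i))"
  using lin_on_subspace.map_lincomb[OF act_lin_on[OF assms(1)] assms(2), where c = w] assms(3)
  by (simp add: vs.scale_sum_right mult.commute)

end

text \<open>Expand \<open>v\<close> into isotypic components for the abelian group of block unipotents. As \<open>b < a\<close>, each character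
  of this group is, after conjugation by \<open>GL\<^sub>a\<close>, trivial on the first row, so that the component is fixed by
  the unipotent radical of the \<open>(1, a + b - 1)\<close>-parabolic and vanishes by cuspidality.\<close>

lemma cuspidal_no_block_eigenvector_gt:
  fixes \<pi> :: "('f::{field,finite} mat, 'v::ab_group_add) rep"
  assumes rep: "is_rep (GL (a + b)) \<pi>" and cusp: "cuspidal (a + b) \<pi>" and ab: "b < a" "1 < a + b"
    and v: "v \<in> rep_space \<pi>"
    and eig: "\<And>x. x \<in> carrier (GL a) \<Longrightarrow>
      rep_act \<pi> (four_block_mat x (0\<^sub>m a b) (0\<^sub>m b a) (1\<^sub>m b)) v = rep_scale \<pi> (c x) v"
    and c1: "\<And>x. det x = 1 \<Longrightarrow> c x = 1"
  shows "v = 0"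
proof -
  let ?G = "GL (a + b) :: 'f mat monoid"
  interpret representation ?G \<pi> by (simp add: representation_def group_GL rep)
  obtain \<theta> :: "'f \<Rightarrow> complex" and z where \<theta>0: "\<theta> 0 = 1"
    and \<theta>: "\<And>x y. \<theta> (x + y) = \<theta> x * \<theta> y" "\<theta> z \<noteq> 1"
    using exists_additive_character by blast
  define N where "N X = four_block_mat (1\<^sub>m a) X (0\<^sub>m b a) (1\<^sub>m b)" for X :: "'f mat"
  define d where "d x = four_block_mat x (0\<^sub>m a b) (0\<^sub>m b a) (1\<^sub>m b)" for x :: "'f mat"
  \<comment> \<open>Up to the order of the group, the isotypic component of \<open>v\<close> for the
    character attached to \<open>\<psi>\<close>.\<close>
  define comp where "comp \<psi> = (\<Sum>X\<in>carrier_mat a b. sc (\<theta> (- pairing a b \<psi> X)) (act (N X) v))" for \<psi>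
  have N: "N X \<in> carrier ?G" if "X \<in> carrier_mat a b" for X
    unfolding N_def by (rule GL_four_block_upper(1)[OF GL_one GL_one that])
  have d: "d x \<in> carrier ?G" if "x \<in> carrier (GL a)" for x
    unfolding d_def by (rule GL_four_block_upper(1)[OF that GL_one zero_carrier_mat])
  have NV: "act (N X) v \<in> V" if "X \<in> carrier_mat a b" for X by (rule act_closed[OF N[OF that] v])
  have comp_V: "comp \<psi> \<in> V" for \<psi> unfolding comp_def by (intro V_sum V_scale NV)
  have dN: "d x * N X = N (x * X) * d x" if "x \<in> carrier (GL a)" "X \<in> carrier_mat a b" for x X
    unfolding d_def N_def
    by (subst (1 2) mult_four_block_mat[of _ a a _ b _ b _ _ a _ b]) (use that GL_carrier_mat[OF that(1)] in auto)
  have NN: "N X * N Y = N (X + Y)" if "X \<in> carrier_mat a b" "Y \<in> carrier_mat a b" for X Y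
    unfolding N_def
    by (subst mult_four_block_mat[of _ a a _ b _ b _ _ a _ b])
      (use that in \<open>auto simp: comm_add_mat[of X a b Y]\<close>)
  have N0: "N (0\<^sub>m a b) = \<one>\<^bsub>?G\<^esub>" by (simp add: N_def one_GL)
  \<comment> \<open>\<open>d g\<close> permutes the components according to its action on
    characters; the scalar arises because \<open>v\<close> itself is an eigenvector.\<close>
  have comp_d: "act (d g) (comp (\<psi> * g)) = sc (c g) (comp \<psi>)"
    if g: "g \<in> carrier (GL a)" and \<psi>: "\<psi> \<in> carrier_mat b a" for g \<psi>
  proof -
    note gc = GL_carrier_mat[OF g]
    obtain g' where g': "g' \<in> carrier (GL a)" "g * g' = 1\<^sub>m a" "g' * g = 1\<^sub>m a" using GL_obtain_inv[OF g] .
    note g'c = GL_carrier_mat[OF g'(1)]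
    have "act (d g) (comp (\<psi> * g)) = sc (c g) (\<Sum>X\<in>carrier_mat a b. sc (\<theta> (- pairing a b (\<psi> * g) X)) (act (N (g * X)) v))"
      unfolding comp_def
    proof (rule act_lincomb_image[OF d[OF g] NV])
      fix X :: "'f mat" assume X: "X \<in> carrier_mat a b"
      have gX: "g * X \<in> carrier_mat a b" using gc X by simp
      have "act (d g) (act (N X) v) = act (d g * N X) v"
        using act_mult[OF d[OF g] N[OF X] v] by (simp add: mult_GL)
      also have "\<dots> = act (N (g * X)) (act (d g) v)"
        using act_mult[OF N[OF gX] d[OF g] v] by (simp add: mult_GL dN[OF g X])
      also have "act (d g) v = sc (c g) v" unfolding d_def by (rule eig[OF g])
      also have "act (N (g * X)) (sc (c g) v) = sc (c g) (act (N (g * X)) v)"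
        by (rule lin_on_scale[OF act_lin[OF N[OF gX]] v])
      finally show "act (d g) (act (N X) v) = sc (c g) (act (N (g * X)) v)" .
    qed
    also have "(\<Sum>X\<in>carrier_mat a b. sc (\<theta> (- pairing a b (\<psi> * g) X)) (act (N (g * X)) v)) = comp \<psi>"
      unfolding comp_def
      by (rule sum.reindex_bij_witness[where i = "\<lambda>X. g' * X" and j = "\<lambda>X. g * X"])
        (use gc g'c g' \<psi> in \<open>auto simp: pairing_mult mult_left_inverse_mat[of _ a b]\<close>)
    finally show ?thesis .
  qed
  have comp_N: "act (N Y) (comp \<psi>) = comp \<psi>"
    if Y: "Y \<in> carrier_mat a b" and 0: "pairing a b \<psi> Y = 0" for Y \<psi>
  proof -
    have "act (N Y) (comp \<psi>) = sc 1 (\<Sum>X\<in>carrier_mat a b. sc (\<theta> (- pairing a b \<psi> X)) (act (N (Y + X)) v))"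
      unfolding comp_def
      by (rule act_lincomb_image[OF N[OF Y] NV])
        (use act_mult[OF N[OF Y] N v] in \<open>simp_all add: mult_GL NN[OF Y]\<close>)
    also have "\<dots> = (\<Sum>X\<in>carrier_mat a b. sc (\<theta> (- pairing a b \<psi> (Y + X))) (act (N (Y + X)) v))"
      by (simp add: pairing_add[OF Y] 0)
    also have "\<dots> = comp \<psi>"
    proof -
      have cancel: "Y + (X - Y) = X" "Y + X - Y = X" if "X \<in> carrier_mat a b" for X
        using that Y by (auto intro!: eq_matI)
      show ?thesis unfolding comp_def
        by (rule sum.reindex_bij_witness[where i = "\<lambda>X. X - Y" and j = "\<lambda>X. Y + X"]) (use Y cancel in auto)
    qed
    finally show ?thesis .
  qed
  \<comment> \<open>An element of the radical factors as \<open>N Y * d t\<close>. With the first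
    column of \<open>\<psi>\<close> zero, \<open>Y\<close> pairs trivially with
    \<open>\<psi>\<close>, and \<open>t\<close> fixes \<open>\<psi>\<close> and has determinant 1,
    so both factors fix the component.\<close>
  have special: "comp \<psi> = 0" if \<psi>: "\<psi> \<in> carrier_mat b a" and col: "\<And>j. j < b \<Longrightarrow> \<psi> $$ (j, 0) = 0" for \<psi>
  proof -
    have "act u (comp \<psi>) = comp \<psi>" if u: "u \<in> unipotent_radical (a + b) {1}" for u
    proof -
      have u1: "u \<in> carrier_mat (a + b) (a + b)" "\<And>i. i < a + b \<Longrightarrow> u $$ (i, i) = 1"
        and u0: "\<And>i j. i < a + b \<Longrightarrow> j < a + b \<Longrightarrow> i \<noteq> j \<Longrightarrow> i \<noteq> 0 \<Longrightarrow> u $$ (i, j) = 0"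
        using u by (auto simp: unipotent_radical_def)
      define t where "t = mat a a (\<lambda>(i, j). u $$ (i, j))"
      define Y where "Y = mat a b (\<lambda>(i, j). u $$ (i, j + a))"
      have tY: "t \<in> carrier_mat a a" "Y \<in> carrier_mat a b" by (simp_all add: t_def Y_def)
      have "u = four_block_mat t Y (0\<^sub>m b a) (1\<^sub>m b)"
        using u1 u0 ab(1) by (intro eq_matI) (auto simp: t_def Y_def eq_diff_iff not_less)
      also have "\<dots> = N Y * d t"
        unfolding N_def d_def
        by (subst mult_four_block_mat[of _ a a _ b _ b _ _ a _ b]) (use tY in auto)
      finally have u_eq: "u = N Y * d t" .
      have "det t = prod_list (diag_mat t)"
        using u0 by (intro det_upper_triangular[of _ a]) (auto simp: t_def)
      also have "diag_mat t = map (\<lambda>_. 1) [0..<a]" using u1(2) by (auto simp: diag_mat_def t_def)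
      also have "prod_list \<dots> = 1" by (induction a) auto
      finally have det_t: "det t = 1" .
      have t: "t \<in> carrier (GL a)" using tY det_t by (simp add: carrier_GL)
      have \<psi>t: "\<psi> * t = \<psi>"
      proof (rule eq_matI)
        fix j i assume "j < dim_row \<psi>" "i < dim_col \<psi>"
        then have ji: "j < b" "i < a" using \<psi> by auto
        have "(\<psi> * t) $$ (j, i) = (\<Sum>k<a. \<psi> $$ (j, k) * t $$ (k, i))"
          using ji \<psi> tY by (simp add: scalar_prod_def lessThan_atLeast0)
        also have "\<dots> = (\<Sum>k<a. if k = i then \<psi> $$ (j, i) else 0)"
        proof (rule sum.cong[OF refl])
          fix k assume "k \<in> {..<a}"
          then show "\<psi> $$ (j, k) * t $$ (k, i) = (if k = i then \<psi> $$ (j, i) else 0)"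
            using ji col u0[of k i] u1(2) by (cases "k = 0") (auto simp: t_def)
        qed
        finally show "(\<psi> * t) $$ (j, i) = \<psi> $$ (j, i)" using ji by simp
      qed (use \<psi> tY in auto)
      have "pairing a b \<psi> Y = 0"
        unfolding pairing_def
      proof (intro sum.neutral ballI)
        fix i j assume "i \<in> {..<a}" "j \<in> {..<b}"
        then show "\<psi> $$ (j, i) * Y $$ (i, j) = 0"
          using col u0[of i "j + a"] by (cases "i = 0") (auto simp: Y_def)
      qed
      then have 2: "act (N Y) (comp \<psi>) = comp \<psi>" by (rule comp_N[OF tY(2)])
      have "act (d t) (comp \<psi>) = comp \<psi>" using comp_d[OF t \<psi>] by (simp add: \<psi>t c1[OF det_t])
      then show ?thesis
        using act_mult[OF N[OF tY(2)] d[OF t] comp_V] 2 by (simp add: u_eq mult_GL)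
    qed
    then have "comp \<psi> \<in> {v \<in> V. \<forall>u\<in>unipotent_radical (a + b) {1}. act u v = v}" using comp_V by simp
    also have "\<dots> = {0}" using cusp ab(2) unfolding cuspidal_def by auto
    finally show ?thesis by simp
  qed
  have zero: "comp \<psi> = 0" if \<psi>: "\<psi> \<in> carrier_mat b a" for \<psi>
  proof -
    obtain g where g: "g \<in> carrier (GL a)" "\<forall>j<b. (\<psi> * g) $$ (j, 0) = 0"
      using exists_GL_first_column_zero[OF \<psi> ab(1)] by blast
    \<comment> \<open>\<open>c\<close> is an arbitrary function, but an invertible operator has no
      nonzero vector with eigenvalue 0.\<close>
    have nz: "v = 0 \<or> c g \<noteq> 0"
    proof (rule disjCI)
      assume "\<not> c g \<noteq> 0"
      then have "act (d g) v = 0" using eig[OF g(1)] by (simp add: d_def)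
      then show "v = 0"
        using act_inv(2)[OF d[OF g(1)] v] lin_on_subspace.map_0[OF act_lin_on[OF group.inv_closed[OF group_G d[OF g(1)]]]] by simp
    qed
    have "comp (\<psi> * g) = 0" using special[of "\<psi> * g"] g \<psi> GL_carrier_mat[OF g(1)] by auto
    then have "sc (c g) (comp \<psi>) = 0"
      using comp_d[OF g(1) \<psi>] lin_on_subspace.map_0[OF act_lin_on[OF d[OF g(1)]]] by simp
    moreover have "comp \<psi> = 0" if "v = 0"
      unfolding comp_def that using lin_on_subspace.map_0[OF act_lin_on[OF N]] by (intro sum.neutral ballI) simp
    ultimately show ?thesis using nz by auto
  qed
  \<comment> \<open>Fourier inversion: in the sum of all components orthogonality leaves only the
    term at \<open>X = 0\<close>, a nonzero multiple of \<open>v\<close>.\<close>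
  have "0 = (\<Sum>\<psi>\<in>carrier_mat b a. comp \<psi>)" using zero by simp
  also have "\<dots> = (\<Sum>X\<in>carrier_mat a b. sc (\<Sum>\<psi>\<in>carrier_mat b a. \<theta> (- pairing a b \<psi> X)) (act (N X) v))"
    unfolding comp_def by (subst sum.swap) (simp add: vs.scale_sum_left)
  also have "\<dots> = (\<Sum>X\<in>{0\<^sub>m a b}. sc (\<Sum>\<psi>\<in>carrier_mat b a. \<theta> (- pairing a b \<psi> X)) (act (N X) v))"
    using character_sum_zero[OF \<theta>] finite_carrier_mat[of a b, where 'a = 'f]
    by (intro sum.mono_neutral_right) auto
  also have "\<dots> = sc (\<Sum>\<psi>\<in>(carrier_mat b a :: 'f mat set). 1) v"
    by (simp add: N0 act_one[OF v] pairing_def \<theta>0)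
  finally have "sc (of_nat (card (carrier_mat b a :: 'f mat set))) v = 0" by simp
  moreover have "card (carrier_mat b a :: 'f mat set) \<noteq> 0"
    using finite_carrier_mat[of b a, where 'a = 'f] zero_carrier_mat[of b a] by (auto simp: card_eq_0_iff)
  ultimately show ?thesis by simp
qed

text \<open>The smaller block may be taken to be the second: for \<open>a < b\<close> the block swap
  carries \<open>v\<close> to an eigenvector with the blocks exchanged. Only the larger factor,
  acting through the determinant, is then used.\<close>

lemma cuspidal_no_block_eigenvector:
  fixes \<pi> :: "('f::{field,finite} mat, 'v::ab_group_add) rep"
  assumes rep: "is_rep (GL (a + b)) \<pi>" and cusp: "cuspidal (a + b) \<pi>" and ab: "a \<noteq> b" "1 < a + b"
    and v: "v \<in> rep_space \<pi>"
    and eig: "\<And>x y. x \<in> carrier (GL a) \<Longrightarrow> y \<in> carrier (GL b) \<Longrightarrow>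
      rep_act \<pi> (four_block_mat x (0\<^sub>m a b) (0\<^sub>m b a) y) v = rep_scale \<pi> (\<chi> (det x) * \<xi> (det y)) v"
    and one: "\<chi> 1 = 1" "\<xi> 1 = 1"
  shows "v = 0"
proof (cases "b < a")
  case True
  show ?thesis
    by (rule cuspidal_no_block_eigenvector_gt[OF rep cusp True ab(2) v, of "\<lambda>x. \<chi> (det x)"])
      (use eig[OF _ GL_one] in \<open>auto simp: one\<close>)
next
  case False
  then have ba: "a < b" "1 < b + a" using ab by auto
  interpret representation "GL (a + b)" \<pi> by (simp add: representation_def group_GL rep)
  let ?W = "block_swap a b :: 'f mat"
  have W: "?W \<in> carrier (GL (a + b))" by (rule block_swap_GL)
  have "act ?W v = 0"
  proof (rule cuspidal_no_block_eigenvector_gt[OF _ _ ba, of \<pi> _ "\<lambda>y. \<xi> (det y)"])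
    show "is_rep (GL (b + a)) \<pi>" "cuspidal (b + a) \<pi>" using rep cusp by (simp_all add: add.commute)
    show "act ?W v \<in> V" by (rule act_closed[OF W v])
    fix y :: "'f mat" assume y: "y \<in> carrier (GL b)"
    let ?d = "four_block_mat (1\<^sub>m a) (0\<^sub>m a b) (0\<^sub>m b a) y" and ?e = "four_block_mat y (0\<^sub>m b a) (0\<^sub>m a b) (1\<^sub>m a)"
    have d: "?d \<in> carrier (GL (a + b))" by (rule GL_four_block_upper(1)[OF GL_one y zero_carrier_mat])
    have e: "?e \<in> carrier (GL (a + b))"
      using GL_four_block_upper(1)[OF y GL_one zero_carrier_mat, of a] by (simp add: add.commute)
    have "act ?e (act ?W v) = act ?W (act ?d v)"
      using act_mult[OF e W v] act_mult[OF W d v] block_swap_conj[OF one_carrier_mat GL_carrier_mat[OF y], of a]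
      by (simp add: mult_GL)
    also have "act ?d v = sc (\<xi> (det y)) v" using eig[OF GL_one y] by (simp add: one)
    also have "act ?W (sc (\<xi> (det y)) v) = sc (\<xi> (det y)) (act ?W v)"
      by (rule lin_on_scale[OF act_lin[OF W] v])
    finally show "act ?e (act ?W v) = sc (\<xi> (det y)) (act ?W v)" .
  qed (simp add: one)
  then show ?thesis
    using act_inv(2)[OF W v] lin_on_subspace.map_0[OF act_lin_on[OF group.inv_closed[OF group_G W]]] by simp
qed

section \<open>Equivariant functions in the induced representation\<close>

locale induced_pair =
  fixes n :: nat and \<pi>1 :: "('f::{field,finite} mat, 'v::ab_group_add) rep"
    and \<pi>2 :: "('f mat, 'w::ab_group_add) rep" and \<chi>1 \<chi>2 :: "'f \<Rightarrow> complex"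
  assumes rep1: "is_rep (GL n) \<pi>1" and rep2: "is_rep (GL n) \<pi>2"
    and hom1: "\<chi>1 \<in> hom field_units field_units" and hom2: "\<chi>2 \<in> hom field_units field_units"
begin

sublocale same_group_pair "GL n" \<pi>1 \<pi>2
  by (simp add: same_group_pair_def representation_pair_def representation_def group_GL rep1 rep2)

abbreviation "bilin \<equiv> bilinear_form \<pi>1 \<pi>2"

definition char_pair :: "'f mat \<times> 'f mat \<Rightarrow> complex" where
  "char_pair = (\<lambda>(h1, h2). \<chi>1 (det h1) * \<chi>2 (det h2))"

definition ind_scale :: "complex \<Rightarrow> ('f mat \<Rightarrow> ('v \<Rightarrow> complex) \<times> ('w \<Rightarrow> complex) \<Rightarrow> complex) \<Rightarrow> _" where
  "ind_scale c f = (\<lambda>g. fun_scale c (f g))"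

definition equivariants :: "('f mat \<Rightarrow> ('v \<Rightarrow> complex) \<times> ('w \<Rightarrow> complex) \<Rightarrow> complex) set" where
  "equivariants = {f. (\<forall>g\<in>carrier (GL (2 * n)). bilin (f g)) \<and> (\<forall>g. g \<notin> carrier (GL (2 * n)) \<longrightarrow> f g = 0) \<and>
     (\<forall>A\<in>carrier (GL n). \<forall>D\<in>carrier (GL n). \<forall>X\<in>carrier_mat n n. \<forall>g\<in>carrier (GL (2 * n)).
        f (four_block_mat A X (0\<^sub>m n n) D * g) = form_act A D (f g)) \<and>
     (\<forall>h1\<in>carrier (GL n). \<forall>h2\<in>carrier (GL n). \<forall>g\<in>carrier (GL (2 * n)).
        f (g * block_diag n h1 h2) = fun_scale (char_pair (h1, h2)) (f g))}"

lemma vector_space_ind_scale: "vector_space ind_scale"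
  by standard (auto simp: ind_scale_def fun_eq_iff algebra_simps)

lemma rep_scale_ind_prod: "rep_scale (ind_prod n \<pi>1 \<pi>2) = ind_scale"
  by (auto simp: ind_prod_def para_ind_def tensor_rep_def ind_scale_def fun_eq_iff)

lemma char_vectors_ind_prod: "char_vectors n (ind_prod n \<pi>1 \<pi>2) \<chi>1 \<chi>2 = equivariants" (is "?L = _")
proof -
  have space: "rep_space (ind_prod n \<pi>1 \<pi>2) = {f. (\<forall>g\<in>carrier (GL (2 * n)). bilin (f g)) \<and>
      (\<forall>g. g \<notin> carrier (GL (2 * n)) \<longrightarrow> f g = 0) \<and>
     (\<forall>A\<in>carrier (GL n). \<forall>D\<in>carrier (GL n). \<forall>X\<in>carrier_mat n n. \<forall>g\<in>carrier (GL (2 * n)).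
        f (four_block_mat A X (0\<^sub>m n n) D * g) = form_act A D (f g))}"
    by (simp add: ind_prod_def para_ind_def tensor_space tensor_act)
  have eig: "rep_act (ind_prod n \<pi>1 \<pi>2) (block_diag n h1 h2) f
        = rep_scale (ind_prod n \<pi>1 \<pi>2) (\<chi>1 (det h1) * \<chi>2 (det h2)) f
      \<longleftrightarrow> (\<forall>g\<in>carrier (GL (2 * n)). f (g * block_diag n h1 h2) = fun_scale (char_pair (h1, h2)) (f g))"
    if f: "f \<in> rep_space (ind_prod n \<pi>1 \<pi>2)" for h1 h2 f
  proof -
    have act: "rep_act (ind_prod n \<pi>1 \<pi>2) h f = (\<lambda>g. if g \<in> carrier (GL (2 * n)) then f (g * h) else 0)" for h
      by (simp add: ind_prod_def para_ind_def)
    have out: "f g = 0" if "g \<notin> carrier (GL (2 * n))" for g using f that by (simp add: space)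
    show ?thesis
      unfolding act rep_scale_ind_prod ind_scale_def char_pair_def using out
      by (auto simp: fun_eq_iff)
  qed
  show ?thesis
  proof (rule Set.set_eqI)
    fix f
    have "f \<in> ?L \<longleftrightarrow> f \<in> rep_space (ind_prod n \<pi>1 \<pi>2) \<and> (\<forall>h1\<in>carrier (GL n). \<forall>h2\<in>carrier (GL n).
        \<forall>g\<in>carrier (GL (2 * n)). f (g * block_diag n h1 h2) = fun_scale (char_pair (h1, h2)) (f g))"
      unfolding char_vectors_def using eig by auto
    then show "f \<in> ?L \<longleftrightarrow> f \<in> equivariants" by (simp add: space equivariants_def)
  qed
qed

lemma equivariantsD:
  assumes "f \<in> equivariants"
  shows "\<And>g. g \<in> carrier (GL (2 * n)) \<Longrightarrow> bilin (f g)" "\<And>g. g \<notin> carrier (GL (2 * n)) \<Longrightarrow> f g = 0"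
    "\<And>A D X g. A \<in> carrier (GL n) \<Longrightarrow> D \<in> carrier (GL n) \<Longrightarrow> X \<in> carrier_mat n n \<Longrightarrow>
       g \<in> carrier (GL (2 * n)) \<Longrightarrow> f (four_block_mat A X (0\<^sub>m n n) D * g) = form_act A D (f g)"
    "\<And>h1 h2 g. h1 \<in> carrier (GL n) \<Longrightarrow> h2 \<in> carrier (GL n) \<Longrightarrow> g \<in> carrier (GL (2 * n)) \<Longrightarrow>
       f (g * block_diag n h1 h2) = fun_scale (char_pair (h1, h2)) (f g)"
  using assms by (simp_all add: equivariants_def)

lemma char_pair_mult:
  assumes "h1 \<in> carrier (GL n)" "h2 \<in> carrier (GL n)" "k1 \<in> carrier (GL n)" "k2 \<in> carrier (GL n)"
  shows "char_pair (h1 * k1, h2 * k2) = char_pair (h1, h2) * char_pair (k1, k2)"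
  using assms field_units_hom(1)[OF hom1] field_units_hom(1)[OF hom2]
  by (auto simp: char_pair_def carrier_GL det_mult)

lemma char_pair_nonzero: "h1 \<in> carrier (GL k) \<Longrightarrow> h2 \<in> carrier (GL k) \<Longrightarrow> char_pair (h1, h2) \<noteq> 0"
  using field_units_hom(2)[OF hom1] field_units_hom(2)[OF hom2] by (auto simp: char_pair_def carrier_GL)

lemma form_act_zero: "form_act A D 0 = 0" "form_act A D (\<lambda>_. 0) = 0"
  by (auto simp: form_act_def fun_eq_iff)

lemma form_act_scale: "form_act A D (fun_scale c B) = fun_scale c (form_act A D B)"
  by (auto simp: form_act_def fun_eq_iff)

lemma form_act_sum: "form_act A D (\<Sum>i\<in>I. B i) = (\<Sum>i\<in>I. form_act A D (B i))"
  by (rule ext) (auto simp: form_act_def sum_fun_apply)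

lemma form_act_mult:
  assumes "A \<in> carrier (GL n)" "D \<in> carrier (GL n)" "A' \<in> carrier (GL n)" "D' \<in> carrier (GL n)"
  shows "form_act (A * A') (D * D') B = form_act A D (form_act A' D' B)"
  by (rule ext) (use assms in \<open>auto simp: form_act_def r1.pullback_closed r2.pullback_closed
      r1.pullback_mult[unfolded mult_GL] r2.pullback_mult[unfolded mult_GL]\<close>)

text \<open>The value of \<open>f\<close> at the common product is computed once from the left and
  once from the right. Every constraint on the values at a representative arises in this
  way.\<close>

lemma equivariant_stabilizer:
  assumes f: "f \<in> equivariants" and r: "r \<in> carrier (GL (2 * n))"
    and "A \<in> carrier (GL n)" "D \<in> carrier (GL n)" "X \<in> carrier_mat n n" "h1 \<in> carrier (GL n)" "h2 \<in> carrier (GL n)"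
    and "four_block_mat A X (0\<^sub>m n n) D * r = r * block_diag n h1 h2"
  shows "form_act A D (f r) = fun_scale (char_pair (h1, h2)) (f r)"
  using equivariantsD(3)[OF f assms(3,4,5) r] equivariantsD(4)[OF f assms(6,7) r] assms(8) by simp


section \<open>Functions supported on one double coset\<close>

text \<open>The action of the diagonal blocks of \<open>y\<close>, extended by \<open>0\<close> to \<open>y\<close> outside the parabolic; with \<open>r'\<close> the inverse
  of \<open>r\<close>, the sum in \<open>coset_lift\<close> then runs over the \<open>h\<close> for which \<open>x h\<close> lies in \<open>P r\<close>.\<close>

definition parabolic_part where
  "parabolic_part B y = (if \<forall>i<n. \<forall>j<n. y $$ (i + n, j) = 0
     then form_act (mat n n (\<lambda>(i, j). y $$ (i, j))) (mat n n (\<lambda>(i, j). y $$ (i + n, j + n))) B else 0)"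

lemma parabolic_part_four_block:
  assumes "A \<in> carrier_mat n n" "X \<in> carrier_mat n n" "C \<in> carrier_mat n n" "D \<in> carrier_mat n n"
  shows "parabolic_part B (four_block_mat A X C D) = (if C = 0\<^sub>m n n then form_act A D B else 0)"
proof -
  have "mat n n (\<lambda>(i, j). four_block_mat A X C D $$ (i, j)) = A"
    "mat n n (\<lambda>(i, j). four_block_mat A X C D $$ (i + n, j + n)) = D"
    using assms by (auto intro!: eq_matI)
  moreover have "(\<forall>i<n. \<forall>j<n. four_block_mat A X C D $$ (i + n, j) = 0) \<longleftrightarrow> C = 0\<^sub>m n n"
    using assms by (auto intro!: eq_matI)
  ultimately show ?thesis by (simp only: parabolic_part_def)
qed

lemma GL_blocks:
  assumes "y \<in> carrier (GL (2 * n))"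
  obtains A X C D where "A \<in> carrier_mat n n" "X \<in> carrier_mat n n" "C \<in> carrier_mat n n" "D \<in> carrier_mat n n"
    "y = four_block_mat A X C D" "C = 0\<^sub>m n n \<longrightarrow> A \<in> carrier (GL n) \<and> D \<in> carrier (GL n)"
proof -
  have "y \<in> carrier_mat (n + n) (n + n)" using assms by (simp add: carrier_GL mult_2)
  then obtain A X C D where b: "A \<in> carrier_mat n n" "X \<in> carrier_mat n n" "C \<in> carrier_mat n n" "D \<in> carrier_mat n n"
    "y = four_block_mat A X C D" by (rule four_block_mat_cases)
  moreover have "A \<in> carrier (GL n) \<and> D \<in> carrier (GL n)" if "C = 0\<^sub>m n n"
    using det_four_block_mat_lower_left_zero[OF b(1,2) that b(4)] assms b by (simp add: carrier_GL)
  ultimately show ?thesis using that by blast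
qed

lemma parabolic_part_bilin:
  assumes "bilin B" "y \<in> carrier (GL (2 * n))"
  shows "bilin (parabolic_part B y)"
proof -
  obtain A X C D where b: "A \<in> carrier_mat n n" "X \<in> carrier_mat n n" "C \<in> carrier_mat n n" "D \<in> carrier_mat n n"
    "y = four_block_mat A X C D" "C = 0\<^sub>m n n \<longrightarrow> A \<in> carrier (GL n) \<and> D \<in> carrier (GL n)"
    using assms(2) by (rule GL_blocks)
  show ?thesis
    unfolding b(5) parabolic_part_four_block[OF b(1-4)]
    using b(6) form_act_bilinear[of A D, OF _ _ assms(1)] fs.subspace_0[OF bilinear_form_subspace[of \<pi>1 \<pi>2]] by simp
qed

text \<open>A factor from the parabolic on the left does not change whether \<open>y\<close> lies in
  the parabolic, since \<open>D\<close> is invertible; if \<open>y\<close> lies outside, both sides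
  are 0.\<close>

lemma parabolic_part_mult:
  assumes A: "A \<in> carrier (GL n)" and D: "D \<in> carrier (GL n)" and X: "X \<in> carrier_mat n n"
    and y: "y \<in> carrier (GL (2 * n))"
  shows "parabolic_part B (four_block_mat A X (0\<^sub>m n n) D * y) = form_act A D (parabolic_part B y)"
proof -
  obtain A' X' C' D' where b: "A' \<in> carrier_mat n n" "X' \<in> carrier_mat n n" "C' \<in> carrier_mat n n" "D' \<in> carrier_mat n n"
    "y = four_block_mat A' X' C' D'" "C' = 0\<^sub>m n n \<longrightarrow> A' \<in> carrier (GL n) \<and> D' \<in> carrier (GL n)"
    using y by (rule GL_blocks)
  note c = GL_carrier_mat[OF A] GL_carrier_mat[OF D] X
  have m: "four_block_mat A X (0\<^sub>m n n) D * y
      = four_block_mat (A * A' + X * C') (A * X' + X * D') (0\<^sub>m n n * A' + D * C') (0\<^sub>m n n * X' + D * D')"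
    unfolding b(5) by (rule mult_four_block_mat) (use c b in auto)
  have z: "0\<^sub>m n n * A' + D * C' = D * C'" "0\<^sub>m n n * X' + D * D' = D * D'"
    using b c by (simp_all add: left_add_zero_mat[of _ n n] mult_carrier_mat[of _ n n _ n])
  obtain D'' where D'': "D'' \<in> carrier (GL n)" "D'' * D = 1\<^sub>m n" using GL_obtain_inv[OF D] by blast
  have iff: "D * C' = 0\<^sub>m n n \<longleftrightarrow> C' = 0\<^sub>m n n"
    using mult_left_inverse_mat[OF b(3) c(2) GL_carrier_mat[OF D''(1)] D''(2)] c GL_carrier_mat[OF D''(1)] by auto
  have "parabolic_part B (four_block_mat A X (0\<^sub>m n n) D * y)
      = (if C' = 0\<^sub>m n n then form_act (A * A' + X * C') (D * D') B else 0)"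
    unfolding m z iff[symmetric] by (rule parabolic_part_four_block) (use b c in auto)
  also have "\<dots> = form_act A D (parabolic_part B y)"
  proof (cases "C' = 0\<^sub>m n n")
    case True
    then have "A * A' + X * C' = A * A'"
      using b c by (simp add: right_add_zero_mat[of _ n n] mult_carrier_mat[of _ n n _ n])
    then show ?thesis
      using form_act_mult[of A D A' D' B] A D b(6) True unfolding b(5) parabolic_part_four_block[OF b(1-4)] by simp
  next
    case False
    then show ?thesis unfolding b(5) parabolic_part_four_block[OF b(1-4)] by (simp add: form_act_zero)
  qed
  finally show ?thesis .
qed

definition coset_lift where
  "coset_lift r' B x = (if x \<in> carrier (GL (2 * n))
     then \<Sum>h\<in>carrier (GL n \<times>\<times> GL n). fun_scale (inverse (char_pair h)) (parabolic_part B (x * block_diag n (fst h) (snd h) * r'))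
     else 0)"

text \<open>Left equivariance holds term by term; right equivariance follows by translating the
  summation over H.\<close>

lemma coset_lift_equivariant:
  assumes r': "r' \<in> carrier (GL (2 * n))" and B: "bilin B"
  shows "coset_lift r' B \<in> equivariants"
proof -
  let ?H = "GL n \<times>\<times> GL n :: ('f mat \<times> 'f mat) monoid"
  let ?bd = "\<lambda>h :: 'f mat \<times> 'f mat. block_diag n (fst h) (snd h)"
  have H: "group ?H" by (intro DirProd_group group_GL)
  have bd: "?bd h \<in> carrier (GL (2 * n))" if "h \<in> carrier ?H" for h
    using that by (auto intro: block_diag_GL)
  have xhr: "x * ?bd h * r' \<in> carrier (GL (2 * n))" if "x \<in> carrier (GL (2 * n))" "h \<in> carrier ?H" for x h
    using that bd r' by (intro GL_mult_closed)
  show ?thesis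
    unfolding equivariants_def
  proof (intro CollectI conjI ballI allI impI)
    fix x :: "'f mat" assume x: "x \<in> carrier (GL (2 * n))"
    have "coset_lift r' B x \<in> Collect bilin"
      unfolding coset_lift_def
      using x xhr parabolic_part_bilin[OF B] bilinear_form_subspace[of \<pi>1 \<pi>2]
      by (auto intro!: fs.subspace_sum[of "Collect bilin", simplified] fs.subspace_scale[of "Collect bilin", simplified])
    then show "bilin (coset_lift r' B x)" by simp
  next
    fix x :: "'f mat" assume "x \<notin> carrier (GL (2 * n))"
    then show "coset_lift r' B x = 0" by (simp add: coset_lift_def)
  next
    fix A D X x :: "'f mat"
    assume A: "A \<in> carrier (GL n)" and D: "D \<in> carrier (GL n)" and X: "X \<in> carrier_mat n n" and x: "x \<in> carrier (GL (2 * n))"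
    let ?p = "four_block_mat A X (0\<^sub>m n n) D"
    have p: "?p \<in> carrier (GL (2 * n))" by (rule parabolic_GL[OF A D X])
    have "parabolic_part B (?p * x * ?bd h * r') = form_act A D (parabolic_part B (x * ?bd h * r'))" if h: "h \<in> carrier ?H" for h
    proof -
      have "?p * x * ?bd h * r' = ?p * (x * ?bd h * r')"
        using GL_carrier_mat[OF p] GL_carrier_mat[OF x] GL_carrier_mat[OF bd[OF h]] GL_carrier_mat[OF r']
        by (simp add: assoc_mult_mat[of _ "2 * n" "2 * n" _ "2 * n" _ "2 * n"] mult_carrier_mat[of _ "2 * n" "2 * n" _ "2 * n"])
      then show ?thesis using parabolic_part_mult[OF A D X xhr[OF x h]] by simp
    qed
    then show "coset_lift r' B (?p * x) = form_act A D (coset_lift r' B x)"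
      using x p by (simp add: coset_lift_def GL_mult_closed form_act_sum form_act_scale)
  next
    fix h1 h2 x :: "'f mat" assume h: "h1 \<in> carrier (GL n)" "h2 \<in> carrier (GL n)" and x: "x \<in> carrier (GL (2 * n))"
    have hH: "(h1, h2) \<in> carrier ?H" using h by simp
    let ?F = "\<lambda>k. fun_scale (char_pair (h1, h2) * inverse (char_pair k)) (parabolic_part B (x * ?bd k * r'))"
    have "coset_lift r' B (x * block_diag n h1 h2) = (\<Sum>k\<in>carrier ?H. ?F ((h1, h2) \<otimes>\<^bsub>?H\<^esub> k))"
    proof -
      have "fun_scale (inverse (char_pair k)) (parabolic_part B (x * block_diag n h1 h2 * ?bd k * r')) = ?F ((h1, h2) \<otimes>\<^bsub>?H\<^esub> k)"
        if k: "k \<in> carrier ?H" for k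
      proof -
        obtain k1 k2 where [simp]: "k = (k1, k2)" by (cases k)
        have kc: "k1 \<in> carrier (GL n)" "k2 \<in> carrier (GL n)" using k by auto
        have "x * block_diag n h1 h2 * block_diag n k1 k2 = x * (block_diag n h1 h2 * block_diag n k1 k2)"
          using GL_carrier_mat[OF x] GL_carrier_mat[OF bd[OF hH]] GL_carrier_mat[OF bd[OF k]] by (intro assoc_mult_mat) auto
        also have "block_diag n h1 h2 * block_diag n k1 k2 = block_diag n (h1 * k1) (h2 * k2)"
          using h kc by (intro block_diag_mult[symmetric] GL_carrier_mat)
        finally show ?thesis
          using char_pair_mult[OF h kc] char_pair_nonzero[OF h] by (simp add: mult_GL)
      qed
      then show ?thesis using x bd[OF hH] by (simp add: coset_lift_def GL_mult_closed)
    qed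
    also have "\<dots> = (\<Sum>k\<in>carrier ?H. ?F k)" by (rule sum_group_translate(1)[OF H hH])
    also have "\<dots> = fun_scale (char_pair (h1, h2)) (coset_lift r' B x)"
      using x by (simp add: coset_lift_def fs.scale_sum_right)
    finally show "coset_lift r' B (x * block_diag n h1 h2) = fun_scale (char_pair (h1, h2)) (coset_lift r' B x)" .
  qed
qed

text \<open>At \<open>r\<close> only elements h with p r = r h for some p in the parabolic
  contribute, and \<open>stab\<close> makes every nonzero contribution equal to \<open>B\<close>.
  The lift therefore takes at \<open>r\<close> a multiple of \<open>B\<close> that can be
  normalised, and at other cosets no term survives.\<close>

lemma coset_lift_exists:
  assumes r: "r \<in> carrier (GL (2 * n))" and B: "bilin B"
    and stab: "\<And>A D X h1 h2. A \<in> carrier (GL n) \<Longrightarrow> D \<in> carrier (GL n) \<Longrightarrow> X \<in> carrier_mat n n \<Longrightarrow>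
      h1 \<in> carrier (GL n) \<Longrightarrow> h2 \<in> carrier (GL n) \<Longrightarrow>
      four_block_mat A X (0\<^sub>m n n) D * r = r * block_diag n h1 h2 \<Longrightarrow> form_act A D B = fun_scale (char_pair (h1, h2)) B"
  shows "\<exists>f\<in>equivariants. f r = B \<and> (\<forall>s\<in>carrier (GL (2 * n)).
    (\<forall>A\<in>carrier (GL n). \<forall>D\<in>carrier (GL n). \<forall>X\<in>carrier_mat n n. \<forall>h1\<in>carrier (GL n). \<forall>h2\<in>carrier (GL n).
       four_block_mat A X (0\<^sub>m n n) D * r \<noteq> s * block_diag n h1 h2) \<longrightarrow> f s = 0)"
proof -
  let ?H = "GL n \<times>\<times> GL n :: ('f mat \<times> 'f mat) monoid"
  let ?bd = "\<lambda>h :: 'f mat \<times> 'f mat. block_diag n (fst h) (snd h)"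
  obtain r' where r': "r' \<in> carrier (GL (2 * n))" "r * r' = 1\<^sub>m (2 * n)" "r' * r = 1\<^sub>m (2 * n)"
    using GL_obtain_inv[OF r] .
  note rc = GL_carrier_mat[OF r] GL_carrier_mat[OF r'(1)]
  have bd: "?bd h \<in> carrier (GL (2 * n))" if "h \<in> carrier ?H" for h
    using that by (auto intro: block_diag_GL)
  have part: "(\<exists>A\<in>carrier (GL n). \<exists>D\<in>carrier (GL n). \<exists>X\<in>carrier_mat n n.
        four_block_mat A X (0\<^sub>m n n) D * r = s * ?bd h \<and> parabolic_part B (s * ?bd h * r') = form_act A D B)
      \<or> parabolic_part B (s * ?bd h * r') = 0" if s: "s \<in> carrier (GL (2 * n))" and h: "h \<in> carrier ?H" for s h
  proof -
    let ?y = "s * ?bd h * r'"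
    have sh: "s * ?bd h \<in> carrier_mat (2 * n) (2 * n)"
      using GL_carrier_mat[OF GL_mult_closed[OF s bd[OF h]]] .
    have y: "?y \<in> carrier (GL (2 * n))" using s bd[OF h] r'(1) by (intro GL_mult_closed)
    obtain A X C D where b: "A \<in> carrier_mat n n" "X \<in> carrier_mat n n" "C \<in> carrier_mat n n" "D \<in> carrier_mat n n"
      "?y = four_block_mat A X C D" "C = 0\<^sub>m n n \<longrightarrow> A \<in> carrier (GL n) \<and> D \<in> carrier (GL n)"
      using y by (rule GL_blocks)
    have yr: "?y * r = s * ?bd h" by (rule mult_right_inverse_mat[OF sh rc(2) rc(1) r'(3)])
    show ?thesis
    proof (cases "C = 0\<^sub>m n n")
      case True
      then show ?thesis
        using b yr parabolic_part_four_block[OF b(1-4), of B]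
        by (intro disjI1 bexI[of _ A] bexI[of _ D] bexI[of _ X]) (simp_all add: b(5)[symmetric] del: assoc_mult_mat)
    next
      case False
      then show ?thesis using b parabolic_part_four_block[OF b(1-4), of B] by simp
    qed
  qed
  \<comment> \<open>The summands that do not vanish at \<open>r\<close>; their number is the factor
    by which the lift is later divided.\<close>
  let ?N = "{h \<in> carrier ?H. parabolic_part B (r * ?bd h * r') \<noteq> 0}"
  have fin: "finite (carrier ?H)" by (simp add: finite_GL)
  have term_r: "fun_scale (inverse (char_pair h)) (parabolic_part B (r * ?bd h * r')) = B" if "h \<in> ?N" for h
  proof -
    have h: "h \<in> carrier ?H" "fst h \<in> carrier (GL n)" "snd h \<in> carrier (GL n)"
      and nz: "parabolic_part B (r * ?bd h * r') \<noteq> 0" using that by auto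
    obtain A D X where *: "A \<in> carrier (GL n)" "D \<in> carrier (GL n)" "X \<in> carrier_mat n n"
      "four_block_mat A X (0\<^sub>m n n) D * r = r * ?bd h" "parabolic_part B (r * ?bd h * r') = form_act A D B"
      using part[OF r h(1)] nz by blast
    show ?thesis
      using stab[OF *(1-3) h(2,3) *(4)] *(5) char_pair_nonzero[OF h(2,3)] by simp
  qed
  have value_r: "coset_lift r' B r = fun_scale (of_nat (card ?N)) B"
  proof -
    have "coset_lift r' B r = (\<Sum>h\<in>?N. fun_scale (inverse (char_pair h)) (parabolic_part B (r * ?bd h * r')))"
      unfolding coset_lift_def using r fin by (auto intro!: sum.mono_neutral_right)
    also have "\<dots> = (\<Sum>h\<in>?N. B)" by (rule sum.cong[OF refl term_r])
    also have "\<dots> = fun_scale (of_nat (card ?N)) B" by (rule fs.sum_constant_scale)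
    finally show ?thesis .
  qed
  show ?thesis
  \<comment> \<open>For \<open>B = 0\<close> the set \<open>?N\<close> is empty and cannot be used
    for normalisation; otherwise it contains the identity.\<close>
  proof (cases "B = 0")
    case True
    have "(0 :: 'f mat \<Rightarrow> ('v \<Rightarrow> complex) \<times> ('w \<Rightarrow> complex) \<Rightarrow> complex) \<in> equivariants"
      using B by (auto simp: equivariants_def True form_act_zero)
    then show ?thesis using True by (intro bexI[of _ 0]) auto
  next
    case False
    have "(1\<^sub>m n, 1\<^sub>m n) \<in> ?N"
    proof -
      have "r * block_diag n (1\<^sub>m n) (1\<^sub>m n) * r' = four_block_mat (1\<^sub>m n) (0\<^sub>m n n) (0\<^sub>m n n) (1\<^sub>m n)"
        using rc r'(2) by (simp add: block_diag_one right_mult_one_mat[of _ "2 * n"] mult_2)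
      then have "parabolic_part B (r * block_diag n (1\<^sub>m n) (1\<^sub>m n) * r') = form_act (1\<^sub>m n) (1\<^sub>m n) B"
        using parabolic_part_four_block[of "1\<^sub>m n" "0\<^sub>m n n" "0\<^sub>m n n" "1\<^sub>m n" B] by simp
      also have "\<dots> = B"
        by (rule ext) (use B in \<open>auto simp: form_act_def bilinear_form_def
          r1.pullback_one[unfolded one_GL] r2.pullback_one[unfolded one_GL]\<close>)
      finally show ?thesis using False GL_one by simp
    qed
    then have N: "card ?N \<noteq> 0" using fin by (auto simp: card_eq_0_iff)
    let ?f = "coset_lift r' (fun_scale (inverse (of_nat (card ?N))) B)"
    have scale: "coset_lift r' (fun_scale c B) x = fun_scale c (coset_lift r' B x)" for c x
    proof -
      have "parabolic_part (fun_scale c B) y = fun_scale c (parabolic_part B y)" for y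
        by (auto simp: parabolic_part_def form_act_scale)
      then show ?thesis by (simp add: coset_lift_def fs.scale_sum_right mult.commute)
    qed
    have "fun_scale (inverse (of_nat (card ?N))) B \<in> Collect bilin"
      using B by (intro fs.subspace_scale bilinear_form_subspace) simp
    then have "?f \<in> equivariants" by (intro coset_lift_equivariant r') simp
    moreover have "?f r = B" using N by (simp add: scale value_r)
    moreover have "?f s = 0" if s: "s \<in> carrier (GL (2 * n))"
      and ne: "\<forall>A\<in>carrier (GL n). \<forall>D\<in>carrier (GL n). \<forall>X\<in>carrier_mat n n. \<forall>h1\<in>carrier (GL n). \<forall>h2\<in>carrier (GL n).
       four_block_mat A X (0\<^sub>m n n) D * r \<noteq> s * block_diag n h1 h2" for s
    proof -
      have "parabolic_part B (s * ?bd h * r') = 0" if "h \<in> carrier ?H" for h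
        using part[OF s that] ne that by auto
      then have "coset_lift r' B s = 0" using s by (simp add: coset_lift_def)
      then show ?thesis by (simp add: scale)
    qed
    ultimately show ?thesis by blast
  qed
qed


section \<open>Values at the orbit representatives\<close>

abbreviation "orbit c r \<equiv> orbit_mat n {..<r} ({..<c} \<union> {r..}) :: 'f mat"

lemma orbit_GL: "orbit c r \<in> carrier (GL (2 * n))"
  by (rule orbit_mat_GL) auto

lemma equivariant_vanishes:
  assumes f: "f \<in> equivariants" and 0: "\<And>c r. c \<le> r \<Longrightarrow> r \<le> n \<Longrightarrow> f (orbit c r) = 0"
  shows "f = 0"
proof (rule ext)
  fix g show "f g = 0 g"
  proof (cases "g \<in> carrier (GL (2 * n))")
    case True
    then obtain c r A D X h1 h2 where cr: "c \<le> r" "r \<le> n" and *: "A \<in> carrier (GL n)" "D \<in> carrier (GL n)"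
      "X \<in> carrier_mat n n" "h1 \<in> carrier (GL n)" "h2 \<in> carrier (GL n)"
      and g: "g = four_block_mat A X (0\<^sub>m n n) D * orbit c r * block_diag n h1 h2"
      using orbit_classification[OF True] by auto
    have "four_block_mat A X (0\<^sub>m n n) D * orbit c r \<in> carrier (GL (2 * n))"
      by (intro GL_mult_closed parabolic_GL * orbit_GL)
    then have "f g = fun_scale (char_pair (h1, h2)) (form_act A D (f (orbit c r)))"
      unfolding g using equivariantsD(4)[OF f *(4,5)] equivariantsD(3)[OF f *(1-3) orbit_GL] by simp
    then show ?thesis using 0[OF cr] by (simp add: form_act_zero fun_eq_iff)
  qed (simp add: equivariantsD(2)[OF f])
qed

lemma char_pair_det_one: "det h1 = 1 \<Longrightarrow> det h2 = 1 \<Longrightarrow> char_pair (h1, h2) = 1"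
  by (simp add: char_pair_def field_units_hom(3)[OF hom1] field_units_hom(3)[OF hom2])

text \<open>Replaces a form by the vectors of \<open>\<pi>2\<close> that represent its slices, the
  objects to which cuspidality applies.\<close>

lemma form_zeroI:
  assumes "bilin B" "\<And>\<phi> w. \<phi> \<in> r1.F \<Longrightarrow> w \<in> r2.V \<Longrightarrow> (\<And>\<psi>. \<psi> \<in> r2.F \<Longrightarrow> B (\<phi>, \<psi>) = \<psi> w) \<Longrightarrow> w = 0"
  shows "B = 0"
proof (rule bilinear_form_eqI[OF assms(1)])
  show "bilin 0" using fs.subspace_0[OF bilinear_form_subspace[of \<pi>1 \<pi>2]] by simp
  fix \<phi> \<psi> assume *: "\<phi> \<in> r1.F" "\<psi> \<in> r2.F"
  obtain w where w: "w \<in> r2.V" "\<forall>\<psi>\<in>r2.F. B (\<phi>, \<psi>) = \<psi> w" using form_vector_snd[OF assms(1) *(1)] by auto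
  then have "w = 0" using assms(2)[OF *(1)] by auto
  then show "B (\<phi>, \<psi>) = 0 (\<phi>, \<psi>)"
    using w *(2) lin_on_subspace.map_0[OF r2.F_lin_on[OF *(2)]] by simp
qed

text \<open>With the identity acting on the first argument the slice at \<open>\<phi>\<close> stays
  in place, so equivariance of the form becomes an eigenvector equation in
  \<open>\<pi>2\<close>.\<close>

lemma form_act_one_fst:
  assumes "form_act (1\<^sub>m n) D B = fun_scale c B" "D \<in> carrier (GL n)"
    and "\<phi> \<in> r1.F" "w \<in> r2.V" "\<And>\<psi>. \<psi> \<in> r2.F \<Longrightarrow> B (\<phi>, \<psi>) = \<psi> w"
  shows "r2.act D w = r2.sc c w"
proof (rule r2.separation)
  fix \<psi> assume \<psi>: "\<psi> \<in> r2.F"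
  have "\<psi> (r2.act D w) = B (\<phi>, pullback \<pi>2 D \<psi>)"
    using assms(5)[OF r2.pullback_closed[OF assms(2) \<psi>]] assms(4) by simp
  also have "\<dots> = form_act (1\<^sub>m n) D B (\<phi>, \<psi>)"
    using \<psi> assms(3) r1.pullback_one[OF assms(3)] by (simp add: form_act_def one_GL)
  also have "\<dots> = c * \<psi> w" using assms(1,5) \<psi> by simp
  finally show "\<psi> (r2.act D w) = \<psi> (r2.sc c w)" using lin_on_scale[OF r2.F_lin[OF \<psi>] assms(4)] by simp
qed (intro r2.act_closed r2.V_scale assms)+

lemma intermediate_orbit:
  assumes f: "f \<in> equivariants" and cusp: "cuspidal n \<pi>2" and cr: "c \<le> r" "r \<le> n" "0 < c" "c < n"
  shows "f (orbit c r) = 0"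
proof (rule form_zeroI[OF equivariantsD(1)[OF f orbit_GL]])
  fix \<phi> w assume \<phi>: "\<phi> \<in> r1.F" and w: "w \<in> r2.V" "\<And>\<psi>. \<psi> \<in> r2.F \<Longrightarrow> f (orbit c r) (\<phi>, \<psi>) = \<psi> w"
  have "r2.act u w = w" if u: "u \<in> unipotent_radical n {c}" for u
  proof -
    obtain X h1 h2 where *: "X \<in> carrier_mat n n" "h1 \<in> carrier (GL n)" "h2 \<in> carrier (GL n)" "det h1 = 1" "det h2 = 1"
      "four_block_mat (1\<^sub>m n) X (0\<^sub>m n n) u * orbit c r = orbit c r * block_diag n h1 h2"
      using orbit_mat_unipotent[OF cr(1,2) u] by blast
    obtain Y where Y: "Y \<in> carrier_mat c (n - c)" "u = four_block_mat (1\<^sub>m c) Y (0\<^sub>m (n - c) c) (1\<^sub>m (n - c))"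
      using u unipotent_radical_single[of c "n - c"] cr by auto
    have uG: "u \<in> carrier (GL n)"
      using GL_four_block_upper(1)[OF GL_one GL_one Y(1)] cr by (simp add: Y(2))
    \<comment> \<open>The right factors have determinant 1, so the character does not enter and the
      slice is fixed by the unipotent itself.\<close>
    have "form_act (1\<^sub>m n) u (f (orbit c r)) = fun_scale 1 (f (orbit c r))"
      using equivariant_stabilizer[OF f orbit_GL GL_one uG *(1-3,6)] char_pair_det_one[OF *(4,5)] by simp
    from form_act_one_fst[OF this uG \<phi> w] show ?thesis by simp
  qed
  then have "w \<in> {v \<in> r2.V. \<forall>u\<in>unipotent_radical n {c}. r2.act u v = v}" using w by simp
  also have "\<dots> = {0}" using cusp cr unfolding cuspidal_def by auto
  finally show "w = 0" by simp
qed

lemma closed_orbit_stabilizer: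
  assumes f: "f \<in> equivariants" and n: "n = a + b"
    and x: "x1 \<in> carrier (GL a)" "x2 \<in> carrier (GL a)" and y: "y1 \<in> carrier (GL b)" "y2 \<in> carrier (GL b)"
  defines "d \<equiv> \<lambda>x y. four_block_mat x (0\<^sub>m a b) (0\<^sub>m b a) y"
  shows "form_act (d x2 y1) (d x1 y2) (f (orbit 0 a)) = fun_scale (char_pair (d x1 y1, d x2 y2)) (f (orbit 0 a))"
proof -
  have dG: "d x y \<in> carrier (GL n)" if "x \<in> carrier (GL a)" "y \<in> carrier (GL b)" for x y
    unfolding d_def n by (rule GL_four_block_upper(1)[OF that]) simp
  have "four_block_mat (d x2 y1) (0\<^sub>m n n) (0\<^sub>m n n) (d x1 y2) * orbit 0 a = orbit 0 a * block_diag n (d x1 y1) (d x2 y2)"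
    using orbit_mat_diag[of x1 a x2 y1 b y2] x y
    unfolding d_def n block_diag_def by (simp add: carrier_GL)
  then show ?thesis by (intro equivariant_stabilizer[OF f orbit_GL, of _ _ "0\<^sub>m n n"] dG x y zero_carrier_mat)
qed

lemma unbalanced_orbit:
  assumes f: "f \<in> equivariants" and cusp: "cuspidal n \<pi>2" and n: "n = a + b" "n > 1" "a \<noteq> b"
  shows "f (orbit 0 a) = 0"
proof (rule form_zeroI[OF equivariantsD(1)[OF f orbit_GL]])
  fix \<phi> w assume \<phi>: "\<phi> \<in> r1.F" and w: "w \<in> r2.V" "\<And>\<psi>. \<psi> \<in> r2.F \<Longrightarrow> f (orbit 0 a) (\<phi>, \<psi>) = \<psi> w"
  show "w = 0"
  proof (rule cuspidal_no_block_eigenvector[of a b \<pi>2 w \<chi>1 \<chi>2])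
    fix x y :: "'f mat" assume xy: "x \<in> carrier (GL a)" "y \<in> carrier (GL b)"
    let ?d = "\<lambda>x y. four_block_mat x (0\<^sub>m a b) (0\<^sub>m b a) y"
    have d: "?d x y \<in> carrier (GL n)" unfolding n(1) by (rule GL_four_block_upper(1)[OF xy]) simp
    have "det (?d x (1\<^sub>m b)) = det x" "det (?d (1\<^sub>m a) y) = det y"
      using GL_four_block_upper(2)[OF xy(1) GL_one, of "0\<^sub>m a b"] GL_four_block_upper(2)[OF GL_one xy(2), of "0\<^sub>m a b"]
      by simp_all
    \<comment> \<open>The four stabilizer blocks are specialised to \<open>x1 = x\<close>,
      \<open>y2 = y\<close> and identities elsewhere: only the second argument moves, while
      \<open>x\<close> is seen by \<open>\<chi>1\<close> and \<open>y\<close> by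
      \<open>\<chi>2\<close>.\<close>
    then have "form_act (1\<^sub>m n) (?d x y) (f (orbit 0 a)) = fun_scale (\<chi>1 (det x) * \<chi>2 (det y)) (f (orbit 0 a))"
      using closed_orbit_stabilizer[OF f n(1) xy(1) GL_one GL_one xy(2)] by (simp add: n(1) char_pair_def)
    from form_act_one_fst[OF this d \<phi> w]
    show "r2.act (?d x y) w = r2.sc (\<chi>1 (det x) * \<chi>2 (det y)) w" .
  qed (use rep2 cusp n w field_units_hom(3)[OF hom1] field_units_hom(3)[OF hom2] in auto)
qed

abbreviation "diagonal_forms \<equiv> invariant_forms (GL n) \<pi>1 \<pi>2 (\<lambda>g. \<chi>1 (det g) * \<chi>2 (det g))"

lemma diagonal_formsI:
  assumes "bilin B" "\<And>g. g \<in> carrier (GL n) \<Longrightarrow> form_act g g B = fun_scale (char_pair (g, g)) B"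
  shows "B \<in> diagonal_forms"
  unfolding invariant_forms_def
proof (intro CollectI conjI ballI)
  fix g :: "'f mat" and \<phi> \<psi> assume *: "g \<in> carrier (GL n)" "\<phi> \<in> r1.F" "\<psi> \<in> r2.F"
  then show "B (pullback \<pi>1 g \<phi>, pullback \<pi>2 g \<psi>) = \<chi>1 (det g) * \<chi>2 (det g) * B (\<phi>, \<psi>)"
    using fun_cong[OF assms(2)[OF *(1)], of "(\<phi>, \<psi>)"] by (simp add: form_act_def char_pair_def)
qed (rule assms(1))

lemma diagonal_formsD:
  assumes "B \<in> diagonal_forms" "g \<in> carrier (GL n)"
  shows "form_act g g B = fun_scale (char_pair (g, g)) B"
proof (rule ext)
  fix p :: "('v \<Rightarrow> complex) \<times> ('w \<Rightarrow> complex)"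
  obtain \<phi> \<psi> where p: "p = (\<phi>, \<psi>)" by (cases p)
  show "form_act g g B p = fun_scale (char_pair (g, g)) B p"
    using assms unfolding p invariant_forms_def bilinear_form_def form_act_def char_pair_def
    by (cases "\<phi> \<in> r1.F \<and> \<psi> \<in> r2.F") auto
qed

lemma open_value:
  assumes f: "f \<in> equivariants"
  shows "f (open_mat n) \<in> diagonal_forms"
proof (rule diagonal_formsI[OF equivariantsD(1)[OF f open_mat_GL]])
  fix g :: "'f mat" assume g: "g \<in> carrier (GL n)"
  show "form_act g g (f (open_mat n)) = fun_scale (char_pair (g, g)) (f (open_mat n))"
    by (rule equivariant_stabilizer[OF f open_mat_GL g g zero_carrier_mat g g])
      (use open_mat_diag[OF GL_carrier_mat[OF g]] in \<open>simp add: block_diag_def\<close>)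
qed

text \<open>For \<open>n = 1\<close> cuspidality says nothing about the orbits with \<open>c = 0\<close> and \<open>a \<noteq> b\<close>, but their values
  are invariant under the diagonal, so that they force condition (1).\<close>

lemma rank_one_value:
  assumes f: "f \<in> equivariants" and n: "n = 1" and r: "r \<le> n"
  shows "f (orbit 0 r) \<in> diagonal_forms"
proof (rule diagonal_formsI[OF equivariantsD(1)[OF f orbit_GL]])
  fix g :: "'f mat" assume g: "g \<in> carrier (GL n)"
  consider "r = 0" | "r = 1" using r n by linarith
  then show "form_act g g (f (orbit 0 r)) = fun_scale (char_pair (g, g)) (f (orbit 0 r))"
  proof cases
    case 1
    have "four_block_mat (1\<^sub>m 0) (0\<^sub>m 0 n) (0\<^sub>m n 0) g = g"
      using GL_carrier_mat[OF g] by (intro eq_matI) auto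
    then show ?thesis
      using closed_orbit_stabilizer[OF f, of 0 n "1\<^sub>m 0" "1\<^sub>m 0" g g] g GL_one[of 0] 1 by simp
  next
    case 2
    have "four_block_mat g (0\<^sub>m n 0) (0\<^sub>m 0 n) (1\<^sub>m 0) = g"
      using GL_carrier_mat[OF g] by (intro eq_matI) auto
    then show ?thesis
      using closed_orbit_stabilizer[OF f, of n 0 g g "1\<^sub>m 0" "1\<^sub>m 0"] g GL_one[of 0] 2 n by simp
  qed
qed

text \<open>The two representatives of this orbit differ by a left factor in the parabolic, so the
  values there determine each other.\<close>

lemma closed_value_zero:
  assumes f: "f \<in> equivariants" and n: "n = m + m" and 0: "f (closed_mat m) = 0"
  shows "f (orbit 0 m) = 0"
proof -
  let ?W = "block_swap m m :: 'f mat"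
  have W: "?W \<in> carrier (GL n)" unfolding n by (rule block_swap_GL)
  have WW: "?W * ?W = 1\<^sub>m n" unfolding n by (rule block_swap_swap)
  have o: "orbit 0 m \<in> carrier_mat (2 * n) (2 * n)" by (rule GL_carrier_mat[OF orbit_GL])
  have "orbit 0 m = block_diag n ?W (1\<^sub>m n) * (block_diag n ?W (1\<^sub>m n) * orbit 0 m)"
    using mult_left_inverse_mat[OF o, of "block_diag n ?W (1\<^sub>m n)" "block_diag n ?W (1\<^sub>m n)"] GL_carrier_mat[OF W]
    by (simp add: block_diag_mult[symmetric] WW block_diag_one)
  also have "block_diag n ?W (1\<^sub>m n) * orbit 0 m = closed_mat m"
    unfolding closed_mat_eq_orbit_mat n by simp
  finally have "f (orbit 0 m) = f (four_block_mat ?W (0\<^sub>m n n) (0\<^sub>m n n) (1\<^sub>m n) * closed_mat m)"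
    by (simp only: block_diag_def)
  also have "\<dots> = form_act ?W (1\<^sub>m n) (f (closed_mat m))"
    using closed_mat_GL[of m] by (intro equivariantsD(3)[OF f W GL_one zero_carrier_mat]) (simp add: n)
  finally show ?thesis by (simp add: 0 form_act_zero)
qed

text \<open>For n > 1 the values at \<open>open_mat\<close> and, for even n, at
  \<open>closed_mat\<close> detect every equivariant function; for n = 1 the remaining orbits at
  least exhibit a nonzero diagonal form.\<close>

lemma equivariant_nonzero_cases:
  assumes f: "f \<in> equivariants" "f \<noteq> 0" and cusp: "cuspidal n \<pi>2" and n: "n \<ge> 1"
  obtains "f (open_mat n) \<noteq> 0" | m where "n = m + m" "f (closed_mat m) \<noteq> 0"
    | B where "n = 1" "B \<in> diagonal_forms" "B \<noteq> 0"
proof -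
  obtain c r where cr: "c \<le> r" "r \<le> n" "f (orbit c r) \<noteq> 0"
    using equivariant_vanishes[OF f(1)] f(2) by blast
  consider "c = n" | "c = 0" "n = 1" | "c = 0" "n > 1"
    using intermediate_orbit[OF f(1) cusp cr(1,2)] cr n by force
  then show ?thesis
  proof cases
    case 1
    then have "r = n" using cr by simp
    then have "{..<c} \<union> {r..} = UNIV" using 1 by auto
    then have "orbit c r = open_mat n" using \<open>r = n\<close> by (simp add: open_mat_eq_orbit_mat)
    then show ?thesis using cr that(1) by simp
  next
    case 2
    then show ?thesis using rank_one_value[OF f(1) 2(2) cr(2)] cr(3) that(3) by blast
  next
    case 3
    have nr: "n = r + (n - r)" using cr by simp
    have eq: "r = n - r" using unbalanced_orbit[OF f(1) cusp nr 3(2)] cr(3) 3(1) by blast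
    then have "n = r + r" using nr by simp
    moreover have "f (closed_mat r) \<noteq> 0" using closed_value_zero[OF f(1) \<open>n = r + r\<close>] cr(3) 3(1) by blast
    ultimately show ?thesis by (rule that(2))
  qed
qed

end

section \<open>Lifts from the two orbits and the dimension count\<close>

context induced_pair
begin

lemma equivariants_subspace: "module.subspace ind_scale equivariants"
proof -
  interpret vector_space ind_scale by (rule vector_space_ind_scale)
  have add: "form_act A D (B + B') = form_act A D B + form_act A D B'" for A D B B'
    by (auto simp: form_act_def fun_eq_iff)
  have bil: "bilin 0" "bilin B \<Longrightarrow> bilin B' \<Longrightarrow> bilin (B + B')" "bilin B \<Longrightarrow> bilin (fun_scale c B)" for B B' c
    using fs.subspace_0[OF bilinear_form_subspace[of \<pi>1 \<pi>2]] fs.subspace_add[OF bilinear_form_subspace[of \<pi>1 \<pi>2]]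
      fs.subspace_scale[OF bilinear_form_subspace[of \<pi>1 \<pi>2]] by auto
  show ?thesis
  proof (rule subspaceI)
    show "0 \<in> equivariants" by (simp add: equivariants_def bil form_act_zero)
    show "f + g \<in> equivariants" if "f \<in> equivariants" "g \<in> equivariants" for f g
      using that by (auto simp: equivariants_def bil add fs.scale_right_distrib)
    show "ind_scale c f \<in> equivariants" if "f \<in> equivariants" for c f
      using that by (auto simp: equivariants_def ind_scale_def bil form_act_scale mult.commute)
  qed
qed

text \<open>The stabilizer of \<open>open_mat\<close> is exactly the diagonal, so membership in
  \<open>diagonal_forms\<close> is the full compatibility condition for a lift.\<close>

lemma open_lift:
  assumes B: "B \<in> diagonal_forms"
  shows "\<exists>f\<in>equivariants. f (open_mat n) = B \<and> (\<forall>m\<ge>1. n = m + m \<longrightarrow> f (closed_mat m) = 0)"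
proof -
  have bil: "bilin B" using B by (simp add: invariant_forms_def)
  obtain f where f: "f \<in> equivariants" "f (open_mat n) = B"
    and 0: "\<And>s. s \<in> carrier (GL (2 * n)) \<Longrightarrow>
    (\<forall>A\<in>carrier (GL n). \<forall>D\<in>carrier (GL n). \<forall>X\<in>carrier_mat n n. \<forall>h1\<in>carrier (GL n). \<forall>h2\<in>carrier (GL n).
       four_block_mat A X (0\<^sub>m n n) D * open_mat n \<noteq> s * block_diag n h1 h2) \<Longrightarrow> f s = 0"
    using coset_lift_exists[OF open_mat_GL bil]
      open_mat_stabilizer[where 'a = 'f, of _ n] diagonal_formsD[OF B] GL_carrier_mat by metis
  have "f (closed_mat m) = 0" if m: "m \<ge> 1" "n = m + m" for m
  proof (intro 0 ballI)
    show "closed_mat m \<in> carrier (GL (2 * n) :: 'f mat monoid)" using closed_mat_GL[of m] by (simp add: m(2))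
    fix A D X h1 h2 :: "'f mat"
    assume "A \<in> carrier (GL n)" "D \<in> carrier (GL n)" "X \<in> carrier_mat n n" "h1 \<in> carrier (GL n)" "h2 \<in> carrier (GL n)"
    then show "four_block_mat A X (0\<^sub>m n n) D * open_mat n \<noteq> closed_mat m * block_diag n h1 h2"
      unfolding m(2) by (intro open_closed_disjoint(1)[OF m(1)]) (auto simp: GL_carrier_mat)
  qed
  then show ?thesis using f by blast
qed

context
  fixes m assumes n: "n = m + m" and m: "m \<ge> 1"
begin

definition levi_group :: "('f mat \<times> 'f mat) monoid" where
  "levi_group = GL m \<times>\<times> GL m"

definition levi_embedding :: "'f mat \<times> 'f mat \<Rightarrow> 'f mat" where
  "levi_embedding = (\<lambda>(k1, k2). block_diag m k1 k2)"

lemma char_pair_mult_half: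
  assumes "h1 \<in> carrier (GL m)" "h2 \<in> carrier (GL m)" "k1 \<in> carrier (GL m)" "k2 \<in> carrier (GL m)"
  shows "char_pair (h1 * k1, h2 * k2) = char_pair (h1, h2) * char_pair (k1, k2)"
  using assms field_units_hom(1)[OF hom1] field_units_hom(1)[OF hom2]
  by (auto simp: char_pair_def carrier_GL det_mult)

lemma levi_average:
  assumes "is_rep (GL n) \<pi>"
  shows "character_average (GL n) \<pi> levi_group levi_embedding char_pair"
proof -
  have hom: "levi_embedding \<in> hom levi_group (GL n)"
    using block_diag_GL(1)[of _ m]
    unfolding n by (auto simp: hom_def levi_embedding_def levi_group_def mult_GL mult_2 block_diag_mult GL_carrier_mat)
  have fin: "finite (carrier levi_group)" by (simp add: levi_group_def finite_GL)
  show ?thesis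
    unfolding character_average_def character_average_axioms_def representation_def
    using assms hom fin char_pair_mult_half char_pair_nonzero
    by (auto simp: levi_group_def DirProd_group group_GL mult_GL)
qed

lemma eigfuns_eq:
  assumes "is_rep (GL n) \<pi>"
  shows "character_average.eigfuns \<pi> levi_group levi_embedding char_pair = hom_to_char m \<pi> \<chi>1 \<chi>2"
  unfolding character_average.eigfuns_def[OF levi_average[OF assms]]
  by (auto simp: hom_to_char_def levi_group_def
      levi_embedding_def char_pair_def)

lemma eigvecs_eq:
  assumes "is_rep (GL n) \<pi>"
  shows "character_average.eigvecs \<pi> levi_group levi_embedding char_pair = char_vectors m \<pi> \<chi>1 \<chi>2"
  unfolding character_average.eigvecs_def[OF levi_average[OF assms]]
  by (auto simp: char_vectors_def levi_group_def
      levi_embedding_def char_pair_def)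

text \<open>Condition (2) asks for eigenvectors, whereas the multiplicity counts functionals; the
  dual basis links the two.\<close>

lemma char_mult_nonzero_iff:
  assumes "is_rep (GL n) \<pi>"
  shows "char_mult m \<pi> \<chi>1 \<chi>2 \<noteq> 0 \<longleftrightarrow> (\<exists>v\<in>char_vectors m \<pi> \<chi>1 \<chi>2. v \<noteq> 0)"
proof -
  interpret c: character_average "GL n" \<pi> levi_group levi_embedding char_pair by (rule levi_average[OF assms])
  obtain I a where I: "finite I" "I \<subseteq> c.eigfuns" "card I = fs.dim c.eigfuns" "\<And>\<alpha>. \<alpha> \<in> I \<Longrightarrow> a \<alpha> \<in> c.eigvecs"
    "\<And>\<alpha> \<beta>. \<alpha> \<in> I \<Longrightarrow> \<beta> \<in> I \<Longrightarrow> \<beta> (a \<alpha>) = (if \<alpha> = \<beta> then 1 else 0)"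
    "\<And>v. v \<in> c.eigvecs \<Longrightarrow> (\<And>\<alpha>. \<alpha> \<in> I \<Longrightarrow> \<alpha> v = 0) \<Longrightarrow> v = 0"
    by (rule c.eigvecs_dual_basis) blast
  have "char_mult m \<pi> \<chi>1 \<chi>2 = card I" using I(3) by (simp add: char_mult_def eigfuns_eq[OF assms])
  then have "char_mult m \<pi> \<chi>1 \<chi>2 \<noteq> 0 \<longleftrightarrow> I \<noteq> {}" using I(1) by simp
  also have "\<dots> \<longleftrightarrow> (\<exists>v\<in>c.eigvecs. v \<noteq> 0)"
  proof
    assume "I \<noteq> {}"
    then obtain \<alpha> where \<alpha>: "\<alpha> \<in> I" by blast
    have \<alpha>F: "\<alpha> \<in> c.F" using I(2) \<alpha> by (auto simp: c.eigfuns_def)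
    then have "a \<alpha> \<noteq> 0" using I(5)[OF \<alpha> \<alpha>] lin_on_subspace.map_0[OF c.F_lin_on[OF \<alpha>F]] by auto
    then show "\<exists>v\<in>c.eigvecs. v \<noteq> 0" using I(4)[OF \<alpha>] by blast
  qed (use I(6) in blast)
  finally show ?thesis by (simp add: eigvecs_eq[OF assms])
qed

lemma closed_value:
  assumes f: "f \<in> equivariants" and k: "k \<in> carrier levi_group" and l: "l \<in> carrier levi_group"
  shows "form_act (levi_embedding k) (levi_embedding l) (f (closed_mat m))
    = fun_scale (char_pair k * char_pair l) (f (closed_mat m))"
proof -
  \<comment> \<open>The blocks are grouped by the argument on which they act. In each group the
    first block lies in the first factor of H and the second in the second, so the character splits
    as \<open>char_pair k * char_pair l\<close>.\<close>
  obtain y1 x2 x1 y2 where kl: "k = (y1, x2)" "l = (x1, y2)" by (cases k, cases l)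
  have xy: "y1 \<in> carrier (GL m)" "x2 \<in> carrier (GL m)" "x1 \<in> carrier (GL m)" "y2 \<in> carrier (GL m)"
    using k l by (auto simp: kl levi_group_def)
  have bd: "block_diag m x y \<in> carrier (GL n)" "det (block_diag m x y) = det x * det y"
    if "x \<in> carrier (GL m)" "y \<in> carrier (GL m)" for x y :: "'f mat"
    using block_diag_GL[OF that] by (simp_all add: n mult_2)
  have "four_block_mat (block_diag m y1 x2) (0\<^sub>m n n) (0\<^sub>m n n) (block_diag m x1 y2) * closed_mat m
      = closed_mat m * block_diag n (block_diag m x1 y1) (block_diag m x2 y2)"
    using closed_mat_diag[of x1 m x2 y1 y2] xy[THEN GL_carrier_mat] by (simp add: n block_diag_def)
  then have "form_act (block_diag m y1 x2) (block_diag m x1 y2) (f (closed_mat m))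
      = fun_scale (char_pair (block_diag m x1 y1, block_diag m x2 y2)) (f (closed_mat m))"
    using closed_mat_GL[of m] by (intro equivariant_stabilizer[OF f, of _ _ _ "0\<^sub>m n n"] bd xy zero_carrier_mat) (simp_all add: n)
  moreover have "char_pair (block_diag m x1 y1, block_diag m x2 y2) = char_pair (y1, x2) * char_pair (x1, y2)"
    using xy bd field_units_hom(1)[OF hom1] field_units_hom(1)[OF hom2] by (simp add: char_pair_def carrier_GL)
  ultimately show ?thesis by (simp add: kl levi_embedding_def)
qed

text \<open>By \<open>closed_mat_stabilizer\<close> every relation at \<open>closed_mat\<close> acts
  on the value through two elements of the Levi subgroup, with the same product of characters, so
  that \<open>inv\<close> is the full compatibility condition.\<close>

lemma closed_lift:
  assumes B: "bilin B" and inv: "\<And>k l. k \<in> carrier levi_group \<Longrightarrow> l \<in> carrier levi_group \<Longrightarrow>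
      form_act (levi_embedding k) (levi_embedding l) B = fun_scale (char_pair k * char_pair l) B"
  shows "\<exists>f\<in>equivariants. f (closed_mat m) = B \<and> f (open_mat n) = 0"
proof -
  have cG: "closed_mat m \<in> carrier (GL (2 * n) :: 'f mat monoid)" using closed_mat_GL[of m] by (simp add: n)
  have stab: "form_act A D B = fun_scale (char_pair (h1, h2)) B"
    if *: "A \<in> carrier (GL n)" "D \<in> carrier (GL n)" "X \<in> carrier_mat n n" "h1 \<in> carrier (GL n)" "h2 \<in> carrier (GL n)"
      "four_block_mat A X (0\<^sub>m n n) D * closed_mat m = closed_mat m * block_diag n h1 h2" for A D X h1 h2
  proof -
    obtain x1 x2 y1 y2 where xy: "x1 \<in> carrier (GL m)" "x2 \<in> carrier (GL m)" "y1 \<in> carrier (GL m)" "y2 \<in> carrier (GL m)"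
      and eq: "A = block_diag m y1 x2" "D = block_diag m x1 y2" "det h1 = det x1 * det y1" "det h2 = det x2 * det y2"
      using closed_mat_stabilizer[of A m D X h1 h2] * GL_carrier_mat unfolding n by blast
    have "char_pair (h1, h2) = char_pair (y1, x2) * char_pair (x1, y2)"
      using xy field_units_hom(1)[OF hom1] field_units_hom(1)[OF hom2] by (simp add: char_pair_def eq(3,4) carrier_GL)
    then show ?thesis
      using inv[of "(y1, x2)" "(x1, y2)"] xy by (simp add: eq(1,2) levi_embedding_def levi_group_def)
  qed
  obtain f where f: "f \<in> equivariants" "f (closed_mat m) = B"
    and 0: "\<And>s. s \<in> carrier (GL (2 * n)) \<Longrightarrow>
    (\<forall>A\<in>carrier (GL n). \<forall>D\<in>carrier (GL n). \<forall>X\<in>carrier_mat n n. \<forall>h1\<in>carrier (GL n). \<forall>h2\<in>carrier (GL n).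
       four_block_mat A X (0\<^sub>m n n) D * closed_mat m \<noteq> s * block_diag n h1 h2) \<Longrightarrow> f s = 0"
  proof -
    have "\<exists>f\<in>equivariants. f (closed_mat m) = B \<and> (\<forall>s\<in>carrier (GL (2 * n)).
      (\<forall>A\<in>carrier (GL n). \<forall>D\<in>carrier (GL n). \<forall>X\<in>carrier_mat n n. \<forall>h1\<in>carrier (GL n). \<forall>h2\<in>carrier (GL n).
       four_block_mat A X (0\<^sub>m n n) D * closed_mat m \<noteq> s * block_diag n h1 h2) \<longrightarrow> f s = 0)"
      using cG B stab by (rule coset_lift_exists)
    then show ?thesis using that by auto
  qed
  have "four_block_mat A X (0\<^sub>m n n) D * closed_mat m \<noteq> open_mat n * block_diag n h1 h2"
    if "A \<in> carrier (GL n)" "D \<in> carrier (GL n)" "X \<in> carrier_mat n n" "h1 \<in> carrier (GL n)" "h2 \<in> carrier (GL n)"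
    for A D X h1 h2 :: "'f mat"
    using that GL_carrier_mat[OF that(1)] unfolding n by (intro open_closed_disjoint(2)[OF m])
  then have "f (open_mat n) = 0" by (intro 0 ballI open_mat_GL)
  then show ?thesis using f by blast
qed

text \<open>The closed half of the dual system: \<open>J\<close> consists of pairs of functionals,
  and the coordinates of \<open>f\<close> are its values at \<open>closed_mat\<close> on these
  pairs.\<close>

lemma closed_orbit_dual_basis:
  "\<exists>(J :: (('v \<Rightarrow> complex) \<times> ('w \<Rightarrow> complex)) set) v.
     finite J \<and> card J = char_mult m \<pi>1 \<chi>1 \<chi>2 * char_mult m \<pi>2 \<chi>1 \<chi>2 \<and>
     (\<forall>j\<in>J. v j \<in> equivariants \<and> v j (open_mat n) = 0) \<and>
     (\<forall>i\<in>J. \<forall>j\<in>J. v i (closed_mat m) j = (if i = j then 1 else 0)) \<and>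
     (\<forall>f\<in>equivariants. (\<forall>j\<in>J. f (closed_mat m) j = 0) \<longrightarrow> f (closed_mat m) = 0)"
proof -
  let ?K = levi_group and ?\<rho> = levi_embedding
  note ca = levi_average[OF rep1] levi_average[OF rep2]
  have cG: "closed_mat m \<in> carrier (GL (2 * n) :: 'f mat monoid)" using closed_mat_GL[of m] by (simp add: n)
  show ?thesis
  proof (rule eigenforms_dual_basis[OF ca])
    fix J b
    assume J: "finite J" "card J = fs.dim (character_average.eigfuns \<pi>1 ?K ?\<rho> char_pair)
        * fs.dim (character_average.eigfuns \<pi>2 ?K ?\<rho> char_pair)"
      and b: "\<And>j. j \<in> J \<Longrightarrow> bilin (b j)"
        "\<And>j k l. j \<in> J \<Longrightarrow> k \<in> carrier ?K \<Longrightarrow> l \<in> carrier ?K \<Longrightarrow>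
          form_act (?\<rho> k) (?\<rho> l) (b j) = fun_scale (char_pair k * char_pair l) (b j)"
        "\<And>i j. i \<in> J \<Longrightarrow> j \<in> J \<Longrightarrow> b i j = (if i = j then 1 else 0)"
      and sep: "\<And>B. bilin B \<Longrightarrow> (\<And>k l. k \<in> carrier ?K \<Longrightarrow> l \<in> carrier ?K \<Longrightarrow>
          form_act (?\<rho> k) (?\<rho> l) B = fun_scale (char_pair k * char_pair l) B) \<Longrightarrow>
        (\<And>j. j \<in> J \<Longrightarrow> B j = 0) \<Longrightarrow> B = (\<lambda>_. 0)"
    have "\<exists>f\<in>equivariants. f (closed_mat m) = b j \<and> f (open_mat n) = 0" if "j \<in> J" for j
      using b(1)[OF that] b(2)[OF that] by (rule closed_lift)
    then obtain v where v: "\<And>j. j \<in> J \<Longrightarrow> v j \<in> equivariants" "\<And>j. j \<in> J \<Longrightarrow> v j (closed_mat m) = b j"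
        "\<And>j. j \<in> J \<Longrightarrow> v j (open_mat n) = 0"
      by metis
    have "f (closed_mat m) = 0" if f: "f \<in> equivariants" and 0: "\<forall>j\<in>J. f (closed_mat m) j = 0" for f
    proof -
      have "f (closed_mat m) = (\<lambda>_. 0)"
        using equivariantsD(1)[OF f cG] closed_value[OF f] by (rule sep) (use 0 in blast)+
      then show ?thesis by (simp add: zero_fun_def)
    qed
    moreover have "card J = char_mult m \<pi>1 \<chi>1 \<chi>2 * char_mult m \<pi>2 \<chi>1 \<chi>2"
      using J(2) by (simp add: char_mult_def eigfuns_eq rep1 rep2)
    ultimately show ?thesis using J(1) b(3) v by (intro exI[of _ J] exI[of _ v]) auto
  qed
qed

end

text \<open>\<open>diag\<close> is condition (1) in the language of forms. Existence and dimension
  use the same vectors and evaluations; only the dimension needs that these evaluations separate all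
  equivariant functions.\<close>

lemma equivariants_dim:
  assumes irr1: "irreducible_rep (GL n) \<pi>1" and irr2: "irreducible_rep (GL n) \<pi>2"
    and cusp: "cuspidal n \<pi>2" and n1: "n \<ge> 1"
  defines "diag \<equiv> \<exists>B\<in>diagonal_forms. B \<noteq> (\<lambda>_. 0)"
    and "cdim \<equiv> if even n then char_mult (n div 2) \<pi>1 \<chi>1 \<chi>2 * char_mult (n div 2) \<pi>2 \<chi>1 \<chi>2 else 0"
  shows "(\<exists>f\<in>equivariants. f \<noteq> 0) \<longleftrightarrow> diag \<or> cdim \<noteq> 0"
    and "n > 1 \<Longrightarrow> vector_space.dim ind_scale equivariants = (if diag then 1 else 0) + cdim"
proof -
  have nz: "\<chi>1 (det g) * \<chi>2 (det g) \<noteq> 0" if "g \<in> carrier (GL n)" for g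
    using char_pair_nonzero[OF that that] by (simp add: char_pair_def)
  define m where "m = n div 2"
  interpret ind: vector_space ind_scale by (rule vector_space_ind_scale)
  \<comment> \<open>Both parities are treated uniformly: for odd \<open>n\<close> the family is
    empty and the separation clause is void.\<close>
  have "\<exists>(J :: (('v \<Rightarrow> complex) \<times> ('w \<Rightarrow> complex)) set) v. finite J \<and> card J = cdim \<and>
     (\<forall>j\<in>J. v j \<in> equivariants \<and> v j (open_mat n) = 0) \<and>
     (\<forall>i\<in>J. \<forall>j\<in>J. v i (closed_mat m) j = (if i = j then 1 else 0)) \<and>
     (\<forall>f\<in>equivariants. (\<forall>j\<in>J. f (closed_mat m) j = 0) \<longrightarrow> even n \<longrightarrow> f (closed_mat m) = 0)"
  proof (cases "even n")
    case True
    then have "n = m + m" "m \<ge> 1" using n1 by (auto simp: m_def)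
    from closed_orbit_dual_basis[OF this] obtain J :: "(('v \<Rightarrow> complex) \<times> ('w \<Rightarrow> complex)) set" and v where
      "finite J" "card J = char_mult m \<pi>1 \<chi>1 \<chi>2 * char_mult m \<pi>2 \<chi>1 \<chi>2"
      "\<forall>j\<in>J. v j \<in> equivariants \<and> v j (open_mat n) = 0"
      "\<forall>i\<in>J. \<forall>j\<in>J. v i (closed_mat m) j = (if i = j then 1 else 0)"
      "\<forall>f\<in>equivariants. (\<forall>j\<in>J. f (closed_mat m) j = 0) \<longrightarrow> f (closed_mat m) = 0"
      by (elim exE conjE)
    moreover have "cdim = char_mult m \<pi>1 \<chi>1 \<chi>2 * char_mult m \<pi>2 \<chi>1 \<chi>2"
      using True by (simp add: cdim_def m_def)
    ultimately show ?thesis by (intro exI[of _ J] exI[of _ v] conjI) auto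
  next
    case False
    then show ?thesis by (intro exI[of _ "{}"]) (simp add: cdim_def)
  qed
  then obtain J :: "(('v \<Rightarrow> complex) \<times> ('w \<Rightarrow> complex)) set" and v where
    J: "finite J" "card J = cdim" and v': "\<forall>j\<in>J. v j \<in> equivariants \<and> v j (open_mat n) = 0"
      "\<forall>i\<in>J. \<forall>j\<in>J. v i (closed_mat m) j = (if i = j then 1 else 0)"
      "\<forall>f\<in>equivariants. (\<forall>j\<in>J. f (closed_mat m) j = 0) \<longrightarrow> even n \<longrightarrow> f (closed_mat m) = 0"
    by (elim exE conjE)
  have v: "v j \<in> equivariants" "v j (open_mat n) = 0" if "j \<in> J" for j
    using v'(1) that by auto
  have v_dual: "v i (closed_mat m) j = (if i = j then 1 else 0)" if "i \<in> J" "j \<in> J" for i j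
    using v'(2) that by blast
  have sep: "f (closed_mat m) = 0" if "f \<in> equivariants" "\<And>j. j \<in> J \<Longrightarrow> f (closed_mat m) j = 0" "even n" for f
    using v'(3) that by blast
  have Jeven: "even n" if "j \<in> J" for j using that J by (auto simp: cdim_def split: if_splits)
  \<comment> \<open>Diagonal forms are unique up to a scalar, so evaluation at one argument
    \<open>p0\<close> where the form does not vanish already detects the whole value at
    \<open>open_mat\<close>; \<open>f0\<close> is normalised there.\<close>
  have "\<exists>f0\<in>equivariants. \<exists>p0. diag \<longrightarrow> f0 (open_mat n) p0 = 1 \<and> (\<forall>j\<in>J. f0 (closed_mat m) j = 0)
      \<and> (\<forall>f\<in>equivariants. f (open_mat n) p0 = 0 \<longrightarrow> f (open_mat n) = 0)"
  proof (cases diag)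
    case True
    then obtain B where B: "B \<in> diagonal_forms" "B \<noteq> (\<lambda>_. 0)" by (auto simp: diag_def)
    then obtain p0 where p0: "B p0 \<noteq> 0" by (metis ext)
    obtain f0 where f0: "f0 \<in> equivariants" "f0 (open_mat n) = B" "\<forall>m\<ge>1. n = m + m \<longrightarrow> f0 (closed_mat m) = 0"
      using open_lift[OF B(1)] by blast
    let ?f = "ind_scale (inverse (B p0)) f0"
    have "?f \<in> equivariants"
      by (rule ind.subspace_scale[OF equivariants_subspace f0(1)])
    moreover have "?f (open_mat n) p0 = 1" using p0 f0(2) by (simp add: ind_scale_def)
    moreover have "?f (closed_mat m) j = 0" if "j \<in> J" for j
    proof -
      have "n = m + m" "m \<ge> 1" using Jeven[OF that] n1 by (auto simp: m_def)
      then show ?thesis using f0(3) by (simp add: ind_scale_def)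
    qed
    moreover have "f (open_mat n) = 0" if f: "f \<in> equivariants" "f (open_mat n) p0 = 0" for f
    proof -
      obtain c where c: "f (open_mat n) = fun_scale c B"
        using invariant_form_unique[OF irr1 irr2 B open_value[OF f(1)] nz] by auto
      then have "c = 0" using f(2) p0 by simp
      then show ?thesis using c by simp
    qed
    ultimately show ?thesis by (intro bexI[of _ ?f] exI[of _ p0] impI conjI ballI)
  next
    case False
    \<comment> \<open>Without a nonzero diagonal form nothing is claimed about \<open>f0\<close>,
      and 0 serves as a placeholder.\<close>
    then show ?thesis using ind.subspace_0[OF equivariants_subspace] by (intro bexI[of _ 0]) auto
  qed
  then obtain f0 p0 where f0: "f0 \<in> equivariants"
    and f0': "diag \<longrightarrow> f0 (open_mat n) p0 = 1 \<and> (\<forall>j\<in>J. f0 (closed_mat m) j = 0)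
      \<and> (\<forall>f\<in>equivariants. f (open_mat n) p0 = 0 \<longrightarrow> f (open_mat n) = 0)"
    by (elim bexE exE)
  have f0_open: "f0 (open_mat n) p0 = 1" and f0_closed: "\<And>j. j \<in> J \<Longrightarrow> f0 (closed_mat m) j = 0"
    and f0_sep: "\<And>f. f \<in> equivariants \<Longrightarrow> f (open_mat n) p0 = 0 \<Longrightarrow> f (open_mat n) = 0" if diag
    using f0' that by auto
  have no_diag: "f (open_mat n) = 0" if "\<not> diag" "f \<in> equivariants" for f
    using that open_value[OF that(2)] by (auto simp: diag_def zero_fun_def)
  show "(\<exists>f\<in>equivariants. f \<noteq> 0) \<longleftrightarrow> diag \<or> cdim \<noteq> 0"
  proof
    assume "\<exists>f\<in>equivariants. f \<noteq> 0"
    then obtain f where f: "f \<in> equivariants" "f \<noteq> 0" by blast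
    show "diag \<or> cdim \<noteq> 0"
      using f cusp n1
    proof (cases rule: equivariant_nonzero_cases)
      case 1
      then show ?thesis using no_diag f(1) by blast
    next
      case (2 m')
      then have "m' = m" "even n" by (auto simp: m_def)
      then have "J \<noteq> {}" using sep[OF f(1)] 2 by auto
      then show ?thesis using J by auto
    next
      case (3 B)
      then show ?thesis by (auto simp: diag_def zero_fun_def)
    qed
  next
    assume "diag \<or> cdim \<noteq> 0"
    then show "\<exists>f\<in>equivariants. f \<noteq> 0"
    proof
      assume diag
      then have "f0 \<noteq> 0" using f0_open by auto
      then show ?thesis using f0 by blast
    next
      assume "cdim \<noteq> 0"
      then have "J \<noteq> {}" using J by auto
      then obtain j where j: "j \<in> J" by blast
      then have "v j \<noteq> 0" using v_dual[OF j j] by auto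
      then show ?thesis using v(1)[OF j] by blast
    qed
  qed
  show "vector_space.dim ind_scale equivariants = (if diag then 1 else 0) + cdim" if "n > 1"
  proof -
    \<comment> \<open>The index \<open>None\<close> stands for the open orbit and
      \<open>Some j\<close> for the coordinates of the closed one; lifts vanish at the
      representative of the other orbit, which gives duality across the two kinds.\<close>
    define S where "S = (if diag then {None} else {}) \<union> Some ` J"
    define w where "w s = (case s of None \<Rightarrow> f0 | Some j \<Rightarrow> v j)" for s
    define l where "l s f = (case s of None \<Rightarrow> f (open_mat n) p0 | Some j \<Rightarrow> f (closed_mat m) j)"
      for s :: "(('v \<Rightarrow> complex) \<times> ('w \<Rightarrow> complex)) option"
        and f :: "'f mat \<Rightarrow> ('v \<Rightarrow> complex) \<times> ('w \<Rightarrow> complex) \<Rightarrow> complex"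
    have "vector_space.dim ind_scale equivariants = card S"
    proof (rule dim_eq_card_dual[OF vector_space_ind_scale equivariants_subspace, of S w l])
      show "finite S" using J by (simp add: S_def)
      show "w s \<in> equivariants" if "s \<in> S" for s
        using that f0 v(1) by (auto simp: S_def w_def split: if_splits)
      show "lin_on equivariants ind_scale (*) (l s)" for s
        by (cases s) (simp_all add: lin_on_def l_def ind_scale_def)
      show "l t (w s) = (if s = t then 1 else 0)" if "s \<in> S" "t \<in> S" for s t
        using that f0_open f0_closed v(2) v_dual by (auto simp: S_def w_def l_def split: if_splits)
      fix f assume f: "f \<in> equivariants" and 0: "\<And>s. s \<in> S \<Longrightarrow> l s f = 0"
      have c0: "f (closed_mat m) j = 0" if "j \<in> J" for j using 0[of "Some j"] that by (simp add: S_def l_def)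
      have o0: "f (open_mat n) = 0"
      proof (cases diag)
        case True
        then show ?thesis using 0[of None] f0_sep[OF True f] by (simp add: S_def l_def)
      qed (rule no_diag[OF _ f])
      show "f = 0"
      proof (rule ccontr)
        assume "f \<noteq> 0"
        with f show False using cusp n1
        proof (cases rule: equivariant_nonzero_cases)
          case (2 m')
          then have "m' = m" "even n" by (auto simp: m_def)
          then show False using sep[OF f c0] 2 by simp
        qed (use o0 \<open>n > 1\<close> in auto)
      qed
    qed
    also have "card S = (if diag then 1 else 0) + cdim"
      unfolding S_def using J by (subst card_Un_disjoint) (auto simp: card_image)
    finally show ?thesis .
  qed
qed

end

theorem proposition3p1:
  fixes n :: nat
    and \<pi>1 :: "('f::{field,finite} mat, 'v::ab_group_add) rep"
    and \<pi>2 :: "('f mat, 'w::ab_group_add) rep"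
    and \<chi>1 \<chi>2 :: "'f \<Rightarrow> complex"
  assumes "n \<ge> 1"
    and "irreducible_rep (GL n) \<pi>1" and "cuspidal n \<pi>1"
    and "irreducible_rep (GL n) \<pi>2" and "cuspidal n \<pi>2"
    and "\<chi>1 \<in> hom field_units field_units" and "\<chi>2 \<in> hom field_units field_units"
  shows
    "let cond1 = iso_rep (GL n) (dual_rep (GL n) (twist \<pi>1 (\<lambda>x. inverse (\<chi>1 x))))
                   (twist \<pi>2 (\<lambda>x. inverse (\<chi>2 x)));
         cond2 = (\<exists>m. n = 2 * m \<and>
                   (\<exists>v\<in>char_vectors m \<pi>1 \<chi>1 \<chi>2. v \<noteq> 0) \<and>
                   (\<exists>v\<in>char_vectors m \<pi>2 \<chi>1 \<chi>2. v \<noteq> 0))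
     in ((\<exists>v\<in>char_vectors n (ind_prod n \<pi>1 \<pi>2) \<chi>1 \<chi>2. v \<noteq> 0) \<longleftrightarrow> cond1 \<or> cond2) \<and>
        (n > 1 \<longrightarrow>
           vector_space.dim (rep_scale (ind_prod n \<pi>1 \<pi>2)) (char_vectors n (ind_prod n \<pi>1 \<pi>2) \<chi>1 \<chi>2)
           = (if cond1 then 1 else 0) +
             (if cond2 then char_mult (n div 2) \<pi>1 \<chi>1 \<chi>2 * char_mult (n div 2) \<pi>2 \<chi>1 \<chi>2 else 0))"
proof -
  interpret induced_pair n \<pi>1 \<pi>2 \<chi>1 \<chi>2
    using assms by (simp add: induced_pair_def irreducible_rep_def)
  let ?cond2 = "\<exists>m. n = 2 * m \<and> (\<exists>v\<in>char_vectors m \<pi>1 \<chi>1 \<chi>2. v \<noteq> 0) \<and> (\<exists>v\<in>char_vectors m \<pi>2 \<chi>1 \<chi>2. v \<noteq> 0)"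
  let ?mult = "char_mult (n div 2) \<pi>1 \<chi>1 \<chi>2 * char_mult (n div 2) \<pi>2 \<chi>1 \<chi>2"
  \<comment> \<open>A product of multiplicities is nonzero exactly if both representations contain
    an eigenvector.\<close>
  have cond2: "?cond2 \<longleftrightarrow> even n \<and> ?mult \<noteq> 0"
  proof (cases "even n")
    case True
    then have n: "n = n div 2 + n div 2" "n div 2 \<ge> 1" using assms(1) by auto
    have "?cond2 \<longleftrightarrow> (\<exists>v\<in>char_vectors (n div 2) \<pi>1 \<chi>1 \<chi>2. v \<noteq> 0) \<and> (\<exists>v\<in>char_vectors (n div 2) \<pi>2 \<chi>1 \<chi>2. v \<noteq> 0)"
    proof -
      have "n = 2 * m \<longleftrightarrow> m = n div 2" for m using True by auto
      then show ?thesis by simp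
    qed
    then show ?thesis
      using True char_mult_nonzero_iff[OF n rep1] char_mult_nonzero_iff[OF n rep2] by simp
  qed auto
  then have mult: "(if even n then ?mult else 0) = (if ?cond2 then ?mult else 0)" by auto
  note dim = equivariants_dim[OF assms(2,4,5,1), folded iso_dual_twist_iff[OF assms(2,4,6,7)]]
  show ?thesis
    unfolding Let_def char_vectors_ind_prod rep_scale_ind_prod
    using dim cond2 unfolding mult by auto
qed

end
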